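(* Suppose that the diffusion coefficient has the affine representation $$a(x,\mathbf y)=a_0(x)+\sum_{m=1}^M a_m(x)\,y_m\qquad\text{for all }x\in D,\ \mathbf y\in\Gamma=[-1,1]^M.$$ If the expansion coefficients $a_m\in L^\infty(D)$, $m=0,1,\dots,M$, satisfy the uniform ellipticity assumption, i.e., there exists $r>0$ such that $\sum_{m=1}^M|a_m(x)|\le a_0(x)-r$ for all $x\in D$, then there exist positive constants $a_{\min},a_{\max}$ such that $$0<a_{\min}\le\operatorname*{ess\,inf}_{x\in D}a(x,\mathbf y)\le\operatorname*{ess\,sup}_{x\in D}a(x,\mathbf y)\le a_{\max}<\infty\qquad\pi\text{-a.e. on }\Gamma,$$ and the Taylor coefficients $w_{\mathbf i}$ of the semidiscrete approximations $w$ satisfy the following summability property: there exists $\boldsymbol\rho=[\rho_1,\dots,\rho_M]$ with $\rho_m>1$ for all $m$ such that $$\big(\boldsymbol\rho^{\mathbf i}\|w_{\mathbf i}\|_{\mathbb X}\big)_{\mathbf i\in\mathbb N_0^M}\in l^2(\mathbb N_0^M)\quad\text{and}\quad\sum_{\mathbf i\in\mathbb N_0^M}\boldsymbol\rho^{2\mathbf i}\|w_{\mathbf i}\|_{\mathbb X}^2\le C<\infty,$$ where $C$ is independent of the underlying finite element space $\mathbb W$.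
   Context: $D\subset\mathbb R^d$ ($d=2,3$) is a bounded Lipschitz domain with polytopal boundary; $M\in\mathbb N$; $\Gamma=[-1,1]^M$; $\pi=\prod_{m=1}^M\pi_m$ is a product of Borel probability measures on $[-1,1]$; $f\in L^2(D)$; $\mathbb X=H^1_0(D)$ with $\|v\|_{\mathbb X}=\|\nabla v\|_{L^2(D)}$. Notation: $\boldsymbol\rho^{\mathbf i}=\prod_m\rho_m^{i_m}$, $\mathbf i!=\prod_m i_m!$. Finite element spaces: $\mathcal T_0$ is an initial conforming simplicial mesh of $D$, and $\mathbb W=\{v\in H^1_0(D):v|_T\text{ is affine for all }T\in\mathcal T\}$ where $\mathcal T$ is $\mathcal T_0$ or any mesh obtained from $\mathcal T_0$ by newest vertex bisection refinement. The semidiscrete approximation $w:\Gamma\to\mathbb W$ is defined by $$\int_Da(x,\mathbf y)\nabla w(x,\mathbf y)\cdot\nabla v(x)\,dx=\int_Df(x)v(x)\,dx\quad\forall v\in\mathbb W,\ \mathbf y\in\Gamma,$$ and its Taylor coefficients are $w_{\mathbf i}(x)=\frac1{\mathbf i!}\frac{\partial^{\mathbf i}w(x,\mathbf y)}{\partial\mathbf y^{\mathbf i}}\big|_{\mathbf y=\mathbf 0}$, $\mathbf i\in\mathbb N_0^M$. Standing assumption in the paper: $\pi$-a.e. on $\Gamma$, $w(x,\mathbf y)=\sum_{\mathbf i\in\mathbb N_0^M}w_{\mathbf i}(x)\mathbf y^{\mathbf i}=\sum_{\boldsymbol\nu\in\mathbb N^M}[\Delta^{\boldsymbol\kappa(\boldsymbol\nu)}w](x,\mathbf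 y)$, where $\Delta^{\boldsymbol\kappa(\boldsymbol\nu)}=\bigotimes_{m=1}^M\big(I_m^{\kappa(\nu_m)}-I_m^{\kappa(\nu_m-1)}\big)$, $I_m^{n}$ is univariate Lagrange interpolation in $y_m$ at $n$ nested nodes in $[-1,1]$ (Leja points with $\kappa(i)=i$, or Clenshaw–Curtis points with $\kappa(0)=0,\kappa(1)=1,\kappa(i)=2^{i-1}+1$ for $i>1$), and $I_m^0=0$. "$C$ independent of the finite element space" means that the same $\boldsymbol\rho$ and $C$ can be used for all admissible $\mathbb W$ (they depend only on the problem data). *)

theory Defs
  imports "HOL-Probability.Probability"
begin

section \<open>Domains\<close>

text \<open>Near every boundary point the set lies strictly above the graph of a Lipschitz function
  over the hyperplane orthogonal to a unit vector e.\<close>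

definition lipschitz_boundary :: "'a::euclidean_space set \<Rightarrow> bool" where
  "lipschitz_boundary D \<longleftrightarrow>
     (\<forall>p\<in>frontier D. \<exists>s>0. \<exists>e. norm e = 1 \<and>
        (\<exists>\<phi> :: 'a \<Rightarrow> real. \<exists>L. L-lipschitz_on {z. z \<bullet> e = 0} \<phi> \<and>
           D \<inter> ball p s = {x \<in> ball p s. \<phi> (x - (x \<bullet> e) *\<^sub>R e) < x \<bullet> e}))"

definition polytopal_boundary :: "'a::euclidean_space set \<Rightarrow> bool" where
  "polytopal_boundary D \<longleftrightarrow>
     (\<exists>\<F>. finite \<F> \<and> (\<forall>F\<in>\<F>. polytope F \<and> aff_dim F = int DIM('a) - 1) \<and>
          frontier D = \<Union>\<F>)"

definition polytopal_lipschitz_domain :: "'a::euclidean_space set \<Rightarrow> bool" where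
  "polytopal_lipschitz_domain D \<longleftrightarrow>
     D \<noteq> {} \<and> open D \<and> connected D \<and> bounded D \<and> lipschitz_boundary D \<and> polytopal_boundary D"


section \<open>Lebesgue and Sobolev spaces\<close>

text \<open>Elements of these spaces are represented by functions, not by classes modulo null sets;
  values outside \<^term>\<open>D\<close> are irrelevant.\<close>

definition L2 :: "'a::euclidean_space set \<Rightarrow> ('a \<Rightarrow> 'b::euclidean_space) set" where
  "L2 D = {v. v \<in> borel_measurable (lebesgue_on D) \<and>
              integrable (lebesgue_on D) (\<lambda>x. (norm (v x))\<^sup>2)}"

definition L2_norm_on :: "'a::euclidean_space set \<Rightarrow> ('a \<Rightarrow> 'b::euclidean_space) \<Rightarrow> real" where
  "L2_norm_on D v = sqrt (LINT x|lebesgue_on D. (norm (v x))\<^sup>2)"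

definition Linf :: "'a::euclidean_space set \<Rightarrow> ('a \<Rightarrow> real) set" where
  "Linf D = {v. v \<in> borel_measurable (lebesgue_on D) \<and>
                (\<exists>B. AE x in lebesgue_on D. \<bar>v x\<bar> \<le> B)}"

fun cont_diff :: "nat \<Rightarrow> ('a::euclidean_space \<Rightarrow> real) \<Rightarrow> bool" where
  "cont_diff 0 \<phi> \<longleftrightarrow> continuous_on UNIV \<phi>"
| "cont_diff (Suc k) \<phi> \<longleftrightarrow>
     (\<forall>x. \<phi> differentiable (at x)) \<and>
     (\<forall>b\<in>Basis. cont_diff k (\<lambda>x. frechet_derivative \<phi> (at x) b))"

definition test_functions :: "'a::euclidean_space set \<Rightarrow> ('a \<Rightarrow> real) set" where
  "test_functions D =
     {\<phi>. (\<forall>k. cont_diff k \<phi>) \<and> (\<exists>K. compact K \<and> K \<subseteq> D \<and> (\<forall>x. x \<notin> K \<longrightarrow> \<phi> x = 0))}"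

definition has_weak_gradient ::
    "'a::euclidean_space set \<Rightarrow> ('a \<Rightarrow> real) \<Rightarrow> ('a \<Rightarrow> 'a) \<Rightarrow> bool" where
  "has_weak_gradient D v g \<longleftrightarrow>
     (\<forall>\<phi>\<in>test_functions D. \<forall>b\<in>Basis.
        (LINT x|lebesgue_on D. v x * frechet_derivative \<phi> (at x) b) =
        - (LINT x|lebesgue_on D. (g x \<bullet> b) * \<phi> x))"

definition H1 :: "'a::euclidean_space set \<Rightarrow> ('a \<Rightarrow> real) set" where
  "H1 D = {v \<in> L2 D. \<exists>g\<in>L2 D. has_weak_gradient D v g}"

text \<open>Weak gradients are unique only up to null sets, which no integral below can detect.\<close>

definition weak_gradient :: "'a::euclidean_space set \<Rightarrow> ('a \<Rightarrow> real) \<Rightarrow> 'a \<Rightarrow> 'a" where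
  "weak_gradient D v = (SOME g. g \<in> L2 D \<and> has_weak_gradient D v g)"

definition H1_norm :: "'a::euclidean_space set \<Rightarrow> ('a \<Rightarrow> real) \<Rightarrow> real" where
  "H1_norm D v = sqrt ((L2_norm_on D v)\<^sup>2 + (L2_norm_on D (weak_gradient D v))\<^sup>2)"

definition H10 :: "'a::euclidean_space set \<Rightarrow> ('a \<Rightarrow> real) set" where
  "H10 D = {v \<in> H1 D. \<exists>\<phi> :: nat \<Rightarrow> 'a \<Rightarrow> real. (\<forall>n. \<phi> n \<in> test_functions D) \<and>
                        (\<lambda>n. H1_norm D (\<lambda>x. v x - \<phi> n x)) \<longlonglongrightarrow> 0}"

definition X_norm :: "'a::euclidean_space set \<Rightarrow> ('a \<Rightarrow> real) \<Rightarrow> real" where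
  "X_norm D v = L2_norm_on D (weak_gradient D v)"

text \<open>Counterpart of the library's \<^const>\<open>esssup\<close>.\<close>

definition essinf :: "'a measure \<Rightarrow>
    ('a \<Rightarrow> 'b::{second_countable_topology, dense_linorder, linorder_topology, complete_linorder}) \<Rightarrow> 'b" where
  "essinf M f = (if f \<in> borel_measurable M then Liminf (ae_filter M) f else bot)"


section \<open>Meshes and finite element spaces\<close>

definition conforming_mesh :: "'a::euclidean_space set \<Rightarrow> 'a set set \<Rightarrow> bool" where
  "conforming_mesh D \<T> \<longleftrightarrow>
     triangulation \<T> \<and> (\<forall>T\<in>\<T>. int DIM('a) simplex T) \<and> \<Union>\<T> = closure D"

text \<open>Newest vertex bisection in arbitrary dimension d (Maubach, Traxler, Stevenson) acts on tagged
  simplices: an ordered vertex list \<open>[z\<^sub>0, \<dots>, z\<^sub>d]\<close> with a type \<open>\<gamma> < d\<close>. The refinement edge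
  joins \<open>z\<^sub>0\<close> and \<open>z\<^sub>d\<close>; with \<open>z\<close> its midpoint, the children are
  \<open>[z\<^sub>0, z, z\<^sub>1, \<dots>, z\<^sub>d\<^sub>-\<^sub>1]\<close> and
  \<open>[z\<^sub>d, z, z\<^sub>1, \<dots>, z\<^sub>\<gamma>, z\<^sub>d\<^sub>-\<^sub>1, \<dots>, z\<^sub>\<gamma>\<^sub>+\<^sub>1]\<close>, both of type \<open>(\<gamma> + 1) mod d\<close>. For d = 2 the type
  plays no role, and the refinement edge is the one opposite the newest vertex \<open>z\<^sub>1\<close>.\<close>

type_synonym 'a tagged_simplex = "'a list \<times> nat"

definition simplex_of :: "'a::euclidean_space tagged_simplex \<Rightarrow> 'a set" where
  "simplex_of t = convex hull (set (fst t))"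

definition bisect :: "'a::euclidean_space tagged_simplex \<Rightarrow> 'a tagged_simplex set" where
  "bisect t =
     (let zs = fst t; \<gamma> = snd t; d = length zs - 1;
          z = midpoint (hd zs) (last zs);
          mid = butlast (tl zs);
          \<gamma>' = (\<gamma> + 1) mod d
      in {(hd zs # z # mid, \<gamma>'), (last zs # z # take \<gamma> mid @ rev (drop \<gamma> mid), \<gamma>')})"

definition initial_mesh :: "'a::euclidean_space set \<Rightarrow> 'a tagged_simplex set \<Rightarrow> bool" where
  "initial_mesh D \<T>0 \<longleftrightarrow>
     (\<forall>(zs, \<gamma>)\<in>\<T>0. length zs = DIM('a) + 1 \<and> distinct zs \<and> \<not> affine_dependent (set zs) \<and>
                    \<gamma> < DIM('a)) \<and>
     inj_on simplex_of \<T>0 \<and> conforming_mesh D (simplex_of ` \<T>0)"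

inductive bisection_refinement ::
    "'a::euclidean_space tagged_simplex set \<Rightarrow> 'a tagged_simplex set \<Rightarrow> bool" for \<T>0 where
  initial: "bisection_refinement \<T>0 \<T>0"
| bisect: "\<lbrakk>bisection_refinement \<T>0 \<S>; t \<in> \<S>\<rbrakk> \<Longrightarrow> bisection_refinement \<T>0 ((\<S> - {t}) \<union> bisect t)"

text \<open>Conformity is imposed on the refined mesh only: completing a set of marked bisections to a
  conforming mesh passes through meshes with hanging nodes.\<close>

definition admissible_mesh ::
    "'a::euclidean_space set \<Rightarrow> 'a tagged_simplex set \<Rightarrow> 'a set set \<Rightarrow> bool" where
  "admissible_mesh D \<T>0 \<T> \<longleftrightarrow>
     (\<exists>\<S>. bisection_refinement \<T>0 \<S> \<and> \<T> = simplex_of ` \<S>) \<and> conforming_mesh D \<T>"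

text \<open>The elements are closed, so being affine on each of them makes the functions continuous on
  \<^term>\<open>closure D\<close> and selects the continuous representative in \<^term>\<open>H10 D\<close>. Hence
  pointwise values at \<^term>\<open>x \<in> D\<close> are meaningful.\<close>

definition fe_space :: "'a::euclidean_space set \<Rightarrow> 'a set set \<Rightarrow> ('a \<Rightarrow> real) set" where
  "fe_space D \<T> = {v \<in> H10 D. \<forall>T\<in>\<T>. \<exists>g c. \<forall>x\<in>T. v x = g \<bullet> x + c}"


section \<open>Parametric problem and Taylor coefficients\<close>

definition param_domain :: "nat \<Rightarrow> (nat \<Rightarrow> real) set" where
  "param_domain M = {1..M} \<rightarrow>\<^sub>E {-1..1}"

definition semidiscrete_solution ::
    "'a::euclidean_space set \<Rightarrow> nat \<Rightarrow> ('a \<Rightarrow> (nat \<Rightarrow> real) \<Rightarrow> real) \<Rightarrow> ('a \<Rightarrow> real) \<Rightarrow>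
     ('a \<Rightarrow> real) set \<Rightarrow> ((nat \<Rightarrow> real) \<Rightarrow> 'a \<Rightarrow> real) \<Rightarrow> bool" where
  "semidiscrete_solution D M a f W w \<longleftrightarrow>
     (\<forall>y\<in>param_domain M. w y \<in> W \<and>
        (\<forall>v\<in>W. (LINT x|lebesgue_on D. a x y * (weak_gradient D (w y) x \<bullet> weak_gradient D v x)) =
                (LINT x|lebesgue_on D. f x * v x)))"

definition multi_indices :: "nat \<Rightarrow> (nat \<Rightarrow> nat) set" where
  "multi_indices M = {1..M} \<rightarrow>\<^sub>E UNIV"

definition multi_power :: "nat \<Rightarrow> (nat \<Rightarrow> real) \<Rightarrow> (nat \<Rightarrow> nat) \<Rightarrow> real" where
  "multi_power M \<rho> i = (\<Prod>m=1..M. \<rho> m ^ i m)"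

definition multi_fact :: "nat \<Rightarrow> (nat \<Rightarrow> nat) \<Rightarrow> real" where
  "multi_fact M i = (\<Prod>m=1..M. fact (i m))"

definition partial_deriv ::
    "nat \<Rightarrow> nat \<Rightarrow> ((nat \<Rightarrow> real) \<Rightarrow> real) \<Rightarrow> (nat \<Rightarrow> real) \<Rightarrow> real" where
  "partial_deriv m k g = (\<lambda>y. (deriv ^^ k) (\<lambda>t. g (y(m := t))) (y m))"

definition mixed_partial ::
    "nat \<Rightarrow> (nat \<Rightarrow> nat) \<Rightarrow> ((nat \<Rightarrow> real) \<Rightarrow> real) \<Rightarrow> (nat \<Rightarrow> real) \<Rightarrow> real" where
  "mixed_partial M i g = foldr (\<lambda>m. partial_deriv m (i m)) [1..<Suc M] g"

definition taylor_coeff ::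
    "nat \<Rightarrow> ((nat \<Rightarrow> real) \<Rightarrow> 'a \<Rightarrow> real) \<Rightarrow> (nat \<Rightarrow> nat) \<Rightarrow> 'a \<Rightarrow> real" where
  "taylor_coeff M w i x = mixed_partial M i (\<lambda>y. w y x) (\<lambda>m\<in>{1..M}. 0) / multi_fact M i"

end

theory Submission
  imports Defs
begin

text \<open>Inserting the power series into the variational problem gives the recursion
  \<open>\<integral> a\<^sub>0 \<nabla>w\<^sub>i \<bullet> \<nabla>v = - \<Sum>\<^sub>m \<integral> a\<^sub>m \<nabla>w\<^bsub>i - e\<^sub>m\<^esub> \<bullet> \<nabla>v\<close> over the \<open>m\<close> with \<open>i\<^sub>m > 0\<close>.
  Choose \<open>\<rho>\<^sub>m > 1\<close> and \<open>\<theta> < 1\<close> with \<open>\<Sum>\<^sub>m \<rho>\<^sub>m \<bar>a\<^sub>m\<bar> \<le> \<theta> a\<^sub>0\<close> almost everywhere, take \<open>v = \<rho>\<^bsup>2i\<^esup> w\<^sub>i\<close> and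
  apply Young's inequality under the integral: the energies
  \<open>E\<^sub>k = \<Sum>\<^bsub>\<bar>i\<bar> = k\<^esub> \<rho>\<^bsup>2i\<^esup> \<integral> a\<^sub>0 \<bar>\<nabla>w\<^sub>i\<bar>\<^sup>2\<close> satisfy \<open>(2 - \<theta>) E\<^bsub>k + 1\<^esub> \<le> \<theta> E\<^sub>k\<close>, so they are summable
  with a bound that depends on \<open>E\<^sub>0\<close> only, and Poincare's inequality bounds \<open>E\<^sub>0\<close> by the data.

  That the Taylor coefficients, which are pointwise iterated derivatives, do satisfy the recursion
  is seen backwards: the series with coefficients defined by the recursion converges on the parameter
  domain and solves the finite-dimensional problem, hence equals the solution by uniqueness.\<close>

subsection \<open>Test functions\<close>

text \<open>Weak gradients are determined up to null sets, whereas a Taylor coefficient is a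
  derivative of \<open>w y x\<close> at each single point \<open>x\<close>. The link is that a
  finite element function which vanishes almost everywhere vanishes at every point of
  \<open>D\<close>, and that it is determined by its values at finitely many vertices. Hence there
  is a finite basis, orthonormal for the form with weight \<open>ac 0\<close>, in which identities
  can be read pointwise. In such a basis the system matrix at \<open>y = 0\<close> is the identity,
  and no estimate depends on the number of basis functions. Ellipticity bounds the sum of the moduli
  of the coefficients point by point. Norms of the single \<open>ac m\<close> would lose this, so
  the weights stay under the integral throughout. The solution is given on the real cube only. The
  expansion is therefore obtained there, from the decay of the coefficients and from uniqueness,
  without extending the parameters to complex values.\<close>

lemma cont_diff_SucD: "cont_diff (Suc k) \<phi> \<Longrightarrow> cont_diff k \<phi>"
proof (induction k arbitrary: \<phi>)
  case 0
  then show ?case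
    by (auto simp: continuous_on_eq_continuous_at intro: differentiable_imp_continuous_within)
next
  case (Suc k)
  then show ?case by (metis cont_diff.simps(2))
qed

lemma cont_diff_const: "cont_diff k (\<lambda>x. c)"
  by (induction k arbitrary: c) (auto simp: frechet_derivative_const)

lemma cont_diff_inner: "cont_diff k (\<lambda>x. x \<bullet> a)"
proof (cases k)
  case (Suc l)
  have d: "((\<lambda>x. x \<bullet> a) has_derivative (\<lambda>h. h \<bullet> a)) (at x)" for x :: 'a
    by (intro derivative_eq_intros | simp)+
  then have "frechet_derivative (\<lambda>x. x \<bullet> a) (at x) = (\<lambda>h. h \<bullet> a)" for x :: 'a
    by (metis frechet_derivative_at)
  with d Suc show ?thesis
    by (auto simp: cont_diff_const intro: differentiableI)
qed (auto intro!: continuous_intros)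

lemma cont_diff_add:
  "cont_diff k \<phi> \<Longrightarrow> cont_diff k \<psi> \<Longrightarrow> cont_diff k (\<lambda>x. \<phi> x + \<psi> x)"
proof (induction k arbitrary: \<phi> \<psi>)
  case (Suc k)
  then have "frechet_derivative (\<lambda>x. \<phi> x + \<psi> x) (at x) =
    (\<lambda>h. frechet_derivative \<phi> (at x) h + frechet_derivative \<psi> (at x) h)" for x
    by (intro frechet_derivative_at [symmetric] has_derivative_add)
      (auto simp: frechet_derivative_works [symmetric])
  with Suc show ?case by auto
qed (auto intro: continuous_intros)

lemma cont_diff_mult:
  "cont_diff k \<phi> \<Longrightarrow> cont_diff k \<psi> \<Longrightarrow> cont_diff k (\<lambda>x. \<phi> x * \<psi> x)"
proof (induction k arbitrary: \<phi> \<psi>)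
  case (Suc k)
  then have "frechet_derivative (\<lambda>x. \<phi> x * \<psi> x) (at x) =
    (\<lambda>h. \<phi> x * frechet_derivative \<psi> (at x) h + frechet_derivative \<phi> (at x) h * \<psi> x)" for x
    by (intro frechet_derivative_at [symmetric] has_derivative_mult)
      (auto simp: frechet_derivative_works [symmetric])
  with Suc show ?case
    \<comment> \<open>The product rule leaves one factor undifferentiated, and the induction
      hypothesis needs that factor at the lower order \<open>k\<close>.\<close>
    using cont_diff_SucD [OF Suc.prems(1)] cont_diff_SucD [OF Suc.prems(2)]
    by (auto intro!: cont_diff_add Suc.IH)
qed (auto intro: continuous_intros)

lemma cont_diff_prod:
  "(\<And>i. i \<in> I \<Longrightarrow> cont_diff k (\<phi> i)) \<Longrightarrow> cont_diff k (\<lambda>x. \<Prod>i\<in>I. \<phi> i x)"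
  by (induction I rule: infinite_finite_induct) (auto intro: cont_diff_const cont_diff_mult)

section \<open>Flat exponentials and smooth bumps on boxes\<close>

definition exp_flat :: "real poly \<Rightarrow> real \<Rightarrow> real" where
  "exp_flat p t = (if t > 0 then poly p (inverse t) * exp (- inverse t) else 0)"

lemma poly_times_exp_neg_tendsto_0: "((\<lambda>s::real. poly p s * exp (- s)) \<longlongrightarrow> 0) at_top"
proof -
  have "((\<lambda>s::real. \<Sum>i\<le>degree p. coeff p i * (s ^ i / exp s)) \<longlongrightarrow> (\<Sum>i\<le>degree p. coeff p i * 0)) at_top"
    by (intro tendsto_intros tendsto_power_div_exp_0)
  then show ?thesis
    by (simp add: poly_altdef exp_minus sum_distrib_right divide_inverse mult.assoc)
qed

text \<open>Differentiating p(1/t) exp(-1/t) gives t^(-2) (p - p')(1/t) exp(-1/t), and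
  \<open>[:0, 0, 1:]\<close> is the polynomial X^2. The family is thus closed under derivatives,
  which is why a polynomial is carried along: smoothness of the classical flat function, the case p
  = 1, becomes an induction over all p at once.\<close>

lemma exp_flat_has_derivative:
  "(exp_flat p has_real_derivative exp_flat ([:0, 0, 1:] * (p - pderiv p)) t) (at t)"
proof -
  consider "t < 0" | "t = 0" | "t > 0" by linarith
  then show ?thesis
  proof cases
    case 1
    have "((\<lambda>t::real. 0) has_real_derivative 0) (at t)" by simp
    then show ?thesis
      using 1 has_field_derivative_transform_within_open [of "\<lambda>t. 0" 0 t "{..<0}" "exp_flat p"]
      by (auto simp: exp_flat_def)
  next
    case 3
    have "((\<lambda>t. poly p (inverse t) * exp (- inverse t)) has_real_derivative
        exp_flat ([:0, 0, 1:] * (p - pderiv p)) t) (at t)"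
      using 3 by (auto intro!: derivative_eq_intros simp: exp_flat_def field_simps power2_eq_square)
    then show ?thesis
      by (rule has_field_derivative_transform_within_open [where S = "{0<..}"])
        (use 3 in \<open>auto simp: exp_flat_def\<close>)
  next
    case 2
    \<comment> \<open>\<open>pCons 0 p\<close> is X p; its extra factor 1/t is the denominator of
      the difference quotient at 0.\<close>
    have "((\<lambda>t. poly (pCons 0 p) (inverse t) * exp (- inverse t)) \<longlongrightarrow> 0) (at_right 0)"
      by (rule filterlim_compose [OF poly_times_exp_neg_tendsto_0 filterlim_inverse_at_top_right])
    then have "((\<lambda>t. exp_flat p t / t) \<longlongrightarrow> 0) (at_right 0)"
      by (rule Lim_transform_eventually)
        (auto simp: eventually_at_filter exp_flat_def divide_inverse intro!: always_eventually)
    moreover have "((\<lambda>t. exp_flat p t / t) \<longlongrightarrow> 0) (at_left 0)"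
      by (rule Lim_transform_eventually [OF tendsto_const])
        (auto simp: eventually_at_filter exp_flat_def intro!: always_eventually)
    ultimately have "((\<lambda>t. exp_flat p t / t) \<longlongrightarrow> 0) (at 0)"
      by (simp add: filterlim_split_at)
    then show ?thesis
      using 2 by (simp add: has_field_derivative_iff exp_flat_def)
  qed
qed

lemma cont_diff_exp_flat: "cont_diff k (\<lambda>x. exp_flat p (\<alpha> * (x \<bullet> a) + \<beta>))"
proof (induction k arbitrary: p)
  case 0
  have "continuous_on UNIV (exp_flat p)"
    by (intro continuous_at_imp_continuous_on ballI DERIV_isCont [OF exp_flat_has_derivative])
  then show ?case
    by (auto intro!: continuous_on_compose2 [of UNIV "exp_flat p"] continuous_intros)
next
  case (Suc k)
  let ?q = "[:0, 0, 1:] * (p - pderiv p)"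
  have d: "((\<lambda>x. exp_flat p (\<alpha> * (x \<bullet> a) + \<beta>)) has_derivative
      (\<lambda>h. \<alpha> * (h \<bullet> a) * exp_flat ?q (\<alpha> * (x \<bullet> a) + \<beta>))) (at x)" for x :: 'a
  proof -
    have "((\<lambda>x. \<alpha> * (x \<bullet> a) + \<beta>) has_derivative (\<lambda>h. \<alpha> * (h \<bullet> a))) (at x)"
      by (intro derivative_eq_intros | simp)+
    from has_derivative_compose [OF this exp_flat_has_derivative [THEN has_field_derivative_imp_has_derivative]]
    show ?thesis by (simp add: mult.commute o_def)
  qed
  then have "frechet_derivative (\<lambda>x. exp_flat p (\<alpha> * (x \<bullet> a) + \<beta>)) (at x) =
      (\<lambda>h. \<alpha> * (h \<bullet> a) * exp_flat ?q (\<alpha> * (x \<bullet> a) + \<beta>))" for x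
    by (metis frechet_derivative_at)
  with d Suc show ?case
    by (auto intro!: cont_diff_mult cont_diff_const intro: differentiableI)
qed

section \<open>Algebraic operations and derivatives of test functions\<close>

lemma test_functions_add:
  assumes "\<phi> \<in> test_functions D" "\<psi> \<in> test_functions D"
  shows "(\<lambda>x. \<phi> x + \<psi> x) \<in> test_functions D"
proof -
  from assms obtain K L where "compact K" "K \<subseteq> D" "\<And>x. x \<notin> K \<Longrightarrow> \<phi> x = 0"
    "compact L" "L \<subseteq> D" "\<And>x. x \<notin> L \<Longrightarrow> \<psi> x = 0"
    by (auto simp: test_functions_def)
  then show ?thesis
    using assms by (auto simp: test_functions_def cont_diff_add intro!: exI [of _ "K \<union> L"])
qed

lemma test_functions_mult:
  assumes "\<And>k. cont_diff k \<phi>" "\<psi> \<in> test_functions D"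
  shows "(\<lambda>x. \<phi> x * \<psi> x) \<in> test_functions D"
  using assms by (force simp: test_functions_def cont_diff_mult)

lemma test_functions_cont_diff: "\<phi> \<in> test_functions D \<Longrightarrow> cont_diff k \<phi>"
  by (simp add: test_functions_def)

lemma test_functions_scale:
  "\<phi> \<in> test_functions D \<Longrightarrow> (\<lambda>x. c * \<phi> x) \<in> test_functions D"
  by (intro test_functions_mult cont_diff_const)

lemma test_functions_zero: "(\<lambda>x. 0) \<in> test_functions D"
  by (auto simp: test_functions_def cont_diff_const intro!: exI [of _ "{}"])

lemma test_functions_derivative:
  assumes "\<phi> \<in> test_functions D"
  shows "(\<phi> has_derivative frechet_derivative \<phi> (at x)) (at x)"
  using test_functions_cont_diff [OF assms, of 1]
  by (simp add: frechet_derivative_works [symmetric])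

lemma test_functions_continuous: "\<phi> \<in> test_functions D \<Longrightarrow> continuous_on UNIV \<phi>"
  using test_functions_cont_diff [of \<phi> D 0] by simp

lemma test_functions_derivative_continuous:
  "\<phi> \<in> test_functions D \<Longrightarrow> b \<in> Basis \<Longrightarrow> continuous_on UNIV (\<lambda>x. frechet_derivative \<phi> (at x) b)"
  using test_functions_cont_diff [of \<phi> D 1] by simp

text \<open>For \<open>n \<rightarrow> \<infinity>\<close> these test functions tend to the indicator of the open box,
  because \<open>exp (- 1 / (n s)) \<rightarrow> 1\<close> for \<open>s > 0\<close>.\<close>

definition box_bump :: "'a::euclidean_space \<Rightarrow> 'a \<Rightarrow> nat \<Rightarrow> 'a \<Rightarrow> real" where
  "box_bump c d n x = (\<Prod>b\<in>Basis. exp_flat 1 (real n * (x \<bullet> b) + - real n * (c \<bullet> b)) *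
     exp_flat 1 (- real n * (x \<bullet> b) + real n * (d \<bullet> b)))"

lemma exp_flat_1_bounds: "0 \<le> exp_flat 1 t" "exp_flat 1 t \<le> 1"
  by (auto simp: exp_flat_def)

lemma box_bump_bounds: "0 \<le> box_bump c d n x" "box_bump c d n x \<le> 1"
  by (auto simp: box_bump_def exp_flat_1_bounds intro!: prod_nonneg prod_le_1 mult_le_one)

lemma box_bump_eq_0: 
  assumes "x \<notin> box c d"
  shows "box_bump c d n x = 0"
proof -
  from assms obtain b where b: "b \<in> Basis" "x \<bullet> b \<le> c \<bullet> b \<or> d \<bullet> b \<le> x \<bullet> b"
    by (auto simp: mem_box not_less)
  then have "real n * (x \<bullet> b) \<le> real n * (c \<bullet> b) \<or> real n * (d \<bullet> b) \<le> real n * (x \<bullet> b)"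
    by (meson mult_left_mono of_nat_0_le_iff)
  then have "exp_flat 1 (real n * (x \<bullet> b) + - real n * (c \<bullet> b)) *
     exp_flat 1 (- real n * (x \<bullet> b) + real n * (d \<bullet> b)) = 0"
    by (auto simp: exp_flat_def)
  with b(1) show ?thesis
    unfolding box_bump_def by (intro prod_zero) auto
qed

lemma box_bump_test_function:
  assumes "cbox c d \<subseteq> D"
  shows "box_bump c d n \<in> test_functions D"
proof -
  have "cont_diff k (box_bump c d n)" for k
    unfolding box_bump_def by (intro cont_diff_prod cont_diff_mult cont_diff_exp_flat)
  then show ?thesis
    using assms box_subset_cbox [of c d]
    by (auto simp: test_functions_def intro!: exI [of _ "cbox c d"] box_bump_eq_0)
qed

lemma exp_flat_1_tendsto:
  assumes "s > 0"
  shows "(\<lambda>n. exp_flat 1 (real n * s)) \<longlonglongrightarrow> 1"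
proof -
  have "(\<lambda>n. exp (- (inverse (real n) * inverse s))) \<longlonglongrightarrow> exp (- (0 * inverse s))"
    by (intro tendsto_intros lim_inverse_n)
  then have "(\<lambda>n. exp (- inverse (real n * s))) \<longlonglongrightarrow> 1"
    by (simp add: inverse_mult_distrib)
  then show ?thesis
    by (rule Lim_transform_eventually)
      (use assms in \<open>auto simp: exp_flat_def intro!: eventually_mono [OF eventually_gt_at_top [of 0]]\<close>)
qed

lemma box_bump_tendsto: "(\<lambda>n. box_bump c d n x) \<longlonglongrightarrow> indicator (box c d) x"
proof (cases "x \<in> box c d")
  case True
  then have "(\<lambda>n. exp_flat 1 (real n * (x \<bullet> b - c \<bullet> b)) * exp_flat 1 (real n * (d \<bullet> b - x \<bullet> b))) \<longlonglongrightarrow> 1 * 1"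
    if "b \<in> Basis" for b
    using that by (intro tendsto_mult exp_flat_1_tendsto) (auto simp: mem_box)
  then have "(\<lambda>n. \<Prod>b\<in>Basis. exp_flat 1 (real n * (x \<bullet> b - c \<bullet> b)) * exp_flat 1 (real n * (d \<bullet> b - x \<bullet> b)))
      \<longlonglongrightarrow> (\<Prod>b\<in>(Basis::'a set). 1 * 1)"
    by (rule tendsto_prod)
  with True show ?thesis by (simp add: box_bump_def algebra_simps)
qed (simp add: box_bump_eq_0)

subsection \<open>Square integrable functions\<close>

text \<open>The square of \<open>L2_norm_on\<close>. Estimates are made for squares, with
  \<open>norm_add_square_le\<close> in place of the triangle inequality; its factors 2 only enlarge
  constants.\<close>

definition sq_int :: "'a::euclidean_space set \<Rightarrow> ('a \<Rightarrow> 'b::euclidean_space) \<Rightarrow> real" where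
  "sq_int D v = (LINT x|lebesgue_on D. (norm (v x))\<^sup>2)"

lemma sq_int_nonneg: "0 \<le> sq_int D v"
  by (simp add: sq_int_def)

lemma L2_norm_on_square: "(L2_norm_on D v)\<^sup>2 = sq_int D v"
  by (simp add: L2_norm_on_def sq_int_def)

lemma L2_measurable: "v \<in> L2 D \<Longrightarrow> v \<in> borel_measurable (lebesgue_on D)"
  by (simp add: L2_def)

lemma L2_integrable_square: "v \<in> L2 D \<Longrightarrow> integrable (lebesgue_on D) (\<lambda>x. (norm (v x))\<^sup>2)"
  by (simp add: L2_def)

lemma L2_integrable_inner:
  assumes "u \<in> L2 D" "v \<in> L2 D"
  shows "integrable (lebesgue_on D) (\<lambda>x. u x \<bullet> v x)"
proof (rule Bochner_Integration.integrable_bound)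
  show "integrable (lebesgue_on D) (\<lambda>x. (norm (u x))\<^sup>2 + (norm (v x))\<^sup>2)"
    using assms by (intro Bochner_Integration.integrable_add L2_integrable_square)
  have "\<bar>u x \<bullet> v x\<bar> \<le> (norm (u x))\<^sup>2 + (norm (v x))\<^sup>2" for x
    using Cauchy_Schwarz_ineq2 [of "u x" "v x"] sum_squares_bound [of "norm (u x)" "norm (v x)"]
      mult_nonneg_nonneg [OF norm_ge_zero norm_ge_zero, of "u x" "v x"] by linarith
  then show "AE x in lebesgue_on D. norm (u x \<bullet> v x) \<le> norm ((norm (u x))\<^sup>2 + (norm (v x))\<^sup>2)"
    by simp
qed (use assms L2_measurable in \<open>auto intro!: borel_measurable_inner\<close>)

lemma L2_integrable_mult:
  fixes u v :: "'a::euclidean_space \<Rightarrow> real"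
  shows "u \<in> L2 D \<Longrightarrow> v \<in> L2 D \<Longrightarrow> integrable (lebesgue_on D) (\<lambda>x. u x * v x)"
  using L2_integrable_inner [of u D v] by simp

lemma norm_add_square_le:
  "(norm (x + y))\<^sup>2 \<le> 2 * (norm x)\<^sup>2 + 2 * (norm y)\<^sup>2" for x y :: "'a::real_normed_vector"
proof -
  have "(norm (x + y))\<^sup>2 \<le> (norm x + norm y)\<^sup>2"
    by (intro power_mono norm_triangle_ineq norm_ge_zero)
  then show ?thesis
    using sum_squares_bound [of "norm x" "norm y"] by (simp add: power2_sum)
qed

lemma L2_add:
  assumes "u \<in> L2 D" "v \<in> L2 D"
  shows "(\<lambda>x. u x + v x) \<in> L2 D"
proof -
  have [measurable]: "u \<in> borel_measurable (lebesgue_on D)" "v \<in> borel_measurable (lebesgue_on D)"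
    using assms by (auto intro: L2_measurable)
  have "integrable (lebesgue_on D) (\<lambda>x. 2 * (norm (u x))\<^sup>2 + 2 * (norm (v x))\<^sup>2)"
    using assms by (intro Bochner_Integration.integrable_add integrable_mult_right L2_integrable_square)
  then have "integrable (lebesgue_on D) (\<lambda>x. (norm (u x + v x))\<^sup>2)"
    by (rule Bochner_Integration.integrable_bound) (auto simp: norm_add_square_le)
  then show ?thesis by (simp add: L2_def)
qed

lemma L2_scaleR: "u \<in> L2 D \<Longrightarrow> (\<lambda>x. c *\<^sub>R u x) \<in> L2 D"
  by (auto simp: L2_def power_mult_distrib)

lemma L2_scale: "u \<in> L2 D \<Longrightarrow> (\<lambda>x. c * u x :: real) \<in> L2 D"
  using L2_scaleR [of u D c] by simp

lemma L2_inner_const: "u \<in> L2 D \<Longrightarrow> (\<lambda>x. u x \<bullet> b) \<in> L2 D"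
proof -
  assume u: "u \<in> L2 D"
  then have [measurable]: "u \<in> borel_measurable (lebesgue_on D)" by (rule L2_measurable)
  have "integrable (lebesgue_on D) (\<lambda>x. (norm b)\<^sup>2 * (norm (u x))\<^sup>2)"
    using u by (intro integrable_mult_right L2_integrable_square)
  then have "integrable (lebesgue_on D) (\<lambda>x. (norm (u x \<bullet> b))\<^sup>2)"
  proof (rule Bochner_Integration.integrable_bound)
    have "(u x \<bullet> b)\<^sup>2 \<le> (norm b)\<^sup>2 * (norm (u x))\<^sup>2" for x
      using power_mono [OF Cauchy_Schwarz_ineq2 [of "u x" b], of 2]
      by (simp add: power_mult_distrib mult.commute)
    then show "AE x in lebesgue_on D. norm ((norm (u x \<bullet> b))\<^sup>2) \<le> norm ((norm b)\<^sup>2 * (norm (u x))\<^sup>2)"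
      by simp
  qed simp
  then show ?thesis by (simp add: L2_def)
qed

lemma L2_minus: "u \<in> L2 D \<Longrightarrow> v \<in> L2 D \<Longrightarrow> (\<lambda>x. u x - v x) \<in> L2 D"
  using L2_add [of u D "\<lambda>x. (-1) *\<^sub>R v x"] L2_scaleR [of v D "-1"] by simp

lemma sq_int_add_le:
  assumes "u \<in> L2 D" "v \<in> L2 D"
  shows "sq_int D (\<lambda>x. u x + v x) \<le> 2 * sq_int D u + 2 * sq_int D v"
proof -
  have "sq_int D (\<lambda>x. u x + v x) \<le> (LINT x|lebesgue_on D. 2 * (norm (u x))\<^sup>2 + 2 * (norm (v x))\<^sup>2)"
    unfolding sq_int_def using assms
    by (intro integral_mono norm_add_square_le L2_integrable_square L2_add Bochner_Integration.integrable_add integrable_mult_right)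
  then show ?thesis
    using assms by (simp add: sq_int_def L2_integrable_square)
qed

lemma sq_int_scaleR: "sq_int D (\<lambda>x. c *\<^sub>R u x) = c\<^sup>2 * sq_int D u"
  by (simp add: sq_int_def power_mult_distrib)

lemma sq_int_minus_le:
  assumes "u \<in> L2 D" "v \<in> L2 D"
  shows "sq_int D (\<lambda>x. u x - v x) \<le> 2 * sq_int D u + 2 * sq_int D v"
  using sq_int_add_le [OF assms(1) L2_scaleR [OF assms(2), of "-1"]] sq_int_scaleR [of D "-1" v] by simp

lemma sq_int_cong_AE:
  assumes "AE x in lebesgue_on D. u x = v x" "u \<in> borel_measurable (lebesgue_on D)"
    "v \<in> borel_measurable (lebesgue_on D)"
  shows "sq_int D u = sq_int D v"
  unfolding sq_int_def using assms by (intro integral_cong_AE) auto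

subsection \<open>Integration by parts and the fundamental lemma\<close>

text \<open>Passes from \<open>D\<close> to the whole space, where integrals can be
  translated.\<close>

lemma integral_test_function_eq:
  fixes f :: "'a::euclidean_space \<Rightarrow> real"
  assumes "open D" "f \<in> borel_measurable borel" "\<And>x. x \<notin> D \<Longrightarrow> f x = 0"
  shows "(LINT x|lebesgue_on D. f x) = (LINT x|lborel. f x)"
proof -
  have "(LINT x|lebesgue_on D. f x) = (LINT x|lebesgue. (if x \<in> D then f x else 0))"
    using assms by (simp add: Lebesgue_Measure.integral_restrict_UNIV borel_open)
  also have "\<dots> = (LINT x|lebesgue. f x)"
    using assms(3) by (intro Bochner_Integration.integral_cong) auto
  also have "\<dots> = (LINT x|lborel. f x)"
    using assms(2) by (intro integral_completion) simp
  finally show ?thesis .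
qed

lemma integrable_continuous_compact_support:
  fixes f :: "'a::euclidean_space \<Rightarrow> real"
  assumes "continuous_on UNIV f" "compact K" "\<And>x. x \<notin> K \<Longrightarrow> f x = 0"
  shows "integrable lborel f"
proof -
  have "integrable lborel (\<lambda>x. indicator K x *\<^sub>R f x)"
    using assms(2) continuous_on_subset [OF assms(1)] by (rule borel_integrable_compact) simp
  moreover have "(\<lambda>x. indicator K x *\<^sub>R f x) = f"
    using assms(3) by (auto simp: fun_eq_iff indicator_def)
  ultimately show ?thesis by simp
qed

lemma test_function_derivative_outside:
  assumes "closed K" "\<And>x. x \<notin> K \<Longrightarrow> \<phi> x = (0::real)" "x \<notin> K"
  shows "frechet_derivative \<phi> (at x) h = 0"
proof -
  have "(\<phi> has_derivative (\<lambda>h. 0)) (at x)"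
    using has_derivative_transform_within_open [of "\<lambda>x. 0" "\<lambda>h. 0" x UNIV "- K" \<phi>] assms
    by (simp add: open_Compl)
  from frechet_derivative_at [OF this] show ?thesis by metis
qed

lemma test_function_directional_derivative:
  assumes "\<phi> \<in> test_functions D"
  shows "((\<lambda>t. \<phi> (t *\<^sub>R b + x)) has_real_derivative frechet_derivative \<phi> (at (t *\<^sub>R b + x)) b) (at t)"
proof -
  have l: "linear (frechet_derivative \<phi> (at (t *\<^sub>R b + x)))"
    using test_functions_derivative [OF assms] has_derivative_linear by blast
  have "((\<lambda>t. t *\<^sub>R b + x) has_derivative (\<lambda>h. h *\<^sub>R b)) (at t)"
    by (intro derivative_eq_intros | simp)+
  from has_derivative_compose [OF this test_functions_derivative [OF assms]]
  show ?thesis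
    by (simp add: has_field_derivative_def linear_cmul [OF l] mult_commute_abs)
qed

text \<open>The difference quotients of a test function have integral zero by translation invariance.\<close>

lemma integral_partial_derivative_test_function:
  fixes \<phi> :: "'a::euclidean_space \<Rightarrow> real"
  assumes D: "open D" and \<phi>: "\<phi> \<in> test_functions D" and b: "b \<in> Basis"
  shows "(LINT x|lebesgue_on D. frechet_derivative \<phi> (at x) b) = 0"
proof -
  obtain K where K: "compact K" "K \<subseteq> D" "\<And>x. x \<notin> K \<Longrightarrow> \<phi> x = 0"
    using \<phi> by (auto simp: test_functions_def)
  let ?d = "\<lambda>x. frechet_derivative \<phi> (at x) b"
  have cd: "continuous_on UNIV ?d" and c: "continuous_on UNIV \<phi>"
    using \<phi> b by (auto intro: test_functions_derivative_continuous test_functions_continuous)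
  have d0: "?d x = 0" if "x \<notin> K" for x
    using test_function_derivative_outside [of K \<phi>] K that compact_imp_closed by blast
  have "bounded (?d ` K)"
    by (intro compact_imp_bounded compact_continuous_image K continuous_on_subset [OF cd]) auto
  then obtain B0 where B0: "\<And>x. x \<in> K \<Longrightarrow> \<bar>?d x\<bar> \<le> B0"
    by (auto simp: bounded_iff)
  define B where "B = max B0 0"
  have B: "\<bar>?d x\<bar> \<le> B" for x
    using B0 [of x] d0 [of x] by (cases "x \<in> K") (auto simp: B_def)
  obtain R where R: "\<And>x. x \<in> K \<Longrightarrow> norm x \<le> R"
    using compact_imp_bounded [OF K(1)] by (auto simp: bounded_iff)
  define s where "s n x = (\<phi> (inverse (real (Suc n)) *\<^sub>R b + x) - \<phi> x) / inverse (real (Suc n))" for n x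
  have int: "integrable lborel \<phi>"
    by (rule integrable_continuous_compact_support [OF c K(1,3)])
  have tr: "integrable lborel (\<lambda>x. \<phi> (z + x))" "(LINT x|lborel. \<phi> (z + x)) = (LINT x|lborel. \<phi> x)" for z
  proof -
    have m: "\<phi> \<in> borel_measurable borel" "(+) z \<in> lborel \<rightarrow>\<^sub>M borel"
      using borel_measurable_continuous_onI [OF c] by auto
    show "integrable lborel (\<lambda>x. \<phi> (z + x))"
      using integrable_distr_eq [of "(+) z" lborel borel \<phi>] m int by (simp add: lborel_distr_plus)
    show "(LINT x|lborel. \<phi> (z + x)) = (LINT x|lborel. \<phi> x)"
      using integral_distr [of "(+) z" lborel borel \<phi>] m by (simp add: lborel_distr_plus)
  qed
  \<comment> \<open>A dominating function for the difference quotients. Inside the ball the mean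
    value theorem turns the quotient into a derivative; outside, both evaluation points miss
    \<open>K\<close>, because the step has length at most 1.\<close>
  have bound: "\<bar>s n x\<bar> \<le> B * indicator (cball 0 (R + 1)) x" for n x
  proof (cases "x \<in> cball 0 (R + 1)")
    case True
    let ?h = "inverse (real (Suc n))"
    have h: "?h > 0" by simp
    from MVT2 [OF h test_function_directional_derivative [OF \<phi>, of b x]] obtain z where "\<phi> (?h *\<^sub>R b + x) - \<phi> (0 *\<^sub>R b + x) = (?h - 0) * ?d (z *\<^sub>R b + x)"
      by blast
    then have "s n x = ?d (z *\<^sub>R b + x)"
      by (simp add: s_def)
    then show ?thesis using B True by simp
  next
    case False
    have "x \<notin> K" using R [of x] False by (auto simp: dist_norm)
    moreover have "inverse (real (Suc n)) *\<^sub>R b + x \<notin> K"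
    proof
      assume "inverse (real (Suc n)) *\<^sub>R b + x \<in> K"
      then have "norm (inverse (real (Suc n)) *\<^sub>R b + x) \<le> R" by (rule R)
      moreover have "norm x \<le> norm (inverse (real (Suc n)) *\<^sub>R b + x) + norm (inverse (real (Suc n)) *\<^sub>R b)"
        by (metis add_diff_cancel_left' norm_triangle_ineq4 add.commute)
      moreover have "norm (inverse (real (Suc n)) *\<^sub>R b) \<le> 1"
        using b by (simp add: divide_simps)
      ultimately show False using False by (simp add: dist_norm)
    qed
    ultimately show ?thesis using False by (simp add: s_def K(3))
  qed
  have lim: "(\<lambda>n. s n x) \<longlonglongrightarrow> ?d x" for x
  proof -
    have "((\<lambda>t. \<phi> (t *\<^sub>R b + x)) has_real_derivative ?d x) (at 0)"
      using test_function_directional_derivative [OF \<phi>, of b x 0] by simp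
    then have "((\<lambda>h. (\<phi> (h *\<^sub>R b + x) - \<phi> x) / h) \<longlongrightarrow> ?d x) (at 0)"
      by (simp add: has_field_derivative_iff)
    moreover have "filterlim (\<lambda>n. inverse (real (Suc n))) (at 0) sequentially"
      using LIMSEQ_inverse_real_of_nat by (auto simp: filterlim_at)
    ultimately show ?thesis
      unfolding s_def by (rule filterlim_compose)
  qed
  have ms: "s n \<in> borel_measurable borel" for n
    unfolding s_def using borel_measurable_continuous_onI [OF c] by measurable
  have "(\<lambda>n. LINT x|lborel. s n x) \<longlonglongrightarrow> (LINT x|lborel. ?d x)"
  proof (rule integral_dominated_convergence [where w = "\<lambda>x. B * indicator (cball 0 (R + 1)) x"])
    show "integrable lborel (\<lambda>x::'a. B * indicator (cball 0 (R + 1)) x :: real)"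
      by (intro integrable_mult_right integrable_real_indicator) 
        (use emeasure_bounded_finite [OF bounded_cball, of "0::'a" "R + 1"] in \<open>simp_all add: infinity_ennreal_def\<close>)
    show "?d \<in> borel_measurable lborel"
      using borel_measurable_continuous_onI [OF cd] by simp
    show "s n \<in> borel_measurable lborel" for n
      using ms by simp
    show "AE x in lborel. (\<lambda>n. s n x) \<longlonglongrightarrow> ?d x"
      by (intro AE_I2 lim)
    show "AE x in lborel. norm (s n x) \<le> B * indicator (cball 0 (R + 1)) x" for n
      using bound by (intro AE_I2) (simp only: real_norm_def)
  qed
  moreover have "(LINT x|lborel. s n x) = 0" for n
  proof -
    have "(LINT x|lborel. s n x) =
      ((LINT x|lborel. \<phi> (inverse (real (Suc n)) *\<^sub>R b + x)) - (LINT x|lborel. \<phi> x)) / inverse (real (Suc n))"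
      unfolding s_def using tr(1) int by (simp only: integral_divide_zero Bochner_Integration.integral_diff)
    then show ?thesis by (simp only: tr(2) diff_self div_0)
  qed
  ultimately have "(LINT x|lborel. ?d x) = 0"
    by (simp add: LIMSEQ_const_iff)
  then show ?thesis
    using integral_test_function_eq [OF D borel_measurable_continuous_onI [OF cd]] d0 K(2) by (metis subsetD)
qed

text \<open>Boxes are closed under intersection and generate the Borel sets, so the integral
  vanishes over every Borel set by Dynkin's argument; \<open>total\<close> is what handles
  complements. Lebesgue sets differ from Borel sets by null sets, and the sets where
  \<open>f\<close> is positive or negative then have to be null.\<close>

lemma AE_zero_if_box_integrals_zero:
  fixes f :: "'a::euclidean_space \<Rightarrow> real"
  assumes f: "integrable lebesgue f"
    and total: "(LINT x|lebesgue. f x) = 0"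
    and box: "\<And>a b. (LINT x:box a b|lebesgue. f x) = 0"
  shows "AE x in lebesgue. f x = 0"
proof -
  have si: "set_integrable lebesgue A f" if "A \<in> sets lebesgue" for A
    using integrable_mult_indicator [OF that f] by (simp add: set_integrable_def)
  have borel: "(LINT x:A|lebesgue. f x) = 0" if "A \<in> sets borel" for A
  proof -
    let ?G = "range (\<lambda>(a, b). box a b :: 'a set)"
    have borel_G: "sigma_sets UNIV ?G = sets borel"
      by (simp add: borel_eq_box)
    have "box a b \<inter> box c d \<in> ?G" for a b c d
      unfolding box_Int_box by blast
    then have "Int_stable ?G"
      by (auto simp: Int_stable_def)
    moreover have "?G \<subseteq> Pow UNIV" by simp
    moreover have "A \<in> sigma_sets UNIV ?G"
      using that by (simp add: borel_G)
    ultimately show ?thesis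
    proof (induction rule: sigma_sets_induct_disjoint)
      case (basic A)
      then obtain p where "A = (\<lambda>(a, b). box a b) p" by (rule rangeE)
      then have "A = box (fst p) (snd p)" by (simp add: case_prod_unfold)
      then show ?case by (simp only: box)
    next
      case (compl A)
      have A: "A \<in> sets lebesgue" using compl by (simp add: borel_G)
      have "(LINT x:(UNIV - A) \<union> A|lebesgue. f x) = (LINT x:UNIV - A|lebesgue. f x) + (LINT x:A|lebesgue. f x)"
        using A by (intro set_integral_Un si) auto
      moreover have "(LINT x:(UNIV - A) \<union> A|lebesgue. f x) = 0"
        using total by (simp add: set_lebesgue_integral_def)
      ultimately show ?case using compl(2) by linarith
    next
      case (union A)
      have A: "A i \<in> sets lebesgue" for i using union(2) by (auto simp: borel_G)
      have "(LINT x:(\<Union>i. A i)|lebesgue. f x) = (\<Sum>i. LINT x:A i|lebesgue. f x)"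
        using A union(1) by (intro lebesgue_integral_countable_add si) (auto simp: disjoint_family_on_def)
      then show ?case using union(3) by simp
    qed (simp add: set_lebesgue_integral_def)
  qed
  have zero: "(LINT x:A|lebesgue. f x) = 0" if "A \<in> sets lebesgue" for A
  proof -
    from that obtain S N N' where A: "A = S \<union> N" "N \<subseteq> N'" "N' \<in> null_sets lborel" "S \<in> sets borel"
      by (rule sets_completionE) auto
    have "AE x in lebesgue. x \<notin> N'"
      using A(3) by (intro AE_not_in null_sets_completionI)
    then have "AE x in lebesgue. indicator A x *\<^sub>R f x = indicator S x *\<^sub>R f x"
      by eventually_elim (use A(1,2) in \<open>auto simp: indicator_def\<close>)
    moreover have "S \<in> sets lebesgue" using A(4) by auto
    ultimately have "(LINT x:A|lebesgue. f x) = (LINT x:S|lebesgue. f x)"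
      using si [OF that] si [of S] unfolding set_lebesgue_integral_def set_integrable_def
      by (intro integral_cong_AE borel_measurable_integrable) auto
    with borel [OF A(4)] show ?thesis by simp
  qed
  have [measurable]: "f \<in> borel_measurable lebesgue" using f by simp
  define P where "P = {x. f x > 0}"
  define N where "N = {x. f x < 0}"
  have sets: "P \<in> sets lebesgue" "N \<in> sets lebesgue"
    using measurable_sets [OF \<open>f \<in> borel_measurable lebesgue\<close>, of "{0<..}"]
      measurable_sets [OF \<open>f \<in> borel_measurable lebesgue\<close>, of "{..<0}"]
    by (auto simp: P_def N_def vimage_def)
  have "AE x in lebesgue. indicator P x * f x = 0"
    using zero [OF sets(1)] si [OF sets(1)]
    by (subst integral_nonneg_eq_0_iff_AE [symmetric])
      (auto simp: set_lebesgue_integral_def set_integrable_def P_def indicator_def)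
  moreover have "AE x in lebesgue. - (indicator N x * f x) = 0"
    using zero [OF sets(2)] si [OF sets(2)]
    by (subst integral_nonneg_eq_0_iff_AE [symmetric])
      (auto simp: set_lebesgue_integral_def set_integrable_def N_def indicator_def)
  ultimately show ?thesis
    by eventually_elim (auto simp: P_def N_def indicator_def split: if_splits)
qed

lemma bounded_imp_finite_measure_lebesgue_on:
  assumes "open D" "bounded D"
  shows "finite_measure (lebesgue_on D)"
  by (intro finite_measure_lebesgue_on lmeasurable_open assms)

text \<open>A bounded domain has finite measure and \<bar>g\<bar> \<le> 1 + g^2.\<close>

lemma L2_integrable:
  fixes g :: "'a::euclidean_space \<Rightarrow> real"
  assumes "open D" "bounded D" "g \<in> L2 D"
  shows "integrable (lebesgue_on D) g"
proof -
  interpret finite_measure "lebesgue_on D"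
    using assms by (intro bounded_imp_finite_measure_lebesgue_on)
  have "integrable (lebesgue_on D) (\<lambda>x. 1 + (norm (g x))\<^sup>2)"
    using assms(3) by (intro Bochner_Integration.integrable_add L2_integrable_square) auto
  then show ?thesis
  proof (rule Bochner_Integration.integrable_bound)
    have "\<bar>g x\<bar> \<le> 1 + (g x)\<^sup>2" for x
      using sum_squares_bound [of 1 "\<bar>g x\<bar>"] by simp
    then show "AE x in lebesgue_on D. norm (g x) \<le> norm (1 + (norm (g x))\<^sup>2)"
      by simp
  qed (use assms L2_measurable in auto)
qed

text \<open>The bumps converge boundedly to the indicator of a box, so \<open>g\<close> has integral
  zero over each open box whose closed box lies in \<open>D\<close>. Boxes that leave
  \<open>D\<close> cannot be tested in this way; the argument is therefore localised to one closed
  box inside \<open>D\<close> at a time, and countably many of these cover \<open>D\<close>.\<close>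

lemma fundamental_lemma_calculus_of_variations:
  fixes g :: "'a::euclidean_space \<Rightarrow> real"
  assumes D: "open D" "bounded D" and g: "g \<in> L2 D"
    and zero: "\<And>\<phi>. \<phi> \<in> test_functions D \<Longrightarrow> (LINT x|lebesgue_on D. g x * \<phi> x) = 0"
  shows "AE x in lebesgue_on D. g x = 0"
proof -
  define G where "G x = (if x \<in> D then g x else 0)" for x
  have DL: "D \<in> sets lebesgue" using D by auto
  have Gint: "integrable lebesgue G"
    unfolding G_def using L2_integrable [OF D g] DL by (simp add: Lebesgue_Measure.integrable_restrict_UNIV)
  have G_eq: "(LINT x|lebesgue. G x * \<phi> x) = (LINT x|lebesgue_on D. g x * \<phi> x)" for \<phi>
  proof -
    have "(LINT x|lebesgue. G x * \<phi> x) = (LINT x|lebesgue. (if x \<in> D then g x * \<phi> x else 0))"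
      by (intro Bochner_Integration.integral_cong) (auto simp: G_def)
    then show ?thesis using DL by (simp add: Lebesgue_Measure.integral_restrict_UNIV)
  qed
  have box: "(LINT x|lebesgue. G x * indicator (box c d) x) = 0" if "cbox c d \<subseteq> D" for c d
  proof -
    have "(\<lambda>n. LINT x|lebesgue. G x * box_bump c d n x) \<longlonglongrightarrow> (LINT x|lebesgue. G x * indicator (box c d) x)"
    proof (rule integral_dominated_convergence [where w = "\<lambda>x. \<bar>G x\<bar>"])
      show "(\<lambda>x. G x * box_bump c d n x) \<in> borel_measurable lebesgue" for n
      proof (intro borel_measurable_times)
        show "box_bump c d n \<in> borel_measurable lebesgue"
          using test_functions_continuous [OF box_bump_test_function [OF that, of n]]
          by (intro measurable_completion) (simp add: borel_measurable_continuous_onI)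
      qed (use Gint in simp)
      show "AE x in lebesgue. (\<lambda>n. G x * box_bump c d n x) \<longlonglongrightarrow> G x * indicator (box c d) x"
        by (intro AE_I2 tendsto_intros box_bump_tendsto)
      show "AE x in lebesgue. norm (G x * box_bump c d n x) \<le> \<bar>G x\<bar>" for n
        by (intro AE_I2) (auto simp: abs_mult box_bump_bounds intro!: mult_left_le)
      show "(\<lambda>x. G x * indicator (box c d) x) \<in> borel_measurable lebesgue"
        using Gint by (intro borel_measurable_times borel_measurable_indicator) auto
    qed (use Gint in auto)
    then show ?thesis
      using zero [OF box_bump_test_function [OF that]] by (simp add: G_eq LIMSEQ_const_iff)
  qed
  have AE_cbox: "AE x in lebesgue. x \<in> cbox c d \<longrightarrow> G x = 0" if cd: "cbox c d \<subseteq> D" for c d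
  proof -
    have "AE x in lebesgue. G x * indicator (box c d) x = 0"
    proof (rule AE_zero_if_box_integrals_zero)
      show "integrable lebesgue (\<lambda>x. G x * indicator (box c d) x)"
        using Gint by (intro integrable_real_mult_indicator) auto
      show "(LINT x|lebesgue. G x * indicator (box c d) x) = 0"
        by (rule box [OF cd])
      fix a b :: 'a
      obtain c' d' where eq: "box a b \<inter> box c d = box c' d'"
        unfolding box_Int_box by blast
      \<comment> \<open>A nonempty intersection of the two boxes has its closure in
        \<open>cbox c d\<close>, hence in \<open>D\<close>, so its own bumps are test
        functions.\<close>
      have "cbox c' d' \<subseteq> D \<or> box c' d' = {}"
      proof (cases "box c' d' = {}")
        case False
        then have "cbox c' d' = closure (box c' d')" by (simp add: closure_box)
        also have "\<dots> \<subseteq> cbox c d"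
          using eq box_subset_cbox [of c d] by (intro closure_minimal) auto
        finally show ?thesis using cd by blast
      qed simp
      then have "(LINT x|lebesgue. G x * indicator (box c' d') x) = 0"
        using box by auto
      then show "(LINT x:box a b|lebesgue. G x * indicator (box c d) x) = 0"
        by (simp add: set_lebesgue_integral_def eq [symmetric] indicator_inter_arith mult_ac)
    qed
    moreover have "AE x in lebesgue. x \<notin> cbox c d - box c d"
      using negligible_frontier_interval [of c d] unfolding negligible_iff_null_sets by (rule AE_not_in)
    ultimately show ?thesis
      by eventually_elim (auto simp: indicator_def split: if_splits)
  qed
  obtain \<D> where \<D>: "countable \<D>" "\<D> \<subseteq> Pow D" "\<And>X. X \<in> \<D> \<Longrightarrow> \<exists>a b. X = cbox a b" "\<Union>\<D> = D"
    using open_countable_Union_open_cbox [OF D(1)] by blast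
  have "AE x in lebesgue. x \<in> X \<longrightarrow> G x = 0" if X: "X \<in> \<D>" for X
  proof -
    obtain c d where "X = cbox c d" using \<D>(3) [OF X] by blast
    then show ?thesis using AE_cbox [of c d] X \<D>(2) by auto
  qed
  then have "AE x in lebesgue. \<forall>X\<in>\<D>. x \<in> X \<longrightarrow> G x = 0"
    unfolding AE_ball_countable [OF \<D>(1)] by blast
  then have "AE x in lebesgue. x \<in> D \<longrightarrow> g x = 0"
  proof eventually_elim
    case (elim x)
    show ?case
    proof
      assume x: "x \<in> D"
      then obtain X where "X \<in> \<D>" "x \<in> X" using \<D>(4) by blast
      with elim have "G x = 0" by blast
      with x show "g x = 0" by (simp add: G_def)
    qed
  qed
  then show ?thesis
    using DL by (simp add: AE_restrict_space_iff)
qed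

subsection \<open>Weak gradients and the Poincare inequality\<close>

lemma L2_continuous:
  fixes \<phi> :: "'a::euclidean_space \<Rightarrow> real"
  assumes "open D" "bounded D" "continuous_on UNIV \<phi>"
  shows "\<phi> \<in> L2 D"
proof -
  interpret finite_measure "lebesgue_on D"
    using assms by (intro bounded_imp_finite_measure_lebesgue_on)
  have m: "\<phi> \<in> borel_measurable (lebesgue_on D)"
    using assms by (intro continuous_imp_measurable_on_sets_lebesgue continuous_on_subset [OF assms(3)]) auto
  have "bounded (\<phi> ` closure D)"
    using assms
    by (intro compact_imp_bounded compact_continuous_image continuous_on_subset [OF assms(3)]) auto
  then obtain B where B: "\<And>x. x \<in> D \<Longrightarrow> \<bar>\<phi> x\<bar> \<le> B"
    using closure_subset by (force simp: bounded_iff)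
  have "integrable (lebesgue_on D) (\<lambda>x. (norm (\<phi> x))\<^sup>2)"
  proof (rule integrable_const_bound [where B = "B\<^sup>2"])
    show "AE x in lebesgue_on D. norm ((norm (\<phi> x))\<^sup>2) \<le> B\<^sup>2"
      using B
      by (intro AE_I2) (auto simp: abs_le_square_iff [symmetric] intro: order_trans [OF _ abs_ge_self])
  qed (use m in simp)
  with m show ?thesis by (simp add: L2_def)
qed

lemma test_functions_L2:
  "open D \<Longrightarrow> bounded D \<Longrightarrow> \<phi> \<in> test_functions D \<Longrightarrow> \<phi> \<in> L2 D"
  by (intro L2_continuous test_functions_continuous)

lemma test_functions_derivative_L2:
  "open D \<Longrightarrow> bounded D \<Longrightarrow> \<phi> \<in> test_functions D \<Longrightarrow> b \<in> Basis \<Longrightarrow>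
    (\<lambda>x. frechet_derivative \<phi> (at x) b) \<in> L2 D"
  by (intro L2_continuous test_functions_derivative_continuous)

text \<open>Each component of the difference is orthogonal to all test functions. Since
  \<open>weak_gradient\<close> is a choice, this is how its linearity is obtained, and only almost
  everywhere.\<close>

lemma weak_gradient_unique:
  assumes D: "open D" "bounded D" and g: "g \<in> L2 D" "has_weak_gradient D v g"
    and h: "h \<in> L2 D" "has_weak_gradient D v h"
  shows "AE x in lebesgue_on D. g x = h x"
proof -
  have "AE x in lebesgue_on D. (g x - h x) \<bullet> b = 0" if b: "b \<in> Basis" for b
  proof (rule fundamental_lemma_calculus_of_variations [OF D])
    show "(\<lambda>x. (g x - h x) \<bullet> b) \<in> L2 D"
      using g h by (intro L2_inner_const L2_minus)
    fix \<phi> :: "'a \<Rightarrow> real" assume \<phi>: "\<phi> \<in> test_functions D"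
    have "(LINT x|lebesgue_on D. (g x \<bullet> b) * \<phi> x) = (LINT x|lebesgue_on D. (h x \<bullet> b) * \<phi> x)"
      using g(2) h(2) \<phi> b by (simp add: has_weak_gradient_def)
    moreover have "integrable (lebesgue_on D) (\<lambda>x. (u x \<bullet> b) * \<phi> x)" if "u \<in> L2 D" for u
      using that \<phi> D by (intro L2_integrable_mult L2_inner_const test_functions_L2)
    ultimately show "(LINT x|lebesgue_on D. (g x - h x) \<bullet> b * \<phi> x) = 0"
      using g h by (simp add: inner_diff_left left_diff_distrib)
  qed
  then have "AE x in lebesgue_on D. \<forall>b\<in>Basis. (g x - h x) \<bullet> b = 0"
    by (intro AE_finite_allI) auto
  then show ?thesis
    by eventually_elim (auto simp: inner_diff_left intro: euclidean_eqI)
qed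

lemma has_weak_gradient_add:
  assumes D: "open D" "bounded D" and u: "u \<in> L2 D" "v \<in> L2 D" and g: "g \<in> L2 D" "h \<in> L2 D"
    and w: "has_weak_gradient D u g" "has_weak_gradient D v h"
  shows "has_weak_gradient D (\<lambda>x. u x + v x) (\<lambda>x. g x + h x)"
  unfolding has_weak_gradient_def
proof (intro ballI)
  fix \<phi> :: "'a \<Rightarrow> real" and b :: 'a assume \<phi>: "\<phi> \<in> test_functions D" and b: "b \<in> Basis"
  have "integrable (lebesgue_on D) (\<lambda>x. z x * frechet_derivative \<phi> (at x) b)" if "z \<in> L2 D" for z
    using that \<phi> b D by (intro L2_integrable_mult test_functions_derivative_L2)
  moreover have "integrable (lebesgue_on D) (\<lambda>x. (z x \<bullet> b) * \<phi> x)" if "z \<in> L2 D" for z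
    using that \<phi> D by (intro L2_integrable_mult L2_inner_const test_functions_L2)
  ultimately show "(LINT x|lebesgue_on D. (u x + v x) * frechet_derivative \<phi> (at x) b) =
      - (LINT x|lebesgue_on D. (g x + h x) \<bullet> b * \<phi> x)"
    using u g w \<phi> b by (simp add: distrib_right inner_add_left has_weak_gradient_def)
qed

lemma has_weak_gradient_scale:
  assumes "has_weak_gradient D u g"
  shows "has_weak_gradient D (\<lambda>x. c * u x) (\<lambda>x. c *\<^sub>R g x)"
  using assms by (simp add: has_weak_gradient_def mult.assoc)

lemma H1_L2: "v \<in> H1 D \<Longrightarrow> v \<in> L2 D"
  by (simp add: H1_def)

lemma weak_gradient_H1:
  assumes "v \<in> H1 D"
  shows "weak_gradient D v \<in> L2 D" "has_weak_gradient D v (weak_gradient D v)"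
proof -
  have "\<exists>g. g \<in> L2 D \<and> has_weak_gradient D v g"
    using assms by (auto simp: H1_def)
  from someI_ex [OF this] show "weak_gradient D v \<in> L2 D" "has_weak_gradient D v (weak_gradient D v)"
    by (auto simp: weak_gradient_def)
qed

lemma H1_add:
  assumes D: "open D" "bounded D" and u: "u \<in> H1 D" "v \<in> H1 D"
  shows "(\<lambda>x. u x + v x) \<in> H1 D"
    and "AE x in lebesgue_on D. weak_gradient D (\<lambda>x. u x + v x) x = weak_gradient D u x + weak_gradient D v x"
proof -
  have *: "(\<lambda>x. weak_gradient D u x + weak_gradient D v x) \<in> L2 D"
    "has_weak_gradient D (\<lambda>x. u x + v x) (\<lambda>x. weak_gradient D u x + weak_gradient D v x)"
    using u D by (auto intro!: L2_add has_weak_gradient_add weak_gradient_H1 H1_L2)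
  then show H: "(\<lambda>x. u x + v x) \<in> H1 D"
    using u by (auto simp: H1_def intro!: L2_add)
  show "AE x in lebesgue_on D. weak_gradient D (\<lambda>x. u x + v x) x = weak_gradient D u x + weak_gradient D v x"
    by (intro weak_gradient_unique [OF D weak_gradient_H1 [OF H] *])
qed

lemma H1_scale:
  assumes D: "open D" "bounded D" and u: "u \<in> H1 D"
  shows "(\<lambda>x. c * u x) \<in> H1 D"
    and "AE x in lebesgue_on D. weak_gradient D (\<lambda>x. c * u x) x = c *\<^sub>R weak_gradient D u x"
proof -
  have *: "(\<lambda>x. c *\<^sub>R weak_gradient D u x) \<in> L2 D"
    "has_weak_gradient D (\<lambda>x. c * u x) (\<lambda>x. c *\<^sub>R weak_gradient D u x)"
    using u by (auto intro!: L2_scaleR has_weak_gradient_scale weak_gradient_H1)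
  then show H: "(\<lambda>x. c * u x) \<in> H1 D"
    using L2_scale [of u D c] u by (auto simp: H1_def)
  show "AE x in lebesgue_on D. weak_gradient D (\<lambda>x. c * u x) x = c *\<^sub>R weak_gradient D u x"
    by (intro weak_gradient_unique [OF D weak_gradient_H1 [OF H] *])
qed

lemma H1_minus:
  assumes D: "open D" "bounded D" and u: "u \<in> H1 D" "v \<in> H1 D"
  shows "(\<lambda>x. u x - v x) \<in> H1 D"
    and "AE x in lebesgue_on D. weak_gradient D (\<lambda>x. u x - v x) x = weak_gradient D u x - weak_gradient D v x"
proof -
  note s = H1_scale [OF D u(2), of "-1"]
  from H1_add [OF D u(1) s(1)] s(2)
  show "(\<lambda>x. u x - v x) \<in> H1 D"
    "AE x in lebesgue_on D. weak_gradient D (\<lambda>x. u x - v x) x = weak_gradient D u x - weak_gradient D v x"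
    by (auto elim: eventually_elim2)
qed

text \<open>Functions that agree on \<open>D\<close> have the same weak gradients, so the choice
  operator receives the same predicate and the chosen gradients are equal as functions. This is what
  allows a Taylor coefficient, known on \<open>D\<close> only, to be replaced by a finite element
  function.\<close>

lemma weak_gradient_cong:
  assumes "\<And>x. x \<in> D \<Longrightarrow> u x = v x"
  shows "weak_gradient D u = weak_gradient D v"
proof -
  have "has_weak_gradient D u = has_weak_gradient D v"
    unfolding has_weak_gradient_def using assms
    by (intro ext ball_cong refl arg_cong2 [where f = "(=)"] Bochner_Integration.integral_cong) auto
  then show ?thesis by (simp add: weak_gradient_def)
qed

text \<open>Integration by parts: the derivative of the product of two test functions has integral zero.\<close>

lemma test_functions_H1:
  assumes D: "open D" "bounded D" and \<phi>: "\<phi> \<in> test_functions D"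
  shows "\<phi> \<in> H1 D"
proof -
  define g where "g x = (\<Sum>b\<in>Basis. frechet_derivative \<phi> (at x) b *\<^sub>R b)" for x
  have gb: "g x \<bullet> b = frechet_derivative \<phi> (at x) b" if "b \<in> Basis" for x b
    using that by (simp add: g_def)
  have "has_weak_gradient D \<phi> g"
    unfolding has_weak_gradient_def
  proof (intro ballI)
    fix \<psi> :: "'a \<Rightarrow> real" and b :: 'a assume \<psi>: "\<psi> \<in> test_functions D" and b: "b \<in> Basis"
    have "(\<lambda>x. \<phi> x * \<psi> x) \<in> test_functions D"
      using \<phi> \<psi> by (intro test_functions_mult test_functions_cont_diff)
    from integral_partial_derivative_test_function [OF D(1) this b]
    have "(LINT x|lebesgue_on D. frechet_derivative (\<lambda>x. \<phi> x * \<psi> x) (at x) b) = 0" .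
    moreover have "frechet_derivative (\<lambda>x. \<phi> x * \<psi> x) (at x) b =
      \<phi> x * frechet_derivative \<psi> (at x) b + (g x \<bullet> b) * \<psi> x" for x
      using frechet_derivative_at [OF has_derivative_mult [OF test_functions_derivative [OF \<phi>] test_functions_derivative [OF \<psi>]], symmetric]
      by (simp add: gb [OF b])
    moreover have "integrable (lebesgue_on D) (\<lambda>x. \<phi> x * frechet_derivative \<psi> (at x) b)"
      using \<phi> \<psi> D b by (intro L2_integrable_mult test_functions_L2 test_functions_derivative_L2)
    moreover have "integrable (lebesgue_on D) (\<lambda>x. (g x \<bullet> b) * \<psi> x)"
      unfolding gb [OF b] using \<phi> \<psi> D b
      by (intro L2_integrable_mult test_functions_L2 test_functions_derivative_L2)
    ultimately show "(LINT x|lebesgue_on D. \<phi> x * frechet_derivative \<psi> (at x) b) =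
        - (LINT x|lebesgue_on D. g x \<bullet> b * \<psi> x)"
      by simp
  qed
  moreover have "g \<in> L2 D"
  proof -
    have "(\<lambda>x. c x *\<^sub>R b) \<in> L2 D" if "c \<in> L2 D" for c :: "'a \<Rightarrow> real" and b :: 'a
      using that L2_measurable [OF that] by (auto simp: L2_def power_mult_distrib)
    then have c: "(\<lambda>x. frechet_derivative \<phi> (at x) b *\<^sub>R b) \<in> L2 D" if "b \<in> Basis" for b
      using that \<phi> D by (blast intro: test_functions_derivative_L2)
    have zero: "(\<lambda>x. 0 :: 'a) \<in> L2 D" by (simp add: L2_def)
    have "(\<lambda>x. \<Sum>b\<in>B. frechet_derivative \<phi> (at x) b *\<^sub>R b) \<in> L2 D" if "B \<subseteq> Basis" for B
      using finite_subset [OF that finite_Basis] that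
      by (induction B rule: finite_induct) (auto intro: L2_add c simp: zero)
    then show ?thesis by (simp add: g_def [abs_def])
  qed
  ultimately show ?thesis
    using test_functions_L2 [OF D \<phi>] by (auto simp: H1_def)
qed

text \<open>Test the weak gradient of \<open>\<phi>\<close> with \<open>(x \<bullet> b) \<phi>\<close>, and use
  \<open>\<integral> (x \<bullet> b) \<phi> \<partial>\<^sub>b\<phi> = - \<integral> \<phi>\<^sup>2 / 2\<close>.\<close>

lemma poincare_test_function:
  assumes D: "open D" "bounded D" "D \<subseteq> cball 0 R" and \<phi>: "\<phi> \<in> test_functions D"
  shows "sq_int D \<phi> \<le> 4 * R\<^sup>2 * sq_int D (weak_gradient D \<phi>)"
proof -
  obtain b :: 'a where b: "b \<in> Basis" using nonempty_Basis by blast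
  let ?g = "weak_gradient D \<phi>" and ?d = "\<lambda>x. frechet_derivative \<phi> (at x) b"
  let ?\<psi> = "\<lambda>x. (x \<bullet> b) * \<phi> x"
  note D' = D(1,2)
  note H = test_functions_H1 [OF D' \<phi>]
  have \<psi>: "?\<psi> \<in> test_functions D"
    by (intro test_functions_mult \<phi> cont_diff_inner)
  have dl: "((\<lambda>x. x \<bullet> b) has_derivative (\<lambda>h. h \<bullet> b)) (at x)" for x :: 'a
    by (intro derivative_eq_intros | simp)+
  have d\<psi>: "(?\<psi> has_derivative (\<lambda>h. (x \<bullet> b) * frechet_derivative \<phi> (at x) h + (h \<bullet> b) * \<phi> x)) (at x)" for x
    by (intro has_derivative_mult dl test_functions_derivative [OF \<phi>])
  have d\<psi>b: "frechet_derivative ?\<psi> (at x) b = (x \<bullet> b) * ?d x + \<phi> x" for x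
    using frechet_derivative_at [OF d\<psi>, symmetric] b by (simp add: inner_Basis)
  have d\<phi>\<psi>b: "frechet_derivative (\<lambda>x. \<phi> x * ?\<psi> x) (at x) b = 2 * (?\<psi> x * ?d x) + (\<phi> x)\<^sup>2" for x
    using frechet_derivative_at [OF has_derivative_mult [OF test_functions_derivative [OF \<phi>] d\<psi>], symmetric] b
    by (simp add: inner_Basis power2_eq_square algebra_simps)
  have i1: "integrable (lebesgue_on D) (\<lambda>x. ?\<psi> x * ?d x)"
    using \<phi> \<psi> D' b by (intro L2_integrable_mult test_functions_L2 test_functions_derivative_L2)
  have i2: "integrable (lebesgue_on D) (\<lambda>x. (\<phi> x)\<^sup>2)"
    using L2_integrable_square [OF test_functions_L2 [OF D' \<phi>]] by simp
  have i3: "integrable (lebesgue_on D) (\<lambda>x. (?g x \<bullet> b) * ?\<psi> x)"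
    using \<psi> D' b H by (intro L2_integrable_mult test_functions_L2 L2_inner_const weak_gradient_H1)
  have i4: "integrable (lebesgue_on D) (\<lambda>x. (norm (?g x))\<^sup>2)"
    using H by (intro L2_integrable_square weak_gradient_H1)
  have "(\<lambda>x. \<phi> x * ?\<psi> x) \<in> test_functions D"
    by (intro test_functions_mult \<psi> test_functions_cont_diff [OF \<phi>])
  from integral_partial_derivative_test_function [OF D(1) this b]
  have e1: "2 * (LINT x|lebesgue_on D. ?\<psi> x * ?d x) + (LINT x|lebesgue_on D. (\<phi> x)\<^sup>2) = 0"
    unfolding d\<phi>\<psi>b using i1 i2 by simp
  have "(LINT x|lebesgue_on D. \<phi> x * frechet_derivative ?\<psi> (at x) b) =
      (LINT x|lebesgue_on D. ?\<psi> x * ?d x) + (LINT x|lebesgue_on D. (\<phi> x)\<^sup>2)"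
    unfolding d\<psi>b using i1 i2 by (simp add: algebra_simps power2_eq_square)
  moreover have "(LINT x|lebesgue_on D. \<phi> x * frechet_derivative ?\<psi> (at x) b) =
      - (LINT x|lebesgue_on D. (?g x \<bullet> b) * ?\<psi> x)"
    using weak_gradient_H1(2) [OF H] \<psi> b unfolding has_weak_gradient_def by blast
  ultimately have e2: "(LINT x|lebesgue_on D. (\<phi> x)\<^sup>2) = - 2 * (LINT x|lebesgue_on D. (?g x \<bullet> b) * ?\<psi> x)"
    using e1 by linarith
  also have "\<dots> = (LINT x|lebesgue_on D. - 2 * ((?g x \<bullet> b) * ?\<psi> x))"
    by simp
  \<comment> \<open>Since \<bar>x \<bullet> b\<bar> \<le> R on \<open>D\<close>, Young's inequality
    splits the product so that half of the integral of \<open>\<phi>\<close> squared can be absorbed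
    on the left; this doubles 2 R^2 to the constant 4 R^2.\<close>
  also have "\<dots> \<le> (LINT x|lebesgue_on D. 2 * R\<^sup>2 * (norm (?g x))\<^sup>2 + (\<phi> x)\<^sup>2 / 2)"
  proof (rule integral_mono_AE)
    have "- 2 * ((?g x \<bullet> b) * ?\<psi> x) \<le> 2 * R\<^sup>2 * (norm (?g x))\<^sup>2 + (\<phi> x)\<^sup>2 / 2" if "x \<in> D" for x
    proof -
      have x: "\<bar>x \<bullet> b\<bar> \<le> R"
        using Basis_le_norm [OF b, of x] that D(3) by (auto simp: dist_norm)
      have g: "\<bar>?g x \<bullet> b\<bar> \<le> norm (?g x)"
        by (rule Basis_le_norm [OF b])
      have "- 2 * ((?g x \<bullet> b) * ?\<psi> x) \<le> 2 * (\<bar>?g x \<bullet> b\<bar> * \<bar>x \<bullet> b\<bar> * \<bar>\<phi> x\<bar>)"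
        using abs_ge_minus_self [of "(?g x \<bullet> b) * ?\<psi> x"] by (simp only: abs_mult mult.assoc)
      also have "\<dots> \<le> 2 * (norm (?g x) * R * \<bar>\<phi> x\<bar>)"
        using x g by (intro mult_left_mono mult_right_mono mult_mono) auto
      also have "\<dots> = 2 * (2 * R * norm (?g x)) * \<bar>\<phi> x\<bar> / 2" by simp
      also have "\<dots> \<le> ((2 * R * norm (?g x))\<^sup>2 + \<bar>\<phi> x\<bar>\<^sup>2) / 2"
        by (intro divide_right_mono sum_squares_bound) auto
      finally show ?thesis by (simp add: power_mult_distrib add_divide_distrib)
    qed
    then show "AE x in lebesgue_on D. - 2 * ((?g x \<bullet> b) * ?\<psi> x) \<le> 2 * R\<^sup>2 * (norm (?g x))\<^sup>2 + (\<phi> x)\<^sup>2 / 2"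
      by (intro AE_I2) (simp only: space_lebesgue_on)
    show "integrable (lebesgue_on D) (\<lambda>x. - 2 * ((?g x \<bullet> b) * ?\<psi> x))"
      by (intro integrable_mult_right i3)
    show "integrable (lebesgue_on D) (\<lambda>x. 2 * R\<^sup>2 * (norm (?g x))\<^sup>2 + (\<phi> x)\<^sup>2 / 2)"
      by (intro Bochner_Integration.integrable_add integrable_mult_right integrable_divide i2 i4)
  qed
  also have "\<dots> = 2 * R\<^sup>2 * sq_int D ?g + (LINT x|lebesgue_on D. (\<phi> x)\<^sup>2) / 2"
    using i2 i4 by (simp add: sq_int_def)
  finally show ?thesis by (simp add: sq_int_def)
qed

section \<open>The closure of the test functions in the H1 norm\<close>

lemma H1_norm_square: "(H1_norm D v)\<^sup>2 = sq_int D v + sq_int D (weak_gradient D v)"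
  by (simp add: H1_norm_def L2_norm_on_square sq_int_nonneg)

lemma H1_norm_tendsto_0_iff:
  "(\<lambda>n. H1_norm D (v n)) \<longlonglongrightarrow> 0 \<longleftrightarrow>
    (\<lambda>n. sq_int D (v n) + sq_int D (weak_gradient D (v n))) \<longlonglongrightarrow> 0"
  unfolding H1_norm_square [symmetric]
  by (metis tendsto_power_zero tendsto_power_strong power_tendsto_0_iff zero_less_numeral)

lemma H10_H1: "v \<in> H10 D \<Longrightarrow> v \<in> H1 D"
  by (simp add: H10_def)

lemma sq_int_weak_gradient_minus_le:
  assumes D: "open D" "bounded D" and u: "u \<in> H1 D" "v \<in> H1 D"
  shows "sq_int D (weak_gradient D (\<lambda>x. u x - v x)) \<le>
    2 * sq_int D (weak_gradient D u) + 2 * sq_int D (weak_gradient D v)"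
proof -
  have "sq_int D (weak_gradient D (\<lambda>x. u x - v x)) = sq_int D (\<lambda>x. weak_gradient D u x - weak_gradient D v x)"
    using D u by (intro sq_int_cong_AE H1_minus L2_measurable L2_minus weak_gradient_H1)
  also have "\<dots> \<le> 2 * sq_int D (weak_gradient D u) + 2 * sq_int D (weak_gradient D v)"
    using u by (intro sq_int_minus_le weak_gradient_H1)
  finally show ?thesis .
qed

lemma sq_int_weak_gradient_add_le:
  assumes D: "open D" "bounded D" and u: "u \<in> H1 D" "v \<in> H1 D"
  shows "sq_int D (weak_gradient D (\<lambda>x. u x + v x)) \<le>
    2 * sq_int D (weak_gradient D u) + 2 * sq_int D (weak_gradient D v)"
proof -
  have "sq_int D (weak_gradient D (\<lambda>x. u x + v x)) = sq_int D (\<lambda>x. weak_gradient D u x + weak_gradient D v x)"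
    using D u by (intro sq_int_cong_AE H1_add L2_measurable L2_add weak_gradient_H1)
  also have "\<dots> \<le> 2 * sq_int D (weak_gradient D u) + 2 * sq_int D (weak_gradient D v)"
    using u by (intro sq_int_add_le weak_gradient_H1)
  finally show ?thesis .
qed

lemma sq_int_weak_gradient_scale:
  assumes D: "open D" "bounded D" and u: "u \<in> H1 D"
  shows "sq_int D (weak_gradient D (\<lambda>x. c * u x)) = c\<^sup>2 * sq_int D (weak_gradient D u)"
proof -
  have "sq_int D (weak_gradient D (\<lambda>x. c * u x)) = sq_int D (\<lambda>x. c *\<^sub>R weak_gradient D u x)"
    using D u by (intro sq_int_cong_AE H1_scale L2_measurable L2_scaleR weak_gradient_H1)
  then show ?thesis by (simp add: sq_int_scaleR)
qed

text \<open>The approximating test functions are added; the squared H1 norm of the sum of the two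
  errors is at most twice the sum of their squared norms.\<close>

lemma H10_add:
  assumes D: "open D" "bounded D" and u: "u \<in> H10 D" "v \<in> H10 D"
  shows "(\<lambda>x. u x + v x) \<in> H10 D"
proof -
  obtain \<phi> \<psi> where \<phi>: "\<And>n. \<phi> n \<in> test_functions D" "(\<lambda>n. H1_norm D (\<lambda>x. u x - \<phi> n x)) \<longlonglongrightarrow> 0"
    and \<psi>: "\<And>n. \<psi> n \<in> test_functions D" "(\<lambda>n. H1_norm D (\<lambda>x. v x - \<psi> n x)) \<longlonglongrightarrow> 0"
    using u by (auto simp: H10_def)
  have H: "u \<in> H1 D" "v \<in> H1 D" using u by (auto intro: H10_H1)
  define p q where "p n x = u x - \<phi> n x" and "q n x = v x - \<psi> n x" for n x
  have pq: "p n \<in> H1 D" "q n \<in> H1 D" for n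
    unfolding p_def q_def by (intro H1_minus(1) D H test_functions_H1 \<phi>(1) \<psi>(1))+
  have eq: "(\<lambda>x. u x + v x - (\<phi> n x + \<psi> n x)) = (\<lambda>x. p n x + q n x)" for n
    by (simp add: p_def q_def fun_eq_iff)
  let ?e = "\<lambda>v. sq_int D v + sq_int D (weak_gradient D v)"
  have "(\<lambda>n. ?e (p n)) \<longlonglongrightarrow> 0" "(\<lambda>n. ?e (q n)) \<longlonglongrightarrow> 0"
    using \<phi>(2) \<psi>(2) by (simp_all add: H1_norm_tendsto_0_iff p_def [abs_def] q_def [abs_def])
  from tendsto_add [OF tendsto_mult_left [OF this(1), of 2] tendsto_mult_left [OF this(2), of 2]]
  have "(\<lambda>n. 2 * ?e (p n) + 2 * ?e (q n)) \<longlonglongrightarrow> 0" by simp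
  then have "(\<lambda>n. ?e (\<lambda>x. p n x + q n x)) \<longlonglongrightarrow> 0"
  proof (rule tendsto_0_le [where K = 1], intro always_eventually allI)
    fix n
    have "?e (\<lambda>x. p n x + q n x) \<le> 2 * ?e (p n) + 2 * ?e (q n)"
      using sq_int_add_le [OF H1_L2 [OF pq(1)] H1_L2 [OF pq(2)], of n n]
        sq_int_weak_gradient_add_le [OF D pq, of n n] by simp
    then show "norm (?e (\<lambda>x. p n x + q n x)) \<le> norm (2 * ?e (p n) + 2 * ?e (q n)) * 1"
      by (simp add: sq_int_nonneg add_nonneg_nonneg)
  qed
  then have "(\<lambda>n. H1_norm D (\<lambda>x. u x + v x - (\<phi> n x + \<psi> n x))) \<longlonglongrightarrow> 0"
    unfolding eq by (simp add: H1_norm_tendsto_0_iff)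
  then show ?thesis
    using H \<phi> \<psi> D unfolding H10_def
    by (auto intro!: H1_add exI [of _ "\<lambda>n x. \<phi> n x + \<psi> n x"] test_functions_add)
qed

lemma H10_scale:
  assumes D: "open D" "bounded D" and u: "u \<in> H10 D"
  shows "(\<lambda>x. c * u x) \<in> H10 D"
proof -
  obtain \<phi> where \<phi>: "\<And>n. \<phi> n \<in> test_functions D" "(\<lambda>n. H1_norm D (\<lambda>x. u x - \<phi> n x)) \<longlonglongrightarrow> 0"
    using u by (auto simp: H10_def)
  have H: "u \<in> H1 D" using u by (auto intro: H10_H1)
  have m: "(\<lambda>x. u x - \<phi> n x) \<in> H1 D" for n
    by (intro H1_minus(1) D H test_functions_H1 \<phi>(1))
  have eq: "(\<lambda>x. c * u x - c * \<phi> n x) = (\<lambda>x. c * (u x - \<phi> n x))" for n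
    by (simp add: algebra_simps)
  have "sq_int D (\<lambda>x. c * (u x - \<phi> n x)) = c\<^sup>2 * sq_int D (\<lambda>x. u x - \<phi> n x)" for n
    using sq_int_scaleR [of D c "\<lambda>x. u x - \<phi> n x"] by simp
  moreover have "(\<lambda>n. c\<^sup>2 * (sq_int D (\<lambda>x. u x - \<phi> n x) + sq_int D (weak_gradient D (\<lambda>x. u x - \<phi> n x)))) \<longlonglongrightarrow> c\<^sup>2 * 0"
    using \<phi>(2) by (intro tendsto_mult_left) (simp add: H1_norm_tendsto_0_iff)
  ultimately have "(\<lambda>n. H1_norm D (\<lambda>x. c * u x - c * \<phi> n x)) \<longlonglongrightarrow> 0"
    unfolding eq H1_norm_tendsto_0_iff
    by (simp add: sq_int_weak_gradient_scale [OF D m] distrib_left)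
  then show ?thesis
    using H \<phi> D unfolding H10_def
    by (auto intro!: H1_scale exI [of _ "\<lambda>n x. c * \<phi> n x"] test_functions_scale)
qed

text \<open>By density of the test functions. The approximant \<open>\<phi> n\<close> is compared
  with \<open>v\<close> twice, once for the function and once for the gradient, and each comparison
  costs a factor 2; together with 4 R^2 this makes 16 R^2.\<close>

lemma poincare_H10:
  assumes D: "open D" "bounded D" "D \<subseteq> cball 0 R" and v: "v \<in> H10 D"
  shows "sq_int D v \<le> 16 * R\<^sup>2 * sq_int D (weak_gradient D v)"
proof -
  obtain \<phi> where \<phi>: "\<And>n. \<phi> n \<in> test_functions D" "(\<lambda>n. H1_norm D (\<lambda>x. v x - \<phi> n x)) \<longlonglongrightarrow> 0"
    using v by (auto simp: H10_def)
  note D' = D(1,2)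
  have H: "v \<in> H1 D" using v by (rule H10_H1)
  define p where "p n x = v x - \<phi> n x" for n x
  have p: "p n \<in> H1 D" for n
    unfolding p_def by (intro H1_minus(1) D(1,2) H test_functions_H1 \<phi>(1))
  let ?e = "\<lambda>v. sq_int D v + sq_int D (weak_gradient D v)"
  have "(\<lambda>n. ?e (p n)) \<longlonglongrightarrow> 0"
    using \<phi>(2) by (simp add: H1_norm_tendsto_0_iff p_def [abs_def])
  then have lim: "(\<lambda>n. 16 * R\<^sup>2 * sq_int D (weak_gradient D v) + (2 + 16 * R\<^sup>2) * ?e (p n)) \<longlonglongrightarrow>
      16 * R\<^sup>2 * sq_int D (weak_gradient D v) + (2 + 16 * R\<^sup>2) * 0"
    by (intro tendsto_intros)
  have "sq_int D v \<le> 16 * R\<^sup>2 * sq_int D (weak_gradient D v) + (2 + 16 * R\<^sup>2) * ?e (p n)" for n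
  proof -
    have "sq_int D v = sq_int D (\<lambda>x. p n x + \<phi> n x)"
      by (simp add: p_def)
    also have "\<dots> \<le> 2 * sq_int D (p n) + 2 * sq_int D (\<phi> n)"
      by (intro sq_int_add_le H1_L2 p test_functions_L2 D' \<phi>)
    also have "sq_int D (\<phi> n) \<le> 4 * R\<^sup>2 * sq_int D (weak_gradient D (\<phi> n))"
      by (rule poincare_test_function [OF D \<phi>(1)])
    also have "\<phi> n = (\<lambda>x. v x - p n x)" by (simp add: p_def)
    also have "sq_int D (weak_gradient D (\<lambda>x. v x - p n x)) \<le>
        2 * sq_int D (weak_gradient D v) + 2 * sq_int D (weak_gradient D (p n))"
      by (rule sq_int_weak_gradient_minus_le [OF D' H p])
    finally have "sq_int D v \<le> 2 * sq_int D (p n) + 2 * (4 * R\<^sup>2 *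
        (2 * sq_int D (weak_gradient D v) + 2 * sq_int D (weak_gradient D (p n))))"
      by (simp add: mult_left_mono)
    moreover have "0 \<le> 16 * R\<^sup>2 * sq_int D (p n)" "0 \<le> 2 * sq_int D (weak_gradient D (p n))"
      by (simp_all add: sq_int_nonneg)
    ultimately show ?thesis by (simp add: algebra_simps)
  qed
  then show ?thesis
    using LIMSEQ_le_const [OF lim] by auto
qed

subsection \<open>Finite element spaces\<close>

text \<open>The points of \<open>U\<close> where the affine function is nonzero form an open null
  set, hence there are none. A function that vanishes on an open set has no slope: a short step in
  direction \<open>g\<close> would increase it.\<close>

lemma affine_AE_zero_imp_zero:
  fixes g :: "'a::euclidean_space"
  assumes "open U" "U \<noteq> {}" "AE x in lebesgue. x \<in> U \<longrightarrow> g \<bullet> x + c = 0"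
  shows "g = 0" "c = 0"
proof -
  let ?B = "U \<inter> {x. g \<bullet> x + c \<noteq> 0}"
  have op: "open ?B"
    using assms(1) by (intro open_Int open_Collect_neq continuous_intros)
  have "negligible ?B"
  proof -
    have "?B \<in> sets lebesgue" using op by auto
    moreover have "AE x in lebesgue. x \<notin> ?B"
      using assms(3) by eventually_elim auto
    ultimately show ?thesis
      by (simp only: negligible_iff_null_sets AE_iff_null_sets)
  qed
  then have "?B = {}"
    using op open_not_negligible by blast
  then have z: "g \<bullet> x + c = 0" if "x \<in> U" for x using that by blast
  obtain p where p: "p \<in> U" using assms(2) by blast
  obtain \<epsilon> where \<epsilon>: "\<epsilon> > 0" "ball p \<epsilon> \<subseteq> U" using assms(1) p open_contains_ball by blast
  show g: "g = 0"
  proof (rule ccontr)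
    assume g: "g \<noteq> 0"
    \<comment> \<open>This step moves \<open>p\<close> by \<epsilon> / 2, so it stays inside the
      ball.\<close>
    define t where "t = \<epsilon> / (2 * norm g)"
    have t: "t > 0" using \<epsilon> g by (simp add: t_def)
    have "norm (t *\<^sub>R g) < \<epsilon>" using \<epsilon> g by (simp add: t_def)
    then have "p + t *\<^sub>R g \<in> U" using \<epsilon>(2) by (auto simp: dist_norm)
    moreover have "g \<bullet> (p + t *\<^sub>R g) + c = (g \<bullet> p + c) + t * (g \<bullet> g)"
      by (simp add: inner_add_right)
    ultimately have "t * (g \<bullet> g) = 0" using z [of p] z [of "p + t *\<^sub>R g"] p by linarith
    with t g show False by simp
  qed
  show "c = 0" using z [OF p] g by simp
qed

lemma fe_space_H10: "v \<in> fe_space D \<T> \<Longrightarrow> v \<in> H10 D"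
  by (simp add: fe_space_def)

lemma fe_space_H1: "v \<in> fe_space D \<T> \<Longrightarrow> v \<in> H1 D"
  by (intro H10_H1 fe_space_H10)

lemma fe_space_add:
  assumes D: "open D" "bounded D" and u: "u \<in> fe_space D \<T>" "v \<in> fe_space D \<T>"
  shows "(\<lambda>x. u x + v x) \<in> fe_space D \<T>"
proof -
  have "\<exists>g c. \<forall>x\<in>T. u x + v x = g \<bullet> x + c" if "T \<in> \<T>" for T
  proof -
    obtain g c g' c' where "\<forall>x\<in>T. u x = g \<bullet> x + c" "\<forall>x\<in>T. v x = g' \<bullet> x + c'"
      using u \<open>T \<in> \<T>\<close> unfolding fe_space_def by blast
    then have "\<forall>x\<in>T. u x + v x = (g + g') \<bullet> x + (c + c')" by (simp add: inner_add_left)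
    then show ?thesis by blast
  qed
  then show ?thesis
    using H10_add [OF D fe_space_H10 [OF u(1)] fe_space_H10 [OF u(2)]] by (simp add: fe_space_def)
qed

lemma fe_space_scale:
  assumes D: "open D" "bounded D" and u: "u \<in> fe_space D \<T>"
  shows "(\<lambda>x. k * u x) \<in> fe_space D \<T>"
proof -
  have "\<exists>g c. \<forall>x\<in>T. k * u x = g \<bullet> x + c" if "T \<in> \<T>" for T
  proof -
    obtain g c where "\<forall>x\<in>T. u x = g \<bullet> x + c"
      using u \<open>T \<in> \<T>\<close> unfolding fe_space_def by blast
    then have "\<forall>x\<in>T. k * u x = (k *\<^sub>R g) \<bullet> x + k * c" by (simp add: distrib_left)
    then show ?thesis by blast
  qed
  then show ?thesis
    using H10_scale [OF D fe_space_H10 [OF u]] by (simp add: fe_space_def)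
qed

lemma H10_zero:
  assumes D: "open D" "bounded D"
  shows "(\<lambda>x. 0) \<in> H10 D"
proof -
  have 0: "(\<lambda>x. 0) \<in> H1 D" by (intro test_functions_H1 D test_functions_zero)
  have "sq_int D (weak_gradient D (\<lambda>x. 0)) = 0"
    using sq_int_weak_gradient_scale [OF D 0, of 0] by simp
  moreover have "sq_int D (\<lambda>x. 0 :: real) = 0" by (simp add: sq_int_def)
  ultimately have "H1_norm D (\<lambda>x. 0 - 0) = 0"
    by (simp add: H1_norm_def L2_norm_on_square)
  then show ?thesis
    using 0 test_functions_zero [of D] unfolding H10_def by (auto intro!: exI [of _ "\<lambda>n x. 0"])
qed

lemma fe_space_zero:
  assumes D: "open D" "bounded D"
  shows "(\<lambda>x. 0) \<in> fe_space D \<T>"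
  unfolding fe_space_def using H10_zero [OF D] by (auto intro!: exI [of _ 0])

lemma fe_space_sum:
  assumes D: "open D" "bounded D" and e: "\<And>j. j \<in> J \<Longrightarrow> e j \<in> fe_space D \<T>"
  shows "(\<lambda>x. \<Sum>j\<in>J. c j * e j x) \<in> fe_space D \<T>"
  using e by (induction J rule: infinite_finite_induct)
    (auto intro!: fe_space_zero D fe_space_add [OF D] fe_space_scale [OF D])

text \<open>Every point of \<open>D\<close> lies in a full-dimensional element \<open>T\<close>. The
  interior of \<open>T\<close> is a nonempty open subset of the closure of \<open>D\<close>, so it
  meets \<open>D\<close> in an open set; vanishing there makes the affine expression zero, and this
  expression is valid on all of the closed \<open>T\<close>, including \<open>x\<close>.\<close>

lemma fe_space_AE_zero:
  assumes D: "open D" and mesh: "conforming_mesh D \<T>" and v: "v \<in> fe_space D \<T>"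
    and zero: "AE x in lebesgue_on D. v x = 0" and x: "x \<in> D"
  shows "v x = 0"
proof -
  have "x \<in> \<Union>\<T>" using mesh x closure_subset [of D] by (auto simp: conforming_mesh_def)
  then obtain T where T: "T \<in> \<T>" "x \<in> T" by blast
  have s: "int DIM('a) simplex T" using mesh T by (auto simp: conforming_mesh_def)
  have "interior T = rel_interior T"
    using aff_dim_simplex [OF s] by (intro rel_interior_interior [symmetric]) (simp add: aff_dim_eq_full)
  then have "interior T \<noteq> {}"
    using rel_interior_eq_empty [OF convex_simplex [OF s]] T by auto
  moreover have "interior T \<subseteq> closure D"
    using mesh T interior_subset by (fastforce simp: conforming_mesh_def)
  ultimately have U: "interior T \<inter> D \<noteq> {}"
    by (metis Int_absorb2 open_Int_closure_eq_empty open_interior)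
  obtain g c where gc: "\<And>x. x \<in> T \<Longrightarrow> v x = g \<bullet> x + c"
    using v T by (auto simp: fe_space_def)
  have "AE x in lebesgue. x \<in> D \<longrightarrow> v x = 0"
    using zero D by (simp add: AE_restrict_space_iff borel_open)
  then have "AE x in lebesgue. x \<in> interior T \<inter> D \<longrightarrow> g \<bullet> x + c = 0"
    by eventually_elim (use gc interior_subset in force)
  from affine_AE_zero_imp_zero [OF _ U this] D have "g = 0" "c = 0" by auto
  then show ?thesis using gc [OF T(2)] by simp
qed

text \<open>An affine function that vanishes at the vertices of a simplex vanishes on their convex
  hull. Together with finiteness of the triangulation this is the source of finite
  dimension.\<close>

lemma fe_space_vertices:
  assumes mesh: "conforming_mesh D \<T>"
  obtains V where "finite V"
    "\<And>v x. v \<in> fe_space D \<T> \<Longrightarrow> (\<And>p. p \<in> V \<Longrightarrow> v p = 0) \<Longrightarrow> x \<in> D \<Longrightarrow> v x = 0"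
proof -
  have "\<exists>C. finite C \<and> T = convex hull C" if "T \<in> \<T>" for T
    using mesh that unfolding conforming_mesh_def simplex by blast
  then obtain C where C: "\<And>T. T \<in> \<T> \<Longrightarrow> finite (C T) \<and> T = convex hull (C T)" by metis
  have fin: "finite (\<Union>T\<in>\<T>. C T)"
    using mesh C by (auto simp: conforming_mesh_def triangulation_def)
  show thesis
  proof (rule that [OF fin])
    fix v x assume v: "v \<in> fe_space D \<T>" and z: "\<And>p. p \<in> (\<Union>T\<in>\<T>. C T) \<Longrightarrow> v p = 0" and x: "x \<in> D"
    have "x \<in> \<Union>\<T>" using mesh x closure_subset [of D] by (auto simp: conforming_mesh_def)
    then obtain T where T: "T \<in> \<T>" "x \<in> T" by blast
    obtain g c where gc: "\<And>x. x \<in> T \<Longrightarrow> v x = g \<bullet> x + c"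
      using v T by (auto simp: fe_space_def)
    have "C T \<subseteq> {x. g \<bullet> x = - c}"
    proof
      fix p assume p: "p \<in> C T"
      then have "p \<in> T" using C [OF T(1)] hull_inc by metis
      with gc [of p] z [of p] p T show "p \<in> {x. g \<bullet> x = - c}"
        by (auto simp: eq_neg_iff_add_eq_0)
    qed
    then have "convex hull (C T) \<subseteq> {x. g \<bullet> x = - c}"
      by (intro hull_minimal convex_hyperplane)
    then show "v x = 0" using C [OF T(1)] T(2) gc [OF T(2)] by auto
  qed
qed

text \<open>Gaussian elimination with more unknowns (\<open>J\<close>) than equations
  (\<open>V\<close>). If equation \<open>p\<close> has a nonzero entry in column \<open>i\<close>,
  the unknown \<open>i\<close> is eliminated with it, which lowers both counts by one.\<close>

lemma homogeneous_system_nontrivial: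
  fixes e :: "'j \<Rightarrow> 'p \<Rightarrow> 'k::field"
  assumes "finite V" "finite J" "card V < card J"
  shows "\<exists>c. (\<exists>j\<in>J. c j \<noteq> 0) \<and> (\<forall>p\<in>V. (\<Sum>j\<in>J. c j * e j p) = 0)"
  using assms
proof (induction V arbitrary: J e rule: finite_induct)
  case empty
  then obtain j where "j \<in> J" by fastforce
  then show ?case by (intro exI [of _ "\<lambda>_. 1"]) auto
next
  case (insert p V)
  show ?case
  proof (cases "\<forall>j\<in>J. e j p = 0")
    case True
    have "card V < card J" using insert by simp
    from insert.IH [OF insert.prems(1) this, of e] obtain c where
      "\<exists>j\<in>J. c j \<noteq> 0" "\<forall>p\<in>V. (\<Sum>j\<in>J. c j * e j p) = 0" by blast
    then show ?thesis using True by (intro exI [of _ c]) auto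
  next
    case False
    then obtain i where i: "i \<in> J" "e i p \<noteq> 0" by blast
    let ?e = "\<lambda>j q. e j q - e j p / e i p * e i q"
    have "card V < card (J - {i})" "finite (J - {i})" using insert i by auto
    from insert.IH [OF this(2,1), of ?e] obtain c where
      c: "\<exists>j\<in>J - {i}. c j \<noteq> 0" "\<forall>q\<in>V. (\<Sum>j\<in>J - {i}. c j * ?e j q) = 0" by blast
    \<comment> \<open>The eliminated unknown is recovered by solving equation \<open>p\<close> for
      it.\<close>
    define c' where "c' j = (if j = i then - (\<Sum>j\<in>J - {i}. c j * (e j p / e i p)) else c j)" for j
    have eq: "(\<Sum>j\<in>J. c' j * e j q) = (\<Sum>j\<in>J - {i}. c j * ?e j q)" for q
    proof -
      have "(\<Sum>j\<in>J. c' j * e j q) = c' i * e i q + (\<Sum>j\<in>J - {i}. c' j * e j q)"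
        using insert.prems i by (simp add: sum.remove)
      also have "(\<Sum>j\<in>J - {i}. c' j * e j q) = (\<Sum>j\<in>J - {i}. c j * e j q)"
        by (intro sum.cong) (auto simp: c'_def)
      also have "c' i * e i q = - (\<Sum>j\<in>J - {i}. c j * (e j p / e i p * e i q))"
        by (simp add: c'_def sum_distrib_right mult.assoc)
      finally show ?thesis by (simp add: right_diff_distrib sum_subtractf)
    qed
    have "\<forall>q\<in>insert p V. (\<Sum>j\<in>J. c' j * e j q) = 0"
      unfolding eq using c(2) i by auto
    moreover have "\<exists>j\<in>J. c' j \<noteq> 0" using c(1) by (auto simp: c'_def)
    ultimately show ?thesis by blast
  qed
qed

text \<open>The span of a maximal orthonormal family is everything, since a nonzero remainder could be
  normalised and added; evaluation at \<open>V\<close> bounds the length of such a family.\<close>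

lemma orthonormal_basis_exists:
  fixes W :: "('a \<Rightarrow> real) set" and E :: "('a \<Rightarrow> real) \<Rightarrow> ('a \<Rightarrow> real) \<Rightarrow> real"
  assumes sum: "\<And>(n::nat) c e. (\<And>j. j < n \<Longrightarrow> e j \<in> W) \<Longrightarrow> (\<lambda>x. \<Sum>j<n. c j * e j x) \<in> W"
    and diff: "\<And>u v. u \<in> W \<Longrightarrow> v \<in> W \<Longrightarrow> (\<lambda>x. u x - v x) \<in> W"
    and scale: "\<And>u c. u \<in> W \<Longrightarrow> (\<lambda>x. c * u x) \<in> W"
    and E_sum: "\<And>(n::nat) c e v. (\<And>j. j < n \<Longrightarrow> e j \<in> W) \<Longrightarrow> v \<in> W \<Longrightarrow>
      E (\<lambda>x. \<Sum>j<n. c j * e j x) v = (\<Sum>j<n. c j * E (e j) v)"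
    and E_diff: "\<And>u v w. u \<in> W \<Longrightarrow> v \<in> W \<Longrightarrow> w \<in> W \<Longrightarrow> E (\<lambda>x. u x - v x) w = E u w - E v w"
    and E_scale: "\<And>u v c. u \<in> W \<Longrightarrow> v \<in> W \<Longrightarrow> E (\<lambda>x. c * u x) v = c * E u v"
    and E_sym: "\<And>u v. E u v = E v u"
    and E_nonneg: "\<And>u. u \<in> W \<Longrightarrow> E u u \<ge> 0"
    and E_zero: "\<And>u x. u \<in> W \<Longrightarrow> E u u = 0 \<Longrightarrow> x \<in> D \<Longrightarrow> u x = 0"
    and V: "finite V" "\<And>u. u \<in> W \<Longrightarrow> (\<And>p. p \<in> V \<Longrightarrow> u p = 0) \<Longrightarrow> E u u = 0"
  obtains n :: nat and e where "\<And>j. j < n \<Longrightarrow> e j \<in> W"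
    "\<And>j k. j < n \<Longrightarrow> k < n \<Longrightarrow> E (e j) (e k) = (if j = k then 1 else 0)"
    "\<And>v x. v \<in> W \<Longrightarrow> x \<in> D \<Longrightarrow> v x = (\<Sum>j<n. E v (e j) * e j x)"
proof -
  define orth where "orth n e \<longleftrightarrow> (\<forall>j<n. e j \<in> W) \<and>
    (\<forall>j<n. \<forall>k<n. E (e j) (e k) = (if j = k then 1 else 0))" for n :: nat and e
  \<comment> \<open>A longer family would have a nontrivial combination that vanishes on
    \<open>V\<close>. Its energy is then zero, but by orthonormality it is also the sum of the
    squared coefficients.\<close>
  have bound: "n \<le> card V" if "orth n e" for n e
  proof (rule ccontr)
    assume "\<not> n \<le> card V"
    then have "card V < card {..<n}" by simp
    from homogeneous_system_nontrivial [OF V(1) _ this, of e]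
    obtain c where c: "\<exists>j\<in>{..<n}. c j \<noteq> 0" "\<forall>p\<in>V. (\<Sum>j<n. c j * e j p) = 0" by blast
    have e: "\<And>j. j < n \<Longrightarrow> e j \<in> W" using that by (simp add: orth_def)
    let ?u = "\<lambda>x. \<Sum>j<n. c j * e j x"
    have u: "?u \<in> W" by (intro sum e)
    have "E (e j) ?u = c j" if j: "j < n" for j
    proof -
      have "E (e j) ?u = (\<Sum>k<n. c k * E (e k) (e j))"
        unfolding E_sym [of "e j" ?u] by (intro E_sum e j)
      also have "\<dots> = (\<Sum>k<n. if k = j then c k else 0)"
        using \<open>orth n e\<close> j by (intro sum.cong) (auto simp: orth_def)
      finally show ?thesis using j by simp
    qed
    then have "E ?u ?u = (\<Sum>j<n. c j * c j)"
      by (simp add: E_sum [OF e u])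
    moreover have "E ?u ?u = 0" using u c(2) by (intro V) auto
    ultimately have "(\<Sum>j<n. c j * c j) = 0" by simp
    then have "\<forall>j\<in>{..<n}. c j * c j = 0"
      by (subst sum_nonneg_eq_0_iff [symmetric]) auto
    with c(1) show False by auto
  qed
  have "\<exists>e. orth 0 e" by (auto simp: orth_def)
  moreover have "\<forall>n. (\<exists>e. orth n e) \<longrightarrow> n \<le> card V" using bound by blast
  ultimately obtain n where n: "\<exists>e. orth n e" "\<And>k. (\<exists>e. orth k e) \<Longrightarrow> k \<le> n"
    using Nat.ex_has_greatest_nat [of "\<lambda>n. \<exists>e. orth n e" 0 "card V"] by metis
  then obtain e where o: "orth n e" by blast
  have e: "\<And>j. j < n \<Longrightarrow> e j \<in> W" using o by (simp add: orth_def)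
  show thesis
  proof (rule that [of n e])
    show "e j \<in> W" if "j < n" for j using that by (rule e)
    show "E (e j) (e k) = (if j = k then 1 else 0)" if "j < n" "k < n" for j k
      using that o by (simp add: orth_def)
    fix v x assume v: "v \<in> W" and x: "x \<in> D"
    define s where "s = (\<lambda>x. \<Sum>j<n. E v (e j) * e j x)"
    define r where "r = (\<lambda>x. v x - s x)"
    have s: "s \<in> W" unfolding s_def by (intro sum e)
    have r: "r \<in> W" unfolding r_def by (rule diff [OF v s])
    have re: "E r (e k) = 0" if k: "k < n" for k
    proof -
      have "E s (e k) = (\<Sum>j<n. if j = k then E v (e j) else 0)"
      proof -
        have "E s (e k) = (\<Sum>j<n. E v (e j) * E (e j) (e k))"
          unfolding s_def by (intro E_sum e k)
        also have "\<dots> = (\<Sum>j<n. if j = k then E v (e j) else 0)"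
          using o k by (intro sum.cong) (auto simp: orth_def)
        finally show ?thesis .
      qed
      also have "\<dots> = E v (e k)" using k by simp
      finally show ?thesis using E_diff [OF v s e [OF k]] by (simp add: r_def)
    qed
    have "E r r = 0"
    proof (rule ccontr)
      assume "E r r \<noteq> 0"
      then have pos: "E r r > 0" using E_nonneg [OF r] by simp
      define q where "q = (\<lambda>x. (1 / sqrt (E r r)) * r x)"
      have q: "q \<in> W" unfolding q_def by (rule scale [OF r])
      have qz: "E q z = (1 / sqrt (E r r)) * E r z" if "z \<in> W" for z
        unfolding q_def by (rule E_scale [OF r that])
      have "E q q = 1"
      proof -
        have "E q q = (1 / sqrt (E r r)) * ((1 / sqrt (E r r)) * E r r)"
          using qz [OF q] qz [OF r] E_sym [of r q] by (simp only:)
        then show ?thesis using pos by (simp add: field_simps)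
      qed
      moreover have "E q (e k) = 0" if "k < n" for k
        using qz [OF e [OF that]] re [OF that] by simp
      moreover have "E (e k) q = 0" if "k < n" for k
        using calculation(2) [OF that] E_sym [of q "e k"] by simp
      ultimately have "E ((e(n := q)) j) ((e(n := q)) k) = (if j = k then 1 else 0)"
        if "j < Suc n" "k < Suc n" for j k
        using that o unfolding orth_def by (cases "j = n"; cases "k = n") (simp_all add: less_Suc_eq)
      moreover have "(e(n := q)) j \<in> W" if "j < Suc n" for j
        using that q e by (auto simp: less_Suc_eq)
      ultimately have "orth (Suc n) (e(n := q))"
        unfolding orth_def by blast
      then have "Suc n \<le> n" by (intro n(2)) blast
      then show False by simp
    qed
    from E_zero [OF r this x] show "v x = (\<Sum>j<n. E v (e j) * e j x)"
      by (simp add: r_def s_def)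
  qed
qed

subsection \<open>Weighted gradient forms\<close>

text \<open>The weight is an argument because the same form serves as energy (\<open>ac 0\<close>),
  as perturbation (\<open>ac m\<close>) and, with \<bar>\<open>ac m\<close>\<bar>, as dominating
  quadratic form; it is moreover linear in the weight, which gives the affine dependence on the
  parameters.\<close>

definition grad_form :: "'a::euclidean_space set \<Rightarrow> ('a \<Rightarrow> real) \<Rightarrow> ('a \<Rightarrow> real) \<Rightarrow> ('a \<Rightarrow> real) \<Rightarrow> real" where
  "grad_form D \<alpha> u v = (LINT x|lebesgue_on D. \<alpha> x * (weak_gradient D u x \<bullet> weak_gradient D v x))"

lemma Linf_mult_integrable:
  assumes "\<alpha> \<in> Linf D" "integrable (lebesgue_on D) h"
  shows "integrable (lebesgue_on D) (\<lambda>x. \<alpha> x * h x)"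
proof -
  obtain B where B: "AE x in lebesgue_on D. \<bar>\<alpha> x\<bar> \<le> B" and m: "\<alpha> \<in> borel_measurable (lebesgue_on D)"
    using assms(1) by (auto simp: Linf_def)
  have "integrable (lebesgue_on D) (\<lambda>x. B * h x)"
    using assms(2) by simp
  then show ?thesis
  proof (rule Bochner_Integration.integrable_bound)
    show "AE x in lebesgue_on D. norm (\<alpha> x * h x) \<le> norm (B * h x)"
      using B by eventually_elim (auto simp: abs_mult intro!: mult_right_mono)
  qed (use m assms(2) in auto)
qed

lemma grad_form_integrable:
  assumes "\<alpha> \<in> Linf D" "u \<in> H1 D" "v \<in> H1 D"
  shows "integrable (lebesgue_on D) (\<lambda>x. \<alpha> x * (weak_gradient D u x \<bullet> weak_gradient D v x))"
  using assms by (intro Linf_mult_integrable L2_integrable_inner weak_gradient_H1)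

lemma grad_form_sym: "grad_form D \<alpha> u v = grad_form D \<alpha> v u"
  by (simp add: grad_form_def inner_commute)

lemma grad_form_cong:
  assumes "\<And>x. x \<in> D \<Longrightarrow> u x = u' x"
  shows "grad_form D \<alpha> u v = grad_form D \<alpha> u' v"
  by (simp add: grad_form_def weak_gradient_cong [OF assms])

lemma grad_form_measurable:
  assumes "\<alpha> \<in> Linf D" "u \<in> L2 D" "v \<in> H1 D"
  shows "(\<lambda>x. \<alpha> x * (u x \<bullet> weak_gradient D v x)) \<in> borel_measurable (lebesgue_on D)"
  using assms L2_measurable [OF assms(2)] L2_measurable [OF weak_gradient_H1(1) [OF assms(3)]]
  by (auto simp: Linf_def intro!: borel_measurable_times borel_measurable_inner)

lemma grad_form_add:
  assumes D: "open D" "bounded D" and \<alpha>: "\<alpha> \<in> Linf D" and u: "u \<in> H1 D" "u' \<in> H1 D" "v \<in> H1 D"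
  shows "grad_form D \<alpha> (\<lambda>x. u x + u' x) v = grad_form D \<alpha> u v + grad_form D \<alpha> u' v"
proof -
  have "grad_form D \<alpha> (\<lambda>x. u x + u' x) v =
    (LINT x|lebesgue_on D. \<alpha> x * ((weak_gradient D u x + weak_gradient D u' x) \<bullet> weak_gradient D v x))"
    unfolding grad_form_def
  proof (rule integral_cong_AE)
    show "AE x in lebesgue_on D. \<alpha> x * (weak_gradient D (\<lambda>x. u x + u' x) x \<bullet> weak_gradient D v x) =
        \<alpha> x * ((weak_gradient D u x + weak_gradient D u' x) \<bullet> weak_gradient D v x)"
      using H1_add(2) [OF D u(1,2)] by eventually_elim simp
  qed (intro grad_form_measurable weak_gradient_H1(1) H1_add(1) L2_add assms)+
  then show ?thesis
    by (simp add: grad_form_def inner_add_left distrib_left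
      grad_form_integrable [OF \<alpha> u(1) u(3)] grad_form_integrable [OF \<alpha> u(2) u(3)])
qed

lemma grad_form_scale:
  assumes D: "open D" "bounded D" and \<alpha>: "\<alpha> \<in> Linf D" and u: "u \<in> H1 D" "v \<in> H1 D"
  shows "grad_form D \<alpha> (\<lambda>x. c * u x) v = c * grad_form D \<alpha> u v"
proof -
  have "grad_form D \<alpha> (\<lambda>x. c * u x) v =
    (LINT x|lebesgue_on D. \<alpha> x * ((c *\<^sub>R weak_gradient D u x) \<bullet> weak_gradient D v x))"
    unfolding grad_form_def
  proof (rule integral_cong_AE)
    show "AE x in lebesgue_on D. \<alpha> x * (weak_gradient D (\<lambda>x. c * u x) x \<bullet> weak_gradient D v x) =
        \<alpha> x * ((c *\<^sub>R weak_gradient D u x) \<bullet> weak_gradient D v x)"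
      using H1_scale(2) [OF D u(1), of c] by eventually_elim simp
  qed (intro grad_form_measurable weak_gradient_H1(1) H1_scale(1) L2_scaleR assms)+
  then show ?thesis
    by (simp add: grad_form_def mult.left_commute [of _ c])
qed

lemma grad_form_sum:
  assumes D: "open D" "bounded D" and \<alpha>: "\<alpha> \<in> Linf D"
    and e: "\<And>j. j \<in> J \<Longrightarrow> e j \<in> fe_space D \<T>" and v: "v \<in> fe_space D \<T>"
  shows "grad_form D \<alpha> (\<lambda>x. \<Sum>j\<in>J. c j * e j x) v = (\<Sum>j\<in>J. c j * grad_form D \<alpha> (e j) v)"
proof -
  have "(\<lambda>x. 0) \<in> H1 D" by (intro H10_H1 H10_zero D)
  from grad_form_scale [OF D \<alpha> this fe_space_H1 [OF v], of 0]
  have zero: "grad_form D \<alpha> (\<lambda>x. 0) v = 0" by simp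
  show ?thesis
    using e
  proof (induction J rule: infinite_finite_induct)
    case (insert j J)
    have "(\<lambda>x. c j * e j x) \<in> H1 D" "(\<lambda>x. \<Sum>j\<in>J. c j * e j x) \<in> H1 D" "e j \<in> H1 D"
      using insert.prems by (auto intro!: fe_space_H1 [of _ D \<T>] fe_space_sum D fe_space_scale)
    with insert show ?case
      using fe_space_H1 [OF v] by (simp add: grad_form_add [OF D \<alpha>] grad_form_scale [OF D \<alpha>])
  qed (simp_all add: zero)
qed

lemma Linf_abs: "\<alpha> \<in> Linf D \<Longrightarrow> (\<lambda>x. \<bar>\<alpha> x\<bar>) \<in> Linf D"
  by (auto simp: Linf_def)

text \<open>Cauchy-Schwarz and Young are applied at each point, for a weight that may change sign.
  The modulus of the weight is kept under the integral, so that the contributions of all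
  \<open>m\<close> can later be added before ellipticity is used.\<close>

lemma grad_form_abs_le:
  assumes \<alpha>: "\<alpha> \<in> Linf D" and u: "u \<in> H1 D" "v \<in> H1 D"
  shows "\<bar>grad_form D \<alpha> u v\<bar> \<le> (grad_form D (\<lambda>x. \<bar>\<alpha> x\<bar>) u u + grad_form D (\<lambda>x. \<bar>\<alpha> x\<bar>) v v) / 2"
proof -
  let ?g = "weak_gradient D"
  note i = grad_form_integrable [OF \<alpha>] grad_form_integrable [OF Linf_abs [OF \<alpha>]]
  have "\<bar>grad_form D \<alpha> u v\<bar> \<le> (LINT x|lebesgue_on D. \<bar>\<alpha> x * (?g u x \<bullet> ?g v x)\<bar>)"
    unfolding grad_form_def by (rule integral_abs_bound)
  also have "\<dots> \<le> (LINT x|lebesgue_on D. (\<bar>\<alpha> x\<bar> * (?g u x \<bullet> ?g u x) + \<bar>\<alpha> x\<bar> * (?g v x \<bullet> ?g v x)) / 2)"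
  proof (intro integral_mono integrable_abs integrable_divide Bochner_Integration.integrable_add i u)
    fix x
    have "2 * \<bar>?g u x \<bullet> ?g v x\<bar> \<le> ?g u x \<bullet> ?g u x + ?g v x \<bullet> ?g v x"
      using Cauchy_Schwarz_ineq2 [of "?g u x" "?g v x"] sum_squares_bound [of "norm (?g u x)" "norm (?g v x)"]
      by (simp add: power2_norm_eq_inner)
    from mult_left_mono [OF this, of "\<bar>\<alpha> x\<bar>"]
    show "\<bar>\<alpha> x * (?g u x \<bullet> ?g v x)\<bar> \<le> (\<bar>\<alpha> x\<bar> * (?g u x \<bullet> ?g u x) + \<bar>\<alpha> x\<bar> * (?g v x \<bullet> ?g v x)) / 2"
      by (simp add: abs_mult distrib_left)
  qed
  also have "\<dots> = (grad_form D (\<lambda>x. \<bar>\<alpha> x\<bar>) u u + grad_form D (\<lambda>x. \<bar>\<alpha> x\<bar>) v v) / 2"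
    unfolding grad_form_def using i(2) [OF u(1) u(1)] i(2) [OF u(2) u(2)] by simp
  finally show ?thesis .
qed

lemma grad_form_mono:
  assumes "\<alpha> \<in> Linf D" "\<beta> \<in> Linf D" "u \<in> H1 D" "AE x in lebesgue_on D. \<alpha> x \<le> \<beta> x"
  shows "grad_form D \<alpha> u u \<le> grad_form D \<beta> u u"
  unfolding grad_form_def
proof (intro integral_mono_AE grad_form_integrable assms)
  show "AE x in lebesgue_on D. \<alpha> x * (weak_gradient D u x \<bullet> weak_gradient D u x) \<le>
      \<beta> x * (weak_gradient D u x \<bullet> weak_gradient D u x)"
    using assms(4) by eventually_elim (auto intro: mult_right_mono)
qed

lemma grad_form_const: "grad_form D (\<lambda>x. r) u u = r * sq_int D (weak_gradient D u)"
  by (simp add: grad_form_def sq_int_def power2_norm_eq_inner)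

lemma Linf_const: "(\<lambda>x. r) \<in> Linf D"
  by (auto simp: Linf_def)

lemma Linf_scale: "\<alpha> \<in> Linf D \<Longrightarrow> (\<lambda>x. c * \<alpha> x) \<in> Linf D"
proof -
  assume \<alpha>: "\<alpha> \<in> Linf D"
  then obtain B where B: "AE x in lebesgue_on D. \<bar>\<alpha> x\<bar> \<le> B" by (auto simp: Linf_def)
  then have "AE x in lebesgue_on D. \<bar>c * \<alpha> x\<bar> \<le> \<bar>c\<bar> * B"
    by eventually_elim (auto simp: abs_mult intro: mult_left_mono)
  with \<alpha> show ?thesis by (auto simp: Linf_def)
qed

lemma Linf_sum: "(\<And>m. m \<in> I \<Longrightarrow> \<alpha> m \<in> Linf D) \<Longrightarrow> (\<lambda>x. \<Sum>m\<in>I. \<alpha> m x) \<in> Linf D"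
proof (induction I rule: infinite_finite_induct)
  case (insert m I)
  then obtain B B' where "AE x in lebesgue_on D. \<bar>\<alpha> m x\<bar> \<le> B"
    "AE x in lebesgue_on D. \<bar>\<Sum>m\<in>I. \<alpha> m x\<bar> \<le> B'" by (force simp: Linf_def)
  then have "AE x in lebesgue_on D. \<bar>\<Sum>m\<in>insert m I. \<alpha> m x\<bar> \<le> B + B'"
    by eventually_elim (use insert in auto)
  moreover have "(\<lambda>x. \<Sum>m\<in>insert m I. \<alpha> m x) \<in> borel_measurable (lebesgue_on D)"
    using insert.prems by (intro borel_measurable_sum) (auto simp: Linf_def)
  ultimately show ?case unfolding Linf_def by blast
qed (auto intro: Linf_const)

lemma grad_form_coeff_sum:
  assumes "\<And>m. m \<in> I \<Longrightarrow> \<alpha> m \<in> Linf D" "u \<in> H1 D" "v \<in> H1 D"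
  shows "grad_form D (\<lambda>x. \<Sum>m\<in>I. \<alpha> m x) u v = (\<Sum>m\<in>I. grad_form D (\<alpha> m) u v)"
proof -
  have "integrable (lebesgue_on D) (\<lambda>x. \<alpha> m x * (weak_gradient D u x \<bullet> weak_gradient D v x))" if "m \<in> I" for m
    using assms that by (intro grad_form_integrable)
  then show ?thesis
    by (simp add: grad_form_def sum_distrib_right)
qed

lemma grad_form_coeff_scale: "grad_form D (\<lambda>x. c * \<alpha> x) u v = c * grad_form D \<alpha> u v"
  by (simp add: grad_form_def mult.assoc)

lemma grad_form_coeff_add:
  assumes "\<alpha> \<in> Linf D" "\<beta> \<in> Linf D" "u \<in> H1 D" "v \<in> H1 D"
  shows "grad_form D (\<lambda>x. \<alpha> x + \<beta> x) u v = grad_form D \<alpha> u v + grad_form D \<beta> u v"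
  using grad_form_integrable [OF assms(1,3,4)] grad_form_integrable [OF assms(2,3,4)]
  by (simp add: grad_form_def distrib_right)

subsection \<open>The coefficient recursion\<close>

lemma multi_power_fun_upd_Suc:
  assumes "m \<in> {1..M}"
  shows "multi_power M y (i(m := Suc (i m))) = y m * multi_power M y i"
proof -
  have "(\<Prod>j\<in>{1..M} - {m}. y j ^ (i(m := Suc (i m))) j) = (\<Prod>j\<in>{1..M} - {m}. y j ^ i j)"
    by (intro prod.cong) auto
  moreover have "multi_power M y k = y m ^ k m * (\<Prod>j\<in>{1..M} - {m}. y j ^ k j)" for k
    unfolding multi_power_def using assms by (intro prod.remove) auto
  ultimately show ?thesis by simp
qed

lemma multi_power_dec:
  assumes "m \<in> {1..M}" "i m > 0"
  shows "multi_power M y i = y m * multi_power M y (i(m := i m - 1))"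
  using multi_power_fun_upd_Suc [OF assms(1), of y "i(m := i m - 1)"] assms(2) by simp

lemma multi_indices_upd: "i \<in> multi_indices M \<Longrightarrow> m \<in> {1..M} \<Longrightarrow> i(m := k) \<in> multi_indices M"
  unfolding multi_indices_def by (auto simp: PiE_iff extensional_def)

definition level :: "nat \<Rightarrow> (nat \<Rightarrow> nat) \<Rightarrow> nat" where
  "level M i = (\<Sum>m=1..M. i m)"

lemma level_upd_Suc:
  assumes "m \<in> {1..M}"
  shows "level M (i(m := Suc (i m))) = Suc (level M i)"
proof -
  have "(\<Sum>j\<in>{1..M} - {m}. (i(m := Suc (i m))) j) = (\<Sum>j\<in>{1..M} - {m}. i j)"
    by (intro sum.cong) auto
  moreover have "level M k = k m + (\<Sum>j\<in>{1..M} - {m}. k j)" for k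
    unfolding level_def using assms by (intro sum.remove) auto
  ultimately show ?thesis by simp
qed

lemma level_dec:
  assumes "m \<in> {1..M}" "i m > 0"
  shows "level M i = Suc (level M (i(m := i m - 1)))"
  using level_upd_Suc [OF assms(1), of "i(m := i m - 1)"] assms(2) by simp

definition level_set :: "nat \<Rightarrow> nat \<Rightarrow> (nat \<Rightarrow> nat) set" where
  "level_set M k = {i \<in> multi_indices M. level M i = k}"

lemma finite_level_set: "finite (level_set M k)"
proof (rule finite_subset)
  show "level_set M k \<subseteq> {1..M} \<rightarrow>\<^sub>E {..k}"
  proof
    fix i assume i: "i \<in> level_set M k"
    have "i m \<le> k" if "m \<in> {1..M}" for m
      using member_le_sum [OF that, of i] i by (simp add: level_set_def level_def)
    then show "i \<in> {1..M} \<rightarrow>\<^sub>E {..k}"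
      using i by (auto simp: level_set_def multi_indices_def PiE_iff)
  qed
qed (auto intro: finite_PiE)

lemma level_set_0: "level_set M 0 = {\<lambda>m\<in>{1..M}. 0}"
proof (intro equalityI subsetI)
  fix i assume i: "i \<in> level_set M 0"
  then have "i m = 0" if "m \<in> {1..M}" for m
    using that by (simp add: level_set_def level_def)
  with i show "i \<in> {\<lambda>m\<in>{1..M}. 0}"
    by (auto simp: level_set_def multi_indices_def PiE_iff extensional_def fun_eq_iff)
qed (auto simp: level_set_def multi_indices_def level_def)

text \<open>Both sides count the edges between neighbouring levels: lowering coordinate
  \<open>m\<close> is a bijection from the pairs (i, m) with i at level k + 1 and i_m > 0 onto all
  pairs (i, m) with i at level k.\<close>

lemma sum_level_set_Suc:
  fixes h :: "nat \<Rightarrow> (nat \<Rightarrow> nat) \<Rightarrow> real"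
  shows "(\<Sum>i\<in>level_set M (Suc k). \<Sum>m\<in>{m\<in>{1..M}. i m > 0}. h m (i(m := i m - 1))) =
    (\<Sum>i\<in>level_set M k. \<Sum>m\<in>{1..M}. h m i)"
proof -
  have "(\<Sum>i\<in>level_set M (Suc k). \<Sum>m\<in>{m\<in>{1..M}. i m > 0}. h m (i(m := i m - 1))) =
      (\<Sum>(i, m)\<in>Sigma (level_set M (Suc k)) (\<lambda>i. {m\<in>{1..M}. i m > 0}). h m (i(m := i m - 1)))"
    by (intro sum.Sigma finite_level_set) auto
  also have "\<dots> = (\<Sum>(i, m)\<in>level_set M k \<times> {1..M}. h m i)"
  proof (rule sum.reindex_bij_witness [where
        i = "\<lambda>(i, m). (i(m := Suc (i m)), m)" and j = "\<lambda>(i, m). (i(m := i m - 1), m)"])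
    fix a assume "a \<in> Sigma (level_set M (Suc k)) (\<lambda>i. {m\<in>{1..M}. i m > 0})"
    then show "(case case a of (i, m) \<Rightarrow> (i(m := i m - 1), m) of (i, m) \<Rightarrow> (i(m := Suc (i m)), m)) = a"
      and "(case a of (i, m) \<Rightarrow> (i(m := i m - 1), m)) \<in> level_set M k \<times> {1..M}"
      and "(case case a of (i, m) \<Rightarrow> (i(m := i m - 1), m) of (i, m) \<Rightarrow> h m i) =
        (case a of (i, m) \<Rightarrow> h m (i(m := i m - 1)))"
      using level_dec [of "snd a" M "fst a"]
      by (auto simp: level_set_def multi_indices_upd)
  next
    fix b assume "b \<in> level_set M k \<times> {1..M}"
    then show "(case case b of (i, m) \<Rightarrow> (i(m := Suc (i m)), m) of (i, m) \<Rightarrow> (i(m := i m - 1), m)) = b"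
      and "(case b of (i, m) \<Rightarrow> (i(m := Suc (i m)), m)) \<in> Sigma (level_set M (Suc k)) (\<lambda>i. {m\<in>{1..M}. i m > 0})"
      using level_upd_Suc [of "snd b" M "fst b"]
      by (auto simp: level_set_def multi_indices_upd)
  qed
  also have "\<dots> = (\<Sum>i\<in>level_set M k. \<Sum>m\<in>{1..M}. h m i)"
    by (intro sum.Sigma [symmetric] finite_level_set) auto
  finally show ?thesis .
qed

section \<open>Unordered sums over multi-indices\<close>

lemma has_sum_sum_finite:
  fixes f :: "'i \<Rightarrow> 'a \<Rightarrow> 'b::topological_comm_monoid_add"
  assumes "\<And>k. k \<in> K \<Longrightarrow> (f k has_sum s k) I"
  shows "((\<lambda>i. \<Sum>k\<in>K. f k i) has_sum (\<Sum>k\<in>K. s k)) I"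
  using assms by (induction K rule: infinite_finite_induct) (auto intro: has_sum_add)

text \<open>A finite set of multi-indices lies in a cube with side {0..N}. Over the cube the sum
  factors into one geometric sum per coordinate, which gives a bound independent of
  \<open>N\<close>.\<close>

lemma multi_geometric_summable:
  assumes "\<And>m. m \<in> {1..M} \<Longrightarrow> 0 \<le> q m \<and> q m < 1"
  shows "(\<lambda>i. multi_power M q i) summable_on multi_indices M"
proof (rule nonneg_bdd_above_summable_on)
  show "bdd_above (sum (multi_power M q) ` {F. F \<subseteq> multi_indices M \<and> finite F})"
  proof (rule bdd_aboveI2)
    fix F assume "F \<in> {F. F \<subseteq> multi_indices M \<and> finite F}"
    then have F: "F \<subseteq> multi_indices M" "finite F" by auto
    define N where "N = Max (insert 0 (level M ` F))"
    have "F \<subseteq> {1..M} \<rightarrow>\<^sub>E {..N}"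
    proof
      fix i assume i: "i \<in> F"
      have "i m \<le> N" if "m \<in> {1..M}" for m
      proof -
        have "i m \<le> level M i" using member_le_sum [OF that, of i] by (simp add: level_def)
        also have "\<dots> \<le> N" unfolding N_def using F i by (intro Max_ge) auto
        finally show ?thesis .
      qed
      then show "i \<in> {1..M} \<rightarrow>\<^sub>E {..N}"
        using i F by (auto simp: multi_indices_def PiE_iff)
    qed
    then have "sum (multi_power M q) F \<le> sum (multi_power M q) ({1..M} \<rightarrow>\<^sub>E {..N})"
      using assms
      by (intro sum_mono2 finite_PiE) (auto simp: multi_power_def intro!: prod_nonneg zero_le_power)
    also have "\<dots> = (\<Prod>m\<in>{1..M}. \<Sum>k\<le>N. q m ^ k)"
      unfolding multi_power_def by (intro prod_sum_PiE [symmetric]) auto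
    also have "\<dots> \<le> (\<Prod>m\<in>{1..M}. 1 / (1 - q m))"
    proof (rule prod_mono, intro conjI)
      fix m assume m: "m \<in> {1..M}"
      show "0 \<le> (\<Sum>k\<le>N. q m ^ k)" using assms [OF m] by (intro sum_nonneg) auto
      have "(\<Sum>k\<le>N. q m ^ k) \<le> suminf (\<lambda>k. q m ^ k)"
        using assms [OF m] by (intro sum_le_suminf summable_geometric) auto
      also have "\<dots> = 1 / (1 - q m)" using assms [OF m] by (intro suminf_geometric) auto
      finally show "(\<Sum>k\<le>N. q m ^ k) \<le> 1 / (1 - q m)" .
    qed
    finally show "sum (multi_power M q) F \<le> (\<Prod>m\<in>{1..M}. 1 / (1 - q m))" .
  qed
qed (use assms in \<open>auto simp: multi_power_def intro!: prod_nonneg zero_le_power\<close>)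

text \<open>Coordinates of the parametric problem \<open>(1 + \<Sum>\<^sub>m y\<^sub>m A\<^sub>m) c = F\<close> in a basis that is orthonormal
  for the form with coefficient \<open>a\<^sub>0\<close>. The quadratic form \<open>Q\<^sub>m\<close> plays the role of
  \<open>\<integral> \<bar>a\<^sub>m\<bar> \<bar>\<nabla>u\<bar>\<^sup>2\<close>.\<close>

locale affine_system =
  fixes n M :: nat and A :: "nat \<Rightarrow> nat \<Rightarrow> nat \<Rightarrow> real" and Q :: "nat \<Rightarrow> (nat \<Rightarrow> real) \<Rightarrow> real"
    and F :: "nat \<Rightarrow> real" and \<rho> :: "nat \<Rightarrow> real" and \<theta> :: real
  assumes \<rho>: "\<And>m. m \<in> {1..M} \<Longrightarrow> \<rho> m > 1"
    and \<theta>: "\<theta> < 1"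
    and A_le: "\<And>m c d. m \<in> {1..M} \<Longrightarrow> \<bar>\<Sum>j<n. \<Sum>l<n. c j * d l * A m j l\<bar> \<le> (Q m c + Q m d) / 2"
    and Q_le: "\<And>c. (\<Sum>m=1..M. \<rho> m * Q m c) \<le> \<theta> * (\<Sum>j<n. (c j)\<^sup>2)"
begin

lemma \<rho>_pos: "m \<in> {1..M} \<Longrightarrow> 0 < \<rho> m"
  using \<rho> order_less_trans [OF zero_less_one] by blast

text \<open>For \<open>d = c\<close> the right-hand side of \<open>A_le\<close> is
  \<open>Q m c\<close>, and the left-hand side is a modulus.\<close>

lemma Q_nonneg: "m \<in> {1..M} \<Longrightarrow> Q m c \<ge> 0"
  using A_le [of m c c] abs_ge_zero order_trans by fastforce

text \<open>The total degree is a separate argument so that the recursion is primitive. The start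
  value is \<open>F\<close> itself, since the system matrix at \<open>y = 0\<close> is the
  identity.\<close>

primrec level_coeff :: "nat \<Rightarrow> (nat \<Rightarrow> nat) \<Rightarrow> nat \<Rightarrow> real" where
  "level_coeff 0 i j = F j"
| "level_coeff (Suc k) i j =
    - (\<Sum>m\<in>{m\<in>{1..M}. i m > 0}. \<Sum>l<n. A m j l * level_coeff k (i(m := i m - 1)) l)"

definition coeff :: "(nat \<Rightarrow> nat) \<Rightarrow> nat \<Rightarrow> real" where
  "coeff i = level_coeff (level M i) i"

lemma coeff_0: "level M i = 0 \<Longrightarrow> coeff i j = F j"
  by (simp add: coeff_def)

lemma coeff_rec:
  assumes "level M i > 0"
  shows "coeff i j = - (\<Sum>m\<in>{m\<in>{1..M}. i m > 0}. \<Sum>l<n. A m j l * coeff (i(m := i m - 1)) l)"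
proof -
  obtain k where k: "level M i = Suc k" using assms gr0_conv_Suc by blast
  have "level M (i(m := i m - 1)) = k" if "m \<in> {m\<in>{1..M}. i m > 0}" for m
    using that level_dec [of m M i] k by auto
  then show ?thesis
    unfolding coeff_def k level_coeff.simps
    by (intro arg_cong [where f = uminus] sum.cong refl) simp
qed

definition energy :: "(nat \<Rightarrow> nat) \<Rightarrow> real" where
  "energy i = (\<Sum>j<n. (multi_power M \<rho> i * coeff i j)\<^sup>2)"

text \<open>The weighted coefficients \<open>z\<close> satisfy the recursion with \<rho>_m A_m in
  place of A_m, because lowering i_m splits one factor \<rho>_m off the weight. Pairing with
  \<open>z i\<close> and using \<open>A_le\<close> yields half of the forms at \<open>z i\<close>,
  which are absorbed at the price of \<theta> / 2, and half of those at the predecessors; doubling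
  gives the factor 2 - \<theta>.\<close>

lemma energy_rec:
  assumes "level M i > 0"
  shows "(2 - \<theta>) * energy i \<le>
    (\<Sum>m\<in>{m\<in>{1..M}. i m > 0}. \<rho> m * Q m (\<lambda>j. multi_power M \<rho> (i(m := i m - 1)) * coeff (i(m := i m - 1)) j))"
proof -
  let ?S = "{m\<in>{1..M}. i m > 0}"
  define z where "z i j = multi_power M \<rho> i * coeff i j" for i j
  have z: "z i j = - (\<Sum>m\<in>?S. \<rho> m * (\<Sum>l<n. A m j l * z (i(m := i m - 1)) l))" for j
  proof -
    have "z i j = - (\<Sum>m\<in>?S. multi_power M \<rho> i * (\<Sum>l<n. A m j l * coeff (i(m := i m - 1)) l))"
      unfolding z_def coeff_rec [OF assms] by (simp add: sum_distrib_left)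
    also have "(\<Sum>m\<in>?S. multi_power M \<rho> i * (\<Sum>l<n. A m j l * coeff (i(m := i m - 1)) l)) =
        (\<Sum>m\<in>?S. \<rho> m * (\<Sum>l<n. A m j l * z (i(m := i m - 1)) l))"
    proof (rule sum.cong)
      fix m assume m: "m \<in> ?S"
      have "multi_power M \<rho> i = \<rho> m * multi_power M \<rho> (i(m := i m - 1))"
        using m by (intro multi_power_dec) auto
      then show "multi_power M \<rho> i * (\<Sum>l<n. A m j l * coeff (i(m := i m - 1)) l) =
        \<rho> m * (\<Sum>l<n. A m j l * z (i(m := i m - 1)) l)"
        by (simp add: z_def sum_distrib_left mult_ac)
    qed simp
    finally show ?thesis .
  qed
  have "energy i = (\<Sum>j<n. z i j * z i j)"
    by (simp add: energy_def z_def power2_eq_square)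
  also have "\<dots> = (\<Sum>j<n. z i j * - (\<Sum>m\<in>?S. \<rho> m * (\<Sum>l<n. A m j l * z (i(m := i m - 1)) l)))"
    by (intro sum.cong refl arg_cong2 [where f = "(*)"] z)
  also have "\<dots> = - (\<Sum>j<n. \<Sum>m\<in>?S. \<rho> m * (\<Sum>l<n. z i j * z (i(m := i m - 1)) l * A m j l))"
    by (simp add: sum_distrib_left sum_negf mult_ac)
  also have "\<dots> = - (\<Sum>m\<in>?S. \<rho> m * (\<Sum>j<n. \<Sum>l<n. z i j * z (i(m := i m - 1)) l * A m j l))"
    by (subst sum.swap) (simp add: sum_distrib_left)
  also have "\<dots> = (\<Sum>m\<in>?S. \<rho> m * - (\<Sum>j<n. \<Sum>l<n. z i j * z (i(m := i m - 1)) l * A m j l))"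
    by (simp add: sum_negf)
  also have "\<dots> \<le> (\<Sum>m\<in>?S. \<rho> m * ((Q m (z i) + Q m (z (i(m := i m - 1)))) / 2))"
  proof (intro sum_mono mult_left_mono)
    fix m assume "m \<in> ?S"
    then show "- (\<Sum>j<n. \<Sum>l<n. z i j * z (i(m := i m - 1)) l * A m j l) \<le> (Q m (z i) + Q m (z (i(m := i m - 1)))) / 2"
      using A_le [of m "z i" "z (i(m := i m - 1))"] by (auto simp: abs_le_iff)
    show "0 \<le> \<rho> m" using \<rho> [of m] \<open>m \<in> ?S\<close> by auto
  qed
  also have "\<dots> = (\<Sum>m\<in>?S. \<rho> m * Q m (z i)) / 2 + (\<Sum>m\<in>?S. \<rho> m * Q m (z (i(m := i m - 1)))) / 2"
    by (simp add: sum.distrib [symmetric] sum_divide_distrib distrib_left add_divide_distrib)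
  \<comment> \<open>The nonnegative terms with i_m = 0 are added, so that \<open>Q_le\<close>
    applies to the full sum.\<close>
  also have "(\<Sum>m\<in>?S. \<rho> m * Q m (z i)) \<le> (\<Sum>m=1..M. \<rho> m * Q m (z i))"
    using \<rho>_pos Q_nonneg by (intro sum_mono2) (auto simp: less_imp_le)
  also have "\<dots> \<le> \<theta> * (\<Sum>j<n. (z i j)\<^sup>2)" by (rule Q_le)
  also have "(\<Sum>j<n. (z i j)\<^sup>2) = energy i" by (simp add: energy_def z_def)
  finally have "energy i \<le> \<theta> * energy i / 2 + (\<Sum>m\<in>?S. \<rho> m * Q m (z (i(m := i m - 1)))) / 2"
    by (simp add: fun_upd_def)
  moreover have "z (i(m := i m - 1)) = (\<lambda>j. multi_power M \<rho> (i(m := i m - 1)) * coeff (i(m := i m - 1)) j)" for m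
    by (simp add: z_def fun_eq_iff)
  ultimately show ?thesis by (simp add: left_diff_distrib)
qed

lemma energy_nonneg: "energy i \<ge> 0"
  by (simp add: energy_def sum_nonneg)

text \<open>After summation over a level, every index of the level below occurs exactly once for
  each direction \<open>m\<close>. The full sum over \<open>m\<close> is therefore available a
  second time and \<open>Q_le\<close> bounds it; a single index of level k + 1 would not give
  this.\<close>

lemma energy_level_Suc:
  "(2 - \<theta>) * (\<Sum>i\<in>level_set M (Suc k). energy i) \<le> \<theta> * (\<Sum>i\<in>level_set M k. energy i)"
proof -
  let ?h = "\<lambda>m i. \<rho> m * Q m (\<lambda>j. multi_power M \<rho> i * coeff i j)"
  have "(2 - \<theta>) * (\<Sum>i\<in>level_set M (Suc k). energy i) = (\<Sum>i\<in>level_set M (Suc k). (2 - \<theta>) * energy i)"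
    by (simp add: sum_distrib_left)
  also have "\<dots> \<le> (\<Sum>i\<in>level_set M (Suc k). \<Sum>m\<in>{m\<in>{1..M}. i m > 0}. ?h m (i(m := i m - 1)))"
    by (intro sum_mono energy_rec) (simp add: level_set_def)
  also have "\<dots> = (\<Sum>i\<in>level_set M k. \<Sum>m\<in>{1..M}. ?h m i)"
    by (rule sum_level_set_Suc)
  also have "\<dots> \<le> (\<Sum>i\<in>level_set M k. \<theta> * energy i)"
    unfolding energy_def by (intro sum_mono Q_le)
  also have "\<dots> = \<theta> * (\<Sum>i\<in>level_set M k. energy i)"
    by (simp add: sum_distrib_left)
  finally show ?thesis .
qed

lemma energy_levels_bound:
  "(2 - 2 * \<theta>) * (\<Sum>k\<le>N. \<Sum>i\<in>level_set M k. energy i) \<le> (2 - \<theta>) * (\<Sum>j<n. (F j)\<^sup>2)"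
proof -
  define E where "E k = (\<Sum>i\<in>level_set M k. energy i)" for k
  have E0: "E 0 = (\<Sum>j<n. (F j)\<^sup>2)"
    unfolding E_def level_set_0 by (simp add: energy_def coeff_0 level_def multi_power_def)
  have En: "E k \<ge> 0" for k
    unfolding E_def by (intro sum_nonneg energy_nonneg)
  \<comment> \<open>Summing the level inequality leaves the sum up to N - 1 on the right, which is
    the reason for subtracting the last term.\<close>
  have "(2 - \<theta>) * (\<Sum>k\<le>N. E k) \<le> (2 - \<theta>) * E 0 + \<theta> * (\<Sum>k\<le>N. E k) - \<theta> * E N"
  proof (induction N)
    case (Suc N)
    then show ?case
      using energy_level_Suc [of N] by (simp add: E_def algebra_simps)
  qed (simp add: algebra_simps)
  \<comment> \<open>The locale does not fix the sign of \<theta>; the level inequality supplies the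
    sign of the product.\<close>
  moreover have "0 \<le> \<theta> * E N"
  proof -
    have "0 \<le> (2 - \<theta>) * E (Suc N)"
      using En [of "Suc N"] \<theta> by (intro mult_nonneg_nonneg) auto
    with energy_level_Suc [of N] show ?thesis by (simp add: E_def)
  qed
  ultimately show ?thesis by (simp add: E_def [symmetric] E0 algebra_simps)
qed

lemma energy_sum_bound:
  assumes "finite S" "S \<subseteq> multi_indices M"
  shows "(\<Sum>i\<in>S. energy i) \<le> (2 - \<theta>) / (2 - 2 * \<theta>) * (\<Sum>j<n. (F j)\<^sup>2)"
proof -
  define N where "N = Max (insert 0 (level M ` S))"
  have "S \<subseteq> (\<Union>k\<le>N. level_set M k)"
  proof
    fix i assume i: "i \<in> S"
    then have "level M i \<le> N" unfolding N_def using assms by (intro Max_ge) auto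
    then show "i \<in> (\<Union>k\<le>N. level_set M k)" using i assms by (auto simp: level_set_def)
  qed
  then have "(\<Sum>i\<in>S. energy i) \<le> (\<Sum>i\<in>(\<Union>k\<le>N. level_set M k). energy i)"
    by (intro sum_mono2 energy_nonneg) (auto simp: finite_level_set)
  also have "\<dots> = (\<Sum>k\<le>N. \<Sum>i\<in>level_set M k. energy i)"
    by (intro sum.UNION_disjoint) (auto simp: finite_level_set, auto simp: level_set_def)
  also have "\<dots> \<le> (2 - \<theta>) / (2 - 2 * \<theta>) * (\<Sum>j<n. (F j)\<^sup>2)"
    using energy_levels_bound [of N] \<theta> by (simp add: field_simps)
  finally show ?thesis .
qed

text \<open>The energy bound applied to one index gives decay of the coefficients like the inverse
  of \<rho>^i. On the closed cube the monomials are at most 1, so a multivariate geometric series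
  with ratios 1 / \<rho>_m < 1 dominates.\<close>

lemma coeff_power_summable:
  assumes y: "y \<in> param_domain M" and j: "j < n"
  shows "(\<lambda>i. norm (coeff i j * multi_power M y i)) summable_on multi_indices M"
proof -
  define C where "C = sqrt ((2 - \<theta>) / (2 - 2 * \<theta>) * (\<Sum>j<n. (F j)\<^sup>2))"
  let ?q = "\<lambda>m. inverse (\<rho> m)"
  have q: "0 \<le> ?q m \<and> ?q m < 1" if "m \<in> {1..M}" for m
    using \<rho> [OF that] by (auto simp: inverse_less_1_iff)
  show ?thesis
  proof (rule summable_on_comparison_test)
    show "(\<lambda>i. C * multi_power M ?q i) summable_on multi_indices M"
      by (intro summable_on_cmult_right multi_geometric_summable q)
    fix i assume i: "i \<in> multi_indices M"
    have pos: "multi_power M \<rho> i > 0"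
      using \<rho>_pos unfolding multi_power_def by (intro prod_pos) auto
    have "(multi_power M \<rho> i * coeff i j)\<^sup>2 \<le> energy i"
      unfolding energy_def using j by (intro member_le_sum) auto
    also have "\<dots> \<le> (2 - \<theta>) / (2 - 2 * \<theta>) * (\<Sum>j<n. (F j)\<^sup>2)"
      using energy_sum_bound [of "{i}"] i by simp
    finally have "\<bar>multi_power M \<rho> i * coeff i j\<bar> \<le> C"
      unfolding C_def by (rule real_le_rsqrt [of "\<bar>_\<bar>", simplified])
    then have "\<bar>coeff i j\<bar> \<le> C * inverse (multi_power M \<rho> i)"
      using pos by (simp add: abs_mult field_simps)
    also have "inverse (multi_power M \<rho> i) = multi_power M ?q i"
      by (simp add: multi_power_def prod_inversef [symmetric] power_inverse)
    finally have c: "\<bar>coeff i j\<bar> \<le> C * multi_power M ?q i" .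
    have "\<bar>multi_power M y i\<bar> \<le> 1"
      unfolding multi_power_def abs_prod using y
      by (intro prod_le_1) (auto simp: power_abs param_domain_def PiE_iff abs_le_iff intro!: power_le_one)
    then have "\<bar>coeff i j\<bar> * \<bar>multi_power M y i\<bar> \<le> \<bar>coeff i j\<bar>"
      by (intro mult_left_le) auto
    with c show "norm (coeff i j * multi_power M y i) \<le> C * multi_power M ?q i"
      by (simp add: abs_mult)
  qed simp
qed

text \<open>Pairing the homogeneous system with \<open>z\<close> and using \<bar>y_m\<bar> \<le> 1 <
  \<rho>_m bounds the squared length of \<open>z\<close> by \<theta> times itself.\<close>

lemma system_unique:
  assumes y: "y \<in> param_domain M"
    and z: "\<And>j. j < n \<Longrightarrow> z j + (\<Sum>m=1..M. y m * (\<Sum>l<n. A m j l * z l)) = 0" and j: "j < n"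
  shows "z j = 0"
proof -
  have "(\<Sum>j<n. (z j)\<^sup>2) = (\<Sum>j<n. z j * - (\<Sum>m=1..M. y m * (\<Sum>l<n. A m j l * z l)))"
  proof (rule sum.cong)
    fix j assume "j \<in> {..<n}"
    then have "- (\<Sum>m=1..M. y m * (\<Sum>l<n. A m j l * z l)) = z j" using z [of j] by simp
    then show "(z j)\<^sup>2 = z j * - (\<Sum>m=1..M. y m * (\<Sum>l<n. A m j l * z l))"
      by (simp only: power2_eq_square)
  qed simp
  also have "\<dots> = - (\<Sum>j<n. \<Sum>m=1..M. y m * (\<Sum>l<n. z j * z l * A m j l))"
    by (simp add: sum_distrib_left sum_negf mult_ac)
  also have "\<dots> = (\<Sum>m=1..M. - y m * (\<Sum>j<n. \<Sum>l<n. z j * z l * A m j l))"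
    by (subst sum.swap) (simp add: sum_distrib_left sum_negf)
  also have "\<dots> \<le> (\<Sum>m=1..M. \<rho> m * Q m z)"
  proof (rule sum_mono)
    fix m assume m: "m \<in> {1..M}"
    let ?a = "\<Sum>j<n. \<Sum>l<n. z j * z l * A m j l"
    have "\<bar>y m\<bar> \<le> 1" using y m by (auto simp: param_domain_def PiE_iff abs_le_iff)
    then have "\<bar>y m\<bar> * \<bar>?a\<bar> \<le> \<rho> m * Q m z"
      using A_le [OF m, of z z] \<rho> [OF m] by (intro mult_mono) auto
    then show "- y m * ?a \<le> \<rho> m * Q m z"
      using abs_ge_minus_self [of "y m * ?a"] by (simp add: abs_mult)
  qed
  also have "\<dots> \<le> \<theta> * (\<Sum>j<n. (z j)\<^sup>2)" by (rule Q_le)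
  finally have "(1 - \<theta>) * (\<Sum>j<n. (z j)\<^sup>2) \<le> 0" by (simp add: algebra_simps)
  then have "(\<Sum>j<n. (z j)\<^sup>2) \<le> 0" using \<theta> by (simp add: mult_le_0_iff)
  moreover have "(z j)\<^sup>2 \<le> (\<Sum>j<n. (z j)\<^sup>2)" using j by (intro member_le_sum) auto
  ultimately show ?thesis by (metis order_trans power2_less_eq_zero_iff)
qed

text \<open>Multiplication by y_m shifts the index i to i + e_m. Once all series run over the
  unshifted indices, \<open>coeff_rec\<close> makes the terms cancel at every positive level, and
  the index zero contributes \<open>F j\<close>.\<close>

lemma power_series_solves:
  assumes y: "y \<in> param_domain M" and j: "j < n"
  defines "s \<equiv> \<lambda>j. \<Sum>\<^sub>\<infinity>i\<in>multi_indices M. coeff i j * multi_power M y i"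
  shows "s j + (\<Sum>m=1..M. y m * (\<Sum>l<n. A m j l * s l)) = F j"
proof -
  let ?I = "multi_indices M"
  have s: "((\<lambda>i. coeff i l * multi_power M y i) has_sum s l) ?I" if "l < n" for l
    unfolding s_def using abs_summable_summable [OF coeff_power_summable [OF y that]] by (rule has_sum_infsum)
  \<comment> \<open>The series of the \<open>m\<close>-th term after the shift; it is zero where i_m
    = 0, which are exactly the indices that the shift does not reach.\<close>
  define t where "t m i = (if i m > 0 then multi_power M y i * (\<Sum>l<n. A m j l * coeff (i(m := i m - 1)) l) else 0)" for m i
  have t: "(t m has_sum y m * (\<Sum>l<n. A m j l * s l)) ?I" if m: "m \<in> {1..M}" for m
  proof -
    have "((\<lambda>i. y m * (\<Sum>l<n. A m j l * (coeff i l * multi_power M y i))) has_sum y m * (\<Sum>l<n. A m j l * s l)) ?I"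
      by (intro has_sum_cmult_right has_sum_sum_finite s) auto
    moreover have "y m * (\<Sum>l<n. A m j l * (coeff i l * multi_power M y i)) = t m (i(m := Suc (i m)))" for i
      using multi_power_fun_upd_Suc [OF m, of y i] by (simp add: t_def sum_distrib_left mult_ac)
    ultimately have "((t m \<circ> (\<lambda>i. i(m := Suc (i m)))) has_sum y m * (\<Sum>l<n. A m j l * s l)) ?I"
      by (simp add: o_def)
    moreover have "inj_on (\<lambda>i. i(m := Suc (i m))) ?I"
    proof (rule inj_onI)
      fix i i' :: "nat \<Rightarrow> nat" assume "i(m := Suc (i m)) = i'(m := Suc (i' m))"
      then have "(i(m := Suc (i m))) k = (i'(m := Suc (i' m))) k" for k by simp
      then have "i k = i' k" for k by (cases "k = m") (auto dest: meta_spec [of _ k] split: if_splits)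
      then show "i = i'" by blast
    qed
    ultimately have "(t m has_sum y m * (\<Sum>l<n. A m j l * s l)) ((\<lambda>i. i(m := Suc (i m))) ` ?I)"
      by (simp add: has_sum_reindex)
    then show ?thesis
    proof (rule has_sum_cong_neutral [THEN iffD1, rotated -1])
      fix i assume i: "i \<in> ?I - (\<lambda>i. i(m := Suc (i m))) ` ?I"
      have "i m = 0"
      proof (rule ccontr)
        assume "i m \<noteq> 0"
        then have "i = (i(m := i m - 1))(m := Suc ((i(m := i m - 1)) m))" by auto
        then show False using i multi_indices_upd [of i M m "i m - 1"] m by blast
      qed
      then show "t m i = 0" by (simp add: t_def)
    next
      fix i assume "i \<in> (\<lambda>i. i(m := Suc (i m))) ` ?I - ?I"
      then show "t m i = 0" using multi_indices_upd [OF _ m] by auto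
    qed simp
  qed
  have total: "((\<lambda>i. coeff i j * multi_power M y i + (\<Sum>m=1..M. t m i)) has_sum
      s j + (\<Sum>m=1..M. y m * (\<Sum>l<n. A m j l * s l))) ?I"
    by (intro has_sum_add has_sum_sum_finite s t j) auto
  have "coeff i j * multi_power M y i + (\<Sum>m=1..M. t m i) = 0" if "level M i > 0" for i
  proof -
    have "(\<Sum>m=1..M. t m i) = (\<Sum>m\<in>{m\<in>{1..M}. i m > 0}. multi_power M y i * (\<Sum>l<n. A m j l * coeff (i(m := i m - 1)) l))"
      unfolding t_def by (rule sum.inter_filter [symmetric]) simp
    also have "\<dots> = - (coeff i j * multi_power M y i)"
      unfolding coeff_rec [OF that] by (simp add: sum_distrib_left mult.commute)
    finally show ?thesis by simp
  qed
  then have "((\<lambda>i. coeff i j * multi_power M y i + (\<Sum>m=1..M. t m i)) has_sum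
      s j + (\<Sum>m=1..M. y m * (\<Sum>l<n. A m j l * s l))) (level_set M 0)"
    using total
    by (subst has_sum_cong_neutral [where T = ?I and g = "\<lambda>i. coeff i j * multi_power M y i + (\<Sum>m=1..M. t m i)"])
      (auto simp: level_set_def)
  moreover have "((\<lambda>i. coeff i j * multi_power M y i + (\<Sum>m=1..M. t m i)) has_sum F j) (level_set M 0)"
    unfolding level_set_0
    by (intro has_sum_finiteI) (simp_all add: coeff_0 level_def multi_power_def t_def)
  ultimately show ?thesis by (rule has_sum_unique)
qed

lemma solution_power_series:
  assumes y: "y \<in> param_domain M"
    and c: "\<And>j. j < n \<Longrightarrow> c j + (\<Sum>m=1..M. y m * (\<Sum>l<n. A m j l * c l)) = F j" and j: "j < n"
  shows "((\<lambda>i. coeff i j * multi_power M y i) has_sum c j) (multi_indices M)"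
proof -
  define s where "s j = (\<Sum>\<^sub>\<infinity>i\<in>multi_indices M. coeff i j * multi_power M y i)" for j
  have s: "s j + (\<Sum>m=1..M. y m * (\<Sum>l<n. A m j l * s l)) = F j" if "j < n" for j
    unfolding s_def by (rule power_series_solves [OF y that])
  have "c j - s j = 0"
  proof (rule system_unique [OF y _ j])
    fix j assume "j < n"
    then show "c j - s j + (\<Sum>m=1..M. y m * (\<Sum>l<n. A m j l * (c l - s l))) = 0"
      using c [of j] s [of j] by (simp add: right_diff_distrib sum_subtractf)
  qed
  then have "c j = s j" by simp
  then show ?thesis
    unfolding s_def using abs_summable_summable [OF coeff_power_summable [OF y j]] by simp
qed

end

subsection \<open>Mixed partial derivatives of power series\<close>

text \<open>Termwise differentiation gives for \<open>deriv \<phi>\<close> a series that is again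
  valid on the whole interval \<bar>t\<bar> < 1, so the hypothesis reproduces itself and the
  induction runs over all \<open>a\<close> and \<open>\<phi>\<close>. Only this interval is
  available, because nothing is known about the solution outside the cube.\<close>

lemma higher_deriv_power_series:
  fixes a :: "nat \<Rightarrow> real"
  assumes "\<And>t. \<bar>t\<bar> < 1 \<Longrightarrow> (\<lambda>p. a p * t ^ p) sums \<phi> t"
  shows "(deriv ^^ p) \<phi> 0 = fact p * a p"
  using assms
proof (induction p arbitrary: a \<phi>)
  case 0
  from 0 [of 0] have "(\<lambda>p. a p * 0 ^ p) sums \<phi> 0" by simp
  moreover have "(\<lambda>p. a p * 0 ^ p) sums a 0" by (rule powser_sums_zero)
  ultimately show ?case using sums_unique2 by auto
next
  case (Suc p)
  have sm: "summable (\<lambda>p. a p * t ^ p)" if "norm t < 1" for t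
    using Suc.prems [of t] that sums_summable by auto
  have "(\<lambda>p. diffs a p * t ^ p) sums deriv \<phi> t" if t: "\<bar>t\<bar> < 1" for t
  proof -
    obtain K where K: "\<bar>t\<bar> < K" "K < 1" using dense t by blast
    have "((\<lambda>x. \<Sum>p. a p * x ^ p) has_real_derivative (\<Sum>p. diffs a p * t ^ p)) (at t)"
      using K by (intro termdiffs_strong [where K = K] sm) auto
    then have "(\<phi> has_real_derivative (\<Sum>p. diffs a p * t ^ p)) (at t)"
    proof (rule has_field_derivative_transform_within_open [where S = "{-1<..<1}"])
      fix x :: real assume "x \<in> {-1<..<1}"
      then show "(\<Sum>p. a p * x ^ p) = \<phi> x"
        using Suc.prems [of x] by (intro sums_unique [symmetric]) auto
    qed (use t in auto)
    then have "deriv \<phi> t = (\<Sum>p. diffs a p * t ^ p)" by (rule DERIV_imp_deriv)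
    moreover have "summable (\<lambda>p. diffs a p * t ^ p)"
      by (rule termdiff_converges [of t 1]) (use t sm in auto)
    ultimately show ?thesis by (simp add: summable_sums)
  qed
  from Suc.IH [OF this] have "(deriv ^^ p) (deriv \<phi>) 0 = fact p * diffs a p" .
  then show ?case by (simp add: funpow_swap1 funpow_Suc_right diffs_def del: funpow.simps)
qed

definition partial_multi_power :: "nat \<Rightarrow> (nat \<Rightarrow> real) \<Rightarrow> (nat \<Rightarrow> nat) \<Rightarrow> real" where
  "partial_multi_power m y k = (\<Prod>j=1..m. y j ^ k j)"

text \<open>Differentiation proceeds from the last variable to the first; since the outer derivatives are
  taken at zero, after treating the variables above \<open>m\<close> only points with \<open>y\<^sub>j = 0\<close> for
  \<open>j > m\<close> matter, and only the indices agreeing with \<open>i\<close> above \<open>m\<close> survive.\<close>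

lemma mixed_partial_tail_power_series:
  assumes g: "\<And>y. y \<in> param_domain M \<Longrightarrow> ((\<lambda>k. c k * multi_power M y k) has_sum g y) (multi_indices M)"
    and m: "m \<le> M" and y: "y \<in> param_domain M" "\<And>j. j \<in> {m<..M} \<Longrightarrow> y j = 0"
  shows "((\<lambda>k. (\<Prod>j\<in>{m<..M}. fact (i j)) * c k * partial_multi_power m y k) has_sum
      foldr (\<lambda>m. partial_deriv m (i m)) [Suc m..<Suc M] g y)
    {k \<in> multi_indices M. \<forall>j\<in>{m<..M}. k j = i j}"
  using m y
proof (induction "M - m" arbitrary: m y)
  case 0
  then have "m = M" by simp
  then show ?case
    using g [OF "0.prems"(2)] by (simp add: partial_multi_power_def multi_power_def)
next
  case (Suc d)
  then have mM: "m < M" and d: "d = M - Suc m" by auto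
  define h where "h = foldr (\<lambda>m. partial_deriv m (i m)) [Suc (Suc m)..<Suc M] g"
  have h_eq: "foldr (\<lambda>m. partial_deriv m (i m)) [Suc m..<Suc M] g = partial_deriv (Suc m) (i (Suc m)) h"
    using mM by (simp add: h_def upt_conv_Cons del: upt_Suc)
  define J where "J = {k \<in> multi_indices M. \<forall>j\<in>{Suc m<..M}. k j = i j}"
  define G where "G = (\<Prod>j\<in>{Suc m<..M}. fact (i j) :: real)"
  define b where "b k = G * c k * partial_multi_power m y k" for k
  \<comment> \<open>The coefficient of t^p, where t is the variable with number m + 1: all terms
    with this exponent are collected.\<close>
  define a where "a p = (\<Sum>\<^sub>\<infinity>k\<in>{k \<in> J. k (Suc m) = p}. b k)" for p
  have ins: "{m<..M} = insert (Suc m) {Suc m<..M}" using mM by auto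
  \<comment> \<open>The induction hypothesis for m + 1 leaves the coordinate m + 1 free, so it may
    be applied along the whole line segment in that direction.\<close>
  have series: "((\<lambda>k. b k * t ^ k (Suc m)) has_sum h (y(Suc m := t))) J" if t: "\<bar>t\<bar> \<le> 1" for t
  proof -
    have yt: "y(Suc m := t) \<in> param_domain M"
      using Suc.prems(2) mM t by (auto simp: param_domain_def PiE_iff extensional_def abs_le_iff)
    have "((\<lambda>k. (\<Prod>j\<in>{Suc m<..M}. fact (i j)) * c k * partial_multi_power (Suc m) (y(Suc m := t)) k) has_sum
        h (y(Suc m := t))) {k \<in> multi_indices M. \<forall>j\<in>{Suc m<..M}. k j = i j}"
      unfolding h_def using mM Suc.prems(3) by (intro Suc.hyps(1) d yt) auto
    moreover have "(\<Prod>j\<in>{Suc m<..M}. fact (i j)) * c k * partial_multi_power (Suc m) (y(Suc m := t)) k = b k * t ^ k (Suc m)" for k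
    proof -
      have "(\<Prod>j=1..m. (y(Suc m := t)) j ^ k j) = (\<Prod>j=1..m. y j ^ k j)"
        by (intro prod.cong) auto
      then show ?thesis by (simp add: b_def G_def partial_multi_power_def)
    qed
    ultimately show ?thesis by (simp add: J_def)
  qed
  have b_sum: "(b has_sum a p) {k \<in> J. k (Suc m) = p}" for p
  proof -
    \<comment> \<open>At t = 1 the powers of t disappear.\<close>
    have "b summable_on J"
      using series [of 1] by (auto simp: summable_on_def)
    then have "b summable_on {k \<in> J. k (Suc m) = p}"
      by (rule summable_on_subset_banach) auto
    then show ?thesis unfolding a_def by (rule has_sum_infsum)
  qed
  have "(\<lambda>p. a p * t ^ p) sums h (y(Suc m := t))" if t: "\<bar>t\<bar> < 1" for t
  proof -
    \<comment> \<open>\<open>J\<close> is the disjoint union of the slices with fixed exponent of t;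
      summing slice by slice turns the sum over multi-indices into a power series in t.\<close>
    have bij: "bij_betw snd (Sigma UNIV (\<lambda>p. {k \<in> J. k (Suc m) = p})) J"
      by (rule bij_betwI [where g = "\<lambda>k. (k (Suc m), k)"]) auto
    have "((\<lambda>x. b (snd x) * t ^ (snd x) (Suc m)) has_sum h (y(Suc m := t))) (Sigma UNIV (\<lambda>p. {k \<in> J. k (Suc m) = p}))"
      using has_sum_reindex_bij_betw [OF bij, of "\<lambda>k. b k * t ^ k (Suc m)"] series [of t] t by simp
    then have "((\<lambda>p. a p * t ^ p) has_sum h (y(Suc m := t))) UNIV"
    proof (rule has_sum_SigmaD)
      fix p
      have "((\<lambda>k. b k * t ^ p) has_sum a p * t ^ p) {k \<in> J. k (Suc m) = p}"
        by (intro has_sum_cmult_left b_sum)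
      then show "((\<lambda>k. b (snd (p, k)) * t ^ (snd (p, k)) (Suc m)) has_sum a p * t ^ p) {k \<in> J. k (Suc m) = p}"
        by (rule has_sum_cong [THEN iffD1, rotated]) auto
    qed
    then show ?thesis by (rule has_sum_imp_sums)
  qed
  then have "(deriv ^^ i (Suc m)) (\<lambda>t. h (y(Suc m := t))) 0 = fact (i (Suc m)) * a (i (Suc m))"
    by (rule higher_deriv_power_series)
  moreover have "y (Suc m) = 0" using Suc.prems(3) mM by auto
  ultimately have val: "foldr (\<lambda>m. partial_deriv m (i m)) [Suc m..<Suc M] g y = fact (i (Suc m)) * a (i (Suc m))"
    unfolding h_eq partial_deriv_def by simp
  have "((\<lambda>k. fact (i (Suc m)) * b k) has_sum fact (i (Suc m)) * a (i (Suc m))) {k \<in> J. k (Suc m) = i (Suc m)}"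
    by (intro has_sum_cmult_right b_sum)
  moreover have "{k \<in> J. k (Suc m) = i (Suc m)} = {k \<in> multi_indices M. \<forall>j\<in>{m<..M}. k j = i j}"
    unfolding J_def ins by auto
  moreover have "fact (i (Suc m)) * b k = (\<Prod>j\<in>{m<..M}. fact (i j)) * c k * partial_multi_power m y k" for k
    unfolding ins b_def G_def by simp
  ultimately show ?case unfolding val by simp
qed

text \<open>The case m = 0 of the preceding lemma: with all variables treated, the index set has
  shrunk to \<open>i\<close> alone.\<close>

lemma mixed_partial_power_series:
  assumes g: "\<And>y. y \<in> param_domain M \<Longrightarrow> ((\<lambda>k. c k * multi_power M y k) has_sum g y) (multi_indices M)"
    and i: "i \<in> multi_indices M"
  shows "mixed_partial M i g (\<lambda>m\<in>{1..M}. 0) = multi_fact M i * c i"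
proof -
  let ?y = "\<lambda>m\<in>{1..M}. 0 :: real"
  have "?y \<in> param_domain M" by (auto simp: param_domain_def)
  from mixed_partial_tail_power_series [where m = 0 and i = i, OF g _ this]
  have "((\<lambda>k. (\<Prod>j\<in>{0<..M}. fact (i j)) * c k * partial_multi_power 0 ?y k) has_sum mixed_partial M i g ?y)
      {k \<in> multi_indices M. \<forall>j\<in>{0<..M}. k j = i j}"
    by (simp add: mixed_partial_def del: upt_Suc)
  moreover have "{k \<in> multi_indices M. \<forall>j\<in>{0<..M}. k j = i j} = {i}"
  proof -
    have "k = i" if "k \<in> multi_indices M" "\<forall>j\<in>{0<..M}. k j = i j" for k
      using that i unfolding multi_indices_def by (intro PiE_ext) auto
    with i show ?thesis by blast
  qed
  moreover have "{0<..M} = {1..M}" by auto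
  ultimately have "((\<lambda>k. multi_fact M i * c k) has_sum mixed_partial M i g ?y) {i}"
    by (simp add: partial_multi_power_def multi_fact_def)
  from has_sum_unique [OF this has_sum_finite] show ?thesis by simp
qed

subsection \<open>Summability of the Taylor coefficients\<close>

lemma L2_mult_young:
  fixes f u :: "'a::euclidean_space \<Rightarrow> real"
  assumes f: "f \<in> L2 D" and u: "u \<in> L2 D" and s: "s > 0"
  shows "2 * (LINT x|lebesgue_on D. f x * u x) \<le> s * sq_int D f + sq_int D u / s"
proof -
  have i: "integrable (lebesgue_on D) (\<lambda>x. (f x)\<^sup>2)" "integrable (lebesgue_on D) (\<lambda>x. (u x)\<^sup>2)"
    using L2_integrable_square [OF f] L2_integrable_square [OF u] by simp_all
  have "2 * (LINT x|lebesgue_on D. f x * u x) = (LINT x|lebesgue_on D. 2 * (f x * u x))"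
    by simp
  also have "\<dots> \<le> (LINT x|lebesgue_on D. s * (f x)\<^sup>2 + (u x)\<^sup>2 / s)"
  proof (intro integral_mono integrable_mult_right L2_integrable_mult f u
      Bochner_Integration.integrable_add integrable_divide i)
    fix x
    have "0 \<le> (s * f x - u x)\<^sup>2 / s" using s by simp
    also have "\<dots> = s * (f x)\<^sup>2 + (u x)\<^sup>2 / s - 2 * (f x * u x)"
      using s by (simp add: power2_diff field_simps power2_eq_square)
    finally show "2 * (f x * u x) \<le> s * (f x)\<^sup>2 + (u x)\<^sup>2 / s" by simp
  qed
  also have "\<dots> = s * sq_int D f + sq_int D u / s"
    using i by (simp add: sq_int_def)
  finally show ?thesis .
qed

lemma multi_power_double: "multi_power M \<rho> (\<lambda>m. 2 * i m) = (multi_power M \<rho> i)\<^sup>2"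
  by (simp add: multi_power_def prod_power_distrib power_mult [symmetric] mult.commute)

text \<open>The mesh is used to obtain the basis and leaves no trace in \<open>C\<close>. There the
  quotient with 2 - 2 * \<theta> comes from summing the level inequality, the middle factor bounds
  the energy at level 0, and the last division by \<open>r\<close> passes from the energy to the
  gradient norm.\<close>

lemma taylor_coeff_summable:
  fixes D :: "'a::euclidean_space set"
  assumes D: "open D" "bounded D" "D \<subseteq> cball 0 R" and R: "R > 0"
    and mesh: "conforming_mesh D \<T>"
    and f: "f \<in> L2 D"
    and affine: "\<And>x y. x \<in> D \<Longrightarrow> y \<in> param_domain M \<Longrightarrow> a x y = ac 0 x + (\<Sum>m=1..M. ac m x * y m)"
    and Linf: "\<And>m. m \<le> M \<Longrightarrow> ac m \<in> Linf D"
    and r: "r > 0" "\<And>x. x \<in> D \<Longrightarrow> r \<le> ac 0 x"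
    and \<rho>: "\<And>m. m \<in> {1..M} \<Longrightarrow> \<rho> m > 1" and \<theta>: "\<theta> < 1"
    and dom: "AE x in lebesgue_on D. (\<Sum>m=1..M. \<rho> m * \<bar>ac m x\<bar>) \<le> \<theta> * ac 0 x"
    and w: "semidiscrete_solution D M a f (fe_space D \<T>) w"
  defines "C \<equiv> (2 - \<theta>) / (2 - 2 * \<theta>) * (16 * R\<^sup>2 / r * sq_int D f) / r"
  shows "(\<lambda>i. (multi_power M \<rho> i * X_norm D (taylor_coeff M w i))\<^sup>2) summable_on multi_indices M"
    and "(\<Sum>\<^sub>\<infinity>i\<in>multi_indices M. multi_power M \<rho> (\<lambda>m. 2 * i m) * (X_norm D (taylor_coeff M w i))\<^sup>2) \<le> C"
proof -
  note D' = D(1,2)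
  let ?W = "fe_space D \<T>"
  let ?E = "grad_form D (ac 0)"
  have a0: "ac 0 \<in> Linf D" by (rule Linf) simp
  have am: "ac m \<in> Linf D" if "m \<in> {1..M}" for m using that by (intro Linf) simp
  have coercive: "r * sq_int D (weak_gradient D u) \<le> ?E u u" if "u \<in> ?W" for u
    unfolding grad_form_const [symmetric] using r
    by (intro grad_form_mono Linf_const a0 fe_space_H1 [OF that]) auto
  \<comment> \<open>Coercivity annihilates the gradient, the Poincare inequality the function almost
    everywhere, and affinity on the elements makes this hold at each point.\<close>
  have E_zero: "u x = 0" if u: "u \<in> ?W" and E: "?E u u = 0" and x: "x \<in> D" for u x
  proof -
    have "r * sq_int D (weak_gradient D u) \<le> 0" using coercive [OF u] E by simp
    then have "sq_int D (weak_gradient D u) = 0"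
      using r sq_int_nonneg [of D "weak_gradient D u"] by (simp add: mult_le_0_iff)
    then have "sq_int D u = 0"
      using poincare_H10 [OF D fe_space_H10 [OF u]] sq_int_nonneg [of D u] by simp
    then have "AE x in lebesgue_on D. (norm (u x))\<^sup>2 = 0"
      using L2_integrable_square [OF H1_L2 [OF fe_space_H1 [OF u]]]
      by (subst integral_nonneg_eq_0_iff_AE [symmetric]) (auto simp: sq_int_def)
    then have "AE x in lebesgue_on D. u x = 0" by simp
    then show ?thesis by (intro fe_space_AE_zero [OF D(1) mesh u _ x])
  qed
  obtain V where V: "finite V"
    "\<And>v x. v \<in> ?W \<Longrightarrow> (\<And>p. p \<in> V \<Longrightarrow> v p = 0) \<Longrightarrow> x \<in> D \<Longrightarrow> v x = 0"
    using fe_space_vertices [OF mesh] by blast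
  have H0: "(\<lambda>x. 0) \<in> H1 D" by (intro H10_H1 H10_zero D')
  \<comment> \<open>Such a \<open>u\<close> is zero on \<open>D\<close>, and the form sees its
    arguments on \<open>D\<close> only.\<close>
  have V_zero: "?E u u = 0" if "u \<in> ?W" "\<And>p. p \<in> V \<Longrightarrow> u p = 0" for u
  proof -
    have "?E u u = ?E (\<lambda>x. 0) u" using V(2) that by (intro grad_form_cong) blast
    also have "\<dots> = 0" using grad_form_scale [OF D' a0 H0 fe_space_H1 [OF that(1)], of 0] by simp
    finally show ?thesis .
  qed
  have W_diff: "(\<lambda>x. u x - v x) \<in> ?W" if "u \<in> ?W" "v \<in> ?W" for u v
    using fe_space_add [OF D' that(1) fe_space_scale [OF D' that(2), of "-1"]] by simp
  have E_diff: "?E (\<lambda>x. u x - v x) z = ?E u z - ?E v z" if "u \<in> ?W" "v \<in> ?W" "z \<in> ?W" for u v z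
    using grad_form_add [OF D' a0 fe_space_H1 [OF that(1)] fe_space_H1 [OF fe_space_scale [OF D' that(2), of "-1"]] fe_space_H1 [OF that(3)]]
      grad_form_scale [OF D' a0 fe_space_H1 [OF that(2)] fe_space_H1 [OF that(3)], of "-1"] by simp
  have E_nonneg: "?E u u \<ge> 0" if "u \<in> ?W" for u
    using coercive [OF that] r(1) sq_int_nonneg [of D "weak_gradient D u"]
    by (meson mult_nonneg_nonneg less_imp_le order_trans)
  obtain n :: nat and e where e: "\<And>j. j < n \<Longrightarrow> e j \<in> ?W"
    and orth: "\<And>j k. j < n \<Longrightarrow> k < n \<Longrightarrow> ?E (e j) (e k) = (if j = k then 1 else 0)"
    and basis: "\<And>v x. v \<in> ?W \<Longrightarrow> x \<in> D \<Longrightarrow> v x = (\<Sum>j<n. ?E v (e j) * e j x)"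
  proof (rule orthonormal_basis_exists [of ?W ?E D V])
    show "(\<lambda>x. \<Sum>j<n. c j * e j x) \<in> ?W" if "\<And>j. j < n \<Longrightarrow> e j \<in> ?W" for n :: nat and c e
      using that by (intro fe_space_sum D') auto
    show "?E (\<lambda>x. \<Sum>j<n. c j * e j x) v = (\<Sum>j<n. c j * ?E (e j) v)"
      if "\<And>j. j < n \<Longrightarrow> e j \<in> ?W" "v \<in> ?W" for n :: nat and c e v
      using that by (intro grad_form_sum [OF D' a0]) auto
    show "?E (\<lambda>x. c * u x) v = c * ?E u v" if "u \<in> ?W" "v \<in> ?W" for u v c
      using that by (intro grad_form_scale D' a0 fe_space_H1)
    show "(\<lambda>x. u x - v x) \<in> ?W" if "u \<in> ?W" "v \<in> ?W" for u v
      using that by (rule W_diff)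
    show "(\<lambda>x. c * u x) \<in> ?W" if "u \<in> ?W" for u c
      using that by (rule fe_space_scale [OF D'])
    show "?E (\<lambda>x. u x - v x) z = ?E u z - ?E v z" if "u \<in> ?W" "v \<in> ?W" "z \<in> ?W" for u v z
      using that by (rule E_diff)
    show "?E u v = ?E v u" for u v by (rule grad_form_sym)
    show "?E u u \<ge> 0" if "u \<in> ?W" for u using that by (rule E_nonneg)
    show "u x = 0" if "u \<in> ?W" "?E u u = 0" "x \<in> D" for u x using that by (rule E_zero)
    show "finite V" by (rule V(1))
    show "?E u u = 0" if "u \<in> ?W" "\<And>p. p \<in> V \<Longrightarrow> u p = 0" for u using that by (rule V_zero)
  qed (rule that)
  \<comment> \<open>Synthesis from coordinates; by \<open>E_UU\<close> it carries the Euclidean norm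
    to the energy norm.\<close>
  define U where "U c = (\<lambda>x. \<Sum>j<n. c j * e j x)" for c :: "nat \<Rightarrow> real"
  have U: "U c \<in> ?W" for c unfolding U_def using e by (intro fe_space_sum D') auto
  have form_U: "grad_form D \<alpha> (U c) v = (\<Sum>j<n. c j * grad_form D \<alpha> (e j) v)" if "\<alpha> \<in> Linf D" "v \<in> ?W" for \<alpha> c v
    unfolding U_def using e that by (intro grad_form_sum D') auto
  have E_UU: "?E (U c) (U c) = (\<Sum>j<n. (c j)\<^sup>2)" for c
  proof -
    have "?E (e j) (U c) = c j" if j: "j < n" for j
    proof -
      have "?E (e j) (U c) = (\<Sum>k<n. c k * ?E (e k) (e j))"
        unfolding grad_form_sym [of D "ac 0" "e j" "U c"] by (intro form_U a0 e j)
      also have "\<dots> = (\<Sum>k<n. if k = j then c k else 0)"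
        using orth j by (intro sum.cong) auto
      finally show ?thesis using j by simp
    qed
    then show ?thesis unfolding form_U [OF a0 U] by (simp add: power2_eq_square)
  qed
  \<comment> \<open>Row \<open>j\<close> belongs to the test function \<open>e j\<close>, column
    \<open>l\<close> to the trial function \<open>e l\<close>; \<open>F\<close> below is the load
    vector.\<close>
  define A where "A m j l = grad_form D (ac m) (e l) (e j)" for m j l
  define Q where "Q m c = grad_form D (\<lambda>x. \<bar>ac m x\<bar>) (U c) (U c)" for m c
  define F where "F j = (LINT x|lebesgue_on D. f x * e j x)" for j
  have form_UU: "(\<Sum>j<n. \<Sum>l<n. c j * d l * A m j l) = grad_form D (ac m) (U d) (U c)" if m: "m \<in> {1..M}" for m c d
  proof -
    have "grad_form D (ac m) (e l) (U c) = (\<Sum>j<n. c j * A m j l)" if l: "l < n" for l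
    proof -
      have "grad_form D (ac m) (e l) (U c) = (\<Sum>j<n. c j * grad_form D (ac m) (e j) (e l))"
        unfolding grad_form_sym [of D "ac m" "e l" "U c"] by (rule form_U [OF am [OF m] e [OF l]])
      also have "\<dots> = (\<Sum>j<n. c j * A m j l)"
        unfolding A_def by (intro sum.cong refl arg_cong2 [where f = "(*)"] grad_form_sym)
      finally show ?thesis .
    qed
    then have "grad_form D (ac m) (U d) (U c) = (\<Sum>l<n. \<Sum>j<n. c j * d l * A m j l)"
      unfolding form_U [OF am [OF m] U] by (simp add: sum_distrib_left mult_ac)
    also have "\<dots> = (\<Sum>j<n. \<Sum>l<n. c j * d l * A m j l)" by (rule sum.swap)
    finally show ?thesis by simp
  qed
  interpret affine_system n M A Q F \<rho> \<theta>
  proof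
    show "\<rho> m > 1" if "m \<in> {1..M}" for m using \<rho> that .
    show "\<theta> < 1" by (rule \<theta>)
    show "\<bar>\<Sum>j<n. \<Sum>l<n. c j * d l * A m j l\<bar> \<le> (Q m c + Q m d) / 2" if m: "m \<in> {1..M}" for m c d
      unfolding form_UU [OF m] Q_def
      using grad_form_abs_le [OF am [OF m] fe_space_H1 [OF U] fe_space_H1 [OF U], of d c]
      by (simp only: add.commute)
    show "(\<Sum>m=1..M. \<rho> m * Q m c) \<le> \<theta> * (\<Sum>j<n. (c j)\<^sup>2)" for c
    proof -
      have l: "(\<lambda>x. \<rho> m * \<bar>ac m x\<bar>) \<in> Linf D" if "m \<in> {1..M}" for m
        by (intro Linf_scale Linf_abs am that)
      have "(\<Sum>m=1..M. \<rho> m * Q m c) = (\<Sum>m=1..M. grad_form D (\<lambda>x. \<rho> m * \<bar>ac m x\<bar>) (U c) (U c))"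
        unfolding Q_def grad_form_coeff_scale ..
      also have "\<dots> = grad_form D (\<lambda>x. \<Sum>m=1..M. \<rho> m * \<bar>ac m x\<bar>) (U c) (U c)"
        by (intro grad_form_coeff_sum [symmetric] l fe_space_H1 [OF U])
      also have "\<dots> \<le> grad_form D (\<lambda>x. \<theta> * ac 0 x) (U c) (U c)"
        by (intro grad_form_mono Linf_sum l Linf_scale a0 fe_space_H1 [OF U] dom)
      also have "\<dots> = \<theta> * (\<Sum>j<n. (c j)\<^sup>2)"
        by (simp add: grad_form_coeff_scale E_UU)
      finally show ?thesis .
    qed
  qed
  have series: "((\<lambda>i. U (coeff i) x * multi_power M y i) has_sum w y x) (multi_indices M)"
    if y: "y \<in> param_domain M" and x: "x \<in> D" for x y
  proof -
    have wy: "w y \<in> ?W" using w y by (simp add: semidiscrete_solution_def)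
    \<comment> \<open>These are the coordinates of the solution and, at the same time, the
      contribution of \<open>ac 0\<close> to the equation tested with \<open>e j\<close>.\<close>
    define c where "c j = ?E (w y) (e j)" for j
    have w_U: "w y x = U c x" if "x \<in> D" for x
      using basis [OF wy that] by (simp add: U_def c_def)
    have "c j + (\<Sum>m=1..M. y m * (\<Sum>l<n. A m j l * c l)) = F j" if j: "j < n" for j
    proof -
      have H: "w y \<in> H1 D" "e j \<in> H1 D" using wy e [OF j] by (auto intro: fe_space_H1)
      have ym: "(\<lambda>x. y m * ac m x) \<in> Linf D" if "m \<in> {1..M}" for m
        by (intro Linf_scale am that)
      have "F j = (LINT x|lebesgue_on D. a x y * (weak_gradient D (w y) x \<bullet> weak_gradient D (e j) x))"
        unfolding F_def using w y e [OF j] by (simp add: semidiscrete_solution_def)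
      also have "\<dots> = grad_form D (\<lambda>x. ac 0 x + (\<Sum>m=1..M. y m * ac m x)) (w y) (e j)"
        unfolding grad_form_def using affine y
        by (intro Bochner_Integration.integral_cong) (auto simp: mult.commute)
      also have "\<dots> = c j + grad_form D (\<lambda>x. \<Sum>m=1..M. y m * ac m x) (w y) (e j)"
        unfolding c_def by (intro grad_form_coeff_add a0 Linf_sum ym H)
      also have "grad_form D (\<lambda>x. \<Sum>m=1..M. y m * ac m x) (w y) (e j) = (\<Sum>m=1..M. y m * grad_form D (ac m) (w y) (e j))"
        unfolding grad_form_coeff_scale [symmetric] by (intro grad_form_coeff_sum ym H)
      also have "\<dots> = (\<Sum>m=1..M. y m * (\<Sum>l<n. A m j l * c l))"
      proof (intro sum.cong refl arg_cong2 [where f = "(*)"])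
        fix m assume m: "m \<in> {1..M}"
        have "grad_form D (ac m) (w y) (e j) = grad_form D (ac m) (U c) (e j)"
          by (intro grad_form_cong w_U)
        also have "\<dots> = (\<Sum>l<n. A m j l * c l)"
          unfolding form_U [OF am [OF m] e [OF j]] A_def by (simp add: mult.commute)
        finally show "grad_form D (ac m) (w y) (e j) = (\<Sum>l<n. A m j l * c l)" .
      qed
      finally show ?thesis by simp
    qed
    then have "((\<lambda>i. coeff i j * multi_power M y i) has_sum c j) (multi_indices M)" if "j < n" for j
      using that by (intro solution_power_series y)
    \<comment> \<open>At a fixed \<open>x\<close> the values of the basis are numbers, so the
      coordinate series combine to a series for the point value.\<close>
    then have "((\<lambda>i. \<Sum>j<n. e j x * (coeff i j * multi_power M y i)) has_sum (\<Sum>j<n. e j x * c j)) (multi_indices M)"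
      by (intro has_sum_sum_finite has_sum_cmult_right) auto
    then show ?thesis
      unfolding w_U [OF x] U_def by (simp add: sum_distrib_right sum_distrib_left mult_ac)
  qed
  have taylor: "taylor_coeff M w i x = U (coeff i) x" if i: "i \<in> multi_indices M" and x: "x \<in> D" for i x
  proof -
    have "mixed_partial M i (\<lambda>y. w y x) (\<lambda>m\<in>{1..M}. 0) = multi_fact M i * U (coeff i) x"
      by (intro mixed_partial_power_series series x i)
    moreover have "multi_fact M i \<noteq> 0" by (simp add: multi_fact_def)
    ultimately show ?thesis by (simp add: taylor_coeff_def)
  qed
  \<comment> \<open>By orthonormality \<open>energy i\<close> is the weighted energy of
    \<open>U (coeff i)\<close>, and coercivity converts energy into gradient norm.\<close>
  have term_le: "(multi_power M \<rho> i * X_norm D (taylor_coeff M w i))\<^sup>2 \<le> energy i / r" if i: "i \<in> multi_indices M" for i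
  proof -
    have "weak_gradient D (taylor_coeff M w i) = weak_gradient D (U (coeff i))"
      by (intro weak_gradient_cong taylor i)
    then have "(X_norm D (taylor_coeff M w i))\<^sup>2 = sq_int D (weak_gradient D (U (coeff i)))"
      by (simp only: X_norm_def L2_norm_on_square)
    also have "\<dots> \<le> (\<Sum>j<n. (coeff i j)\<^sup>2) / r"
      using coercive [OF U, of "coeff i"] r(1) by (simp add: E_UU pos_le_divide_eq mult.commute)
    finally have "(multi_power M \<rho> i)\<^sup>2 * (X_norm D (taylor_coeff M w i))\<^sup>2 \<le>
        (multi_power M \<rho> i)\<^sup>2 * ((\<Sum>j<n. (coeff i j)\<^sup>2) / r)"
      by (intro mult_left_mono) auto
    then show ?thesis by (simp add: energy_def power_mult_distrib sum_distrib_left)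
  qed
  have F_le: "(\<Sum>j<n. (F j)\<^sup>2) \<le> 16 * R\<^sup>2 / r * sq_int D f"
  proof -
    \<comment> \<open>The sum of the squared loads equals the integral of f times
      \<open>U F\<close>. With Young's parameter equal to the Poincare constant divided by
      \<open>r\<close>, the second term is at most that same sum and is absorbed.\<close>
    let ?s = "16 * R\<^sup>2 / r"
    have s: "?s > 0" using R r(1) by simp
    have eL: "e j \<in> L2 D" if "j < n" for j using e [OF that] by (intro H1_L2 fe_space_H1)
    have UL: "U F \<in> L2 D" by (intro H1_L2 fe_space_H1 [OF U])
    have "(\<Sum>j<n. (F j)\<^sup>2) = (\<Sum>j<n. F j * (LINT x|lebesgue_on D. f x * e j x))"
      by (simp add: F_def power2_eq_square)
    also have "\<dots> = (\<Sum>j<n. (LINT x|lebesgue_on D. F j * (f x * e j x)))"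
      by simp
    also have "\<dots> = (LINT x|lebesgue_on D. (\<Sum>j<n. F j * (f x * e j x)))"
      using eL
      by (intro Bochner_Integration.integral_sum [symmetric] integrable_mult_right L2_integrable_mult f) auto
    also have "\<dots> = (LINT x|lebesgue_on D. f x * U F x)"
      by (simp add: U_def sum_distrib_left mult_ac)
    finally have "2 * (\<Sum>j<n. (F j)\<^sup>2) \<le> ?s * sq_int D f + sq_int D (U F) / ?s"
      using L2_mult_young [OF f UL s] by simp
    moreover have "sq_int D (U F) \<le> ?s * (\<Sum>j<n. (F j)\<^sup>2)"
    proof -
      have "sq_int D (U F) \<le> 16 * R\<^sup>2 * sq_int D (weak_gradient D (U F))"
        by (rule poincare_H10 [OF D fe_space_H10 [OF U]])
      also have "\<dots> \<le> 16 * R\<^sup>2 * ((\<Sum>j<n. (F j)\<^sup>2) / r)"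
        using coercive [OF U, of F] r(1)
        by (intro mult_left_mono) (simp_all add: E_UU pos_le_divide_eq mult.commute)
      finally show ?thesis by simp
    qed
    then have "sq_int D (U F) / ?s \<le> (\<Sum>j<n. (F j)\<^sup>2)"
      using s by (simp only: pos_divide_le_eq mult.commute)
    ultimately show ?thesis by linarith
  qed
  have fin: "(\<Sum>i\<in>S. (multi_power M \<rho> i * X_norm D (taylor_coeff M w i))\<^sup>2) \<le> C"
    if S: "finite S" "S \<subseteq> multi_indices M" for S
  proof -
    have "(\<Sum>i\<in>S. (multi_power M \<rho> i * X_norm D (taylor_coeff M w i))\<^sup>2) \<le> (\<Sum>i\<in>S. energy i / r)"
      using S by (intro sum_mono term_le) auto
    also have "\<dots> = (\<Sum>i\<in>S. energy i) / r" by (simp add: sum_divide_distrib)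
    also have "\<dots> \<le> ((2 - \<theta>) / (2 - 2 * \<theta>) * (\<Sum>j<n. (F j)\<^sup>2)) / r"
      using r(1) by (intro divide_right_mono energy_sum_bound S) auto
    also have "\<dots> \<le> C"
      unfolding C_def using r(1) \<theta> by (intro divide_right_mono mult_left_mono F_le) auto
    finally show ?thesis .
  qed
  show sm: "(\<lambda>i. (multi_power M \<rho> i * X_norm D (taylor_coeff M w i))\<^sup>2) summable_on multi_indices M"
    using fin by (intro nonneg_bdd_above_summable_on bdd_aboveI2 [where M = C]) auto
  have "(\<Sum>\<^sub>\<infinity>i\<in>multi_indices M. (multi_power M \<rho> i * X_norm D (taylor_coeff M w i))\<^sup>2) \<le> C"
    using sm fin by (rule infsum_le_finite_sums)
  then show "(\<Sum>\<^sub>\<infinity>i\<in>multi_indices M. multi_power M \<rho> (\<lambda>m. 2 * i m) * (X_norm D (taylor_coeff M w i))\<^sup>2) \<le> C"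
    by (simp add: multi_power_double power_mult_distrib)
qed

section \<open>Two-sided bounds for the diffusion coefficient\<close>

lemma coefficient_bounds:
  fixes D :: "'a::euclidean_space set"
  assumes D: "open D" "D \<noteq> {}"
    and P: "\<And>m. m \<in> {1..M} \<Longrightarrow> sets (P m) = sets (restrict_space borel {-1..1::real})"
    and affine: "\<And>x y. x \<in> D \<Longrightarrow> y \<in> param_domain M \<Longrightarrow> a x y = ac 0 x + (\<Sum>m=1..M. ac m x * y m)"
    and Linf: "\<And>m. m \<le> M \<Longrightarrow> ac m \<in> Linf D"
    and r: "r > 0" "\<And>x. x \<in> D \<Longrightarrow> (\<Sum>m=1..M. \<bar>ac m x\<bar>) \<le> ac 0 x - r"
  shows "\<exists>a_min a_max :: real. 0 < a_min \<and> 0 < a_max \<and>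
            (AE y in Pi\<^sub>M {1..M} P.
               ereal a_min \<le> essinf (lebesgue_on D) (\<lambda>x. ereal (a x y)) \<and>
               essinf (lebesgue_on D) (\<lambda>x. ereal (a x y))
                 \<le> esssup (lebesgue_on D) (\<lambda>x. ereal (a x y)) \<and>
               esssup (lebesgue_on D) (\<lambda>x. ereal (a x y)) \<le> ereal a_max)"
proof -
  obtain B where B: "AE x in lebesgue_on D. \<bar>ac 0 x\<bar> \<le> B"
    using Linf [of 0] by (auto simp: Linf_def)
  have space: "space (P m) = {-1..1}" if "m \<in> {1..M}" for m
    using sets_eq_imp_space_eq [OF P [OF that]] by (simp add: space_restrict_space)
  have "ereal r \<le> essinf (lebesgue_on D) (\<lambda>x. ereal (a x y)) \<and>
      essinf (lebesgue_on D) (\<lambda>x. ereal (a x y)) \<le> esssup (lebesgue_on D) (\<lambda>x. ereal (a x y)) \<and>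
      esssup (lebesgue_on D) (\<lambda>x. ereal (a x y)) \<le> ereal (max 1 (2 * B))"
    if "y \<in> space (Pi\<^sub>M {1..M} P)" for y
  proof -
    have y: "y \<in> param_domain M"
      using that space by (auto simp: space_PiM param_domain_def PiE_iff)
    \<comment> \<open>Both bounds come from this: it says r \<le> a \<le> 2 a_0 - r on
      \<open>D\<close>.\<close>
    have dev: "\<bar>a x y - ac 0 x\<bar> \<le> ac 0 x - r" if x: "x \<in> D" for x
    proof -
      have "\<bar>\<Sum>m=1..M. ac m x * y m\<bar> \<le> (\<Sum>m=1..M. \<bar>ac m x * y m\<bar>)" by (rule sum_abs)
      also have "\<dots> \<le> (\<Sum>m=1..M. \<bar>ac m x\<bar>)"
        using y unfolding abs_mult
        by (intro sum_mono mult_left_le) (auto simp: param_domain_def PiE_iff abs_le_iff)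
      also have "\<dots> \<le> ac 0 x - r" by (rule r(2) [OF x])
      finally show ?thesis using affine [OF x y] by simp
    qed
    have "(\<lambda>x. ac 0 x + (\<Sum>m=1..M. ac m x * y m)) \<in> borel_measurable (lebesgue_on D)"
      using Linf
      by (intro borel_measurable_add borel_measurable_sum borel_measurable_times) (auto simp: Linf_def)
    then have "(\<lambda>x. a x y) \<in> borel_measurable (lebesgue_on D)"
      using affine y
      by (subst measurable_cong [where g = "\<lambda>x. ac 0 x + (\<Sum>m=1..M. ac m x * y m)"]) auto
    then have m: "(\<lambda>x. ereal (a x y)) \<in> borel_measurable (lebesgue_on D)" by simp
    have lower: "AE x in lebesgue_on D. ereal r \<le> ereal (a x y)"
      using dev by (intro AE_I2) (fastforce simp: abs_le_iff)
    have "AE x in lebesgue_on D. x \<in> D" by (intro AE_I2) simp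
    \<comment> \<open>The maximum with 1 makes the upper bound positive whatever \<open>B\<close>
      is.\<close>
    with B have upper: "AE x in lebesgue_on D. ereal (a x y) \<le> ereal (max 1 (2 * B))"
    proof eventually_elim
      case (elim x)
      have "a x y \<le> 2 * B" using dev [OF elim(2)] elim(1) r(1) unfolding abs_le_iff by linarith
      then show ?case by (simp add: le_max_iff_disj)
    qed
    \<comment> \<open>The lower limit lies below the upper one for a nontrivial filter, that is,
      when \<open>D\<close> has positive measure.\<close>
    have "\<not> negligible D" using D open_not_negligible by blast
    then have "emeasure (lebesgue_on D) (space (lebesgue_on D)) \<noteq> 0"
      using D by (auto simp: negligible_iff_emeasure0 emeasure_restrict_space)
    then have "ae_filter (lebesgue_on D) \<noteq> bot" by (simp add: ae_filter_eq_bot_iff)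
    then show ?thesis
      using m lower upper
      by (auto simp: essinf_def esssup_def intro!: Liminf_bounded Limsup_bounded Liminf_le_Limsup)
  qed
  then have "AE y in Pi\<^sub>M {1..M} P. ereal r \<le> essinf (lebesgue_on D) (\<lambda>x. ereal (a x y)) \<and>
      essinf (lebesgue_on D) (\<lambda>x. ereal (a x y)) \<le> esssup (lebesgue_on D) (\<lambda>x. ereal (a x y)) \<and>
      esssup (lebesgue_on D) (\<lambda>x. ereal (a x y)) \<le> ereal (max 1 (2 * B))"
    by (rule AE_I2)
  moreover have "0 < max 1 (2 * B)" by simp
  ultimately show ?thesis using r(1) by blast
qed

theorem lemma1:
  fixes D :: "(real ^ 'd) set"
    and M :: nat
    and P :: "nat \<Rightarrow> real measure"
    and f :: "real ^ 'd \<Rightarrow> real"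
    and a :: "real ^ 'd \<Rightarrow> (nat \<Rightarrow> real) \<Rightarrow> real"
    and ac :: "nat \<Rightarrow> real ^ 'd \<Rightarrow> real"
  assumes dim: "CARD('d) = 2 \<or> CARD('d) = 3"
    and D: "polytopal_lipschitz_domain D"
    and M: "M \<ge> 1"
    and P: "\<And>m. m \<in> {1..M} \<Longrightarrow>
              prob_space (P m) \<and> sets (P m) = sets (restrict_space borel {-1..1})"
    and f: "f \<in> L2 D"
    and affine: "\<And>x y. x \<in> D \<Longrightarrow> y \<in> param_domain M \<Longrightarrow>
                   a x y = ac 0 x + (\<Sum>m=1..M. ac m x * y m)"
    and Linf: "\<And>m. m \<le> M \<Longrightarrow> ac m \<in> Linf D"
    and elliptic: "\<exists>r>0. \<forall>x\<in>D. (\<Sum>m=1..M. \<bar>ac m x\<bar>) \<le> ac 0 x - r"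
  shows "(\<exists>a_min a_max :: real. 0 < a_min \<and> 0 < a_max \<and>
            (AE y in Pi\<^sub>M {1..M} P.
               ereal a_min \<le> essinf (lebesgue_on D) (\<lambda>x. ereal (a x y)) \<and>
               essinf (lebesgue_on D) (\<lambda>x. ereal (a x y))
                 \<le> esssup (lebesgue_on D) (\<lambda>x. ereal (a x y)) \<and>
               esssup (lebesgue_on D) (\<lambda>x. ereal (a x y)) \<le> ereal a_max)) \<and>
         (\<exists>(\<rho> :: nat \<Rightarrow> real) (C :: real). (\<forall>m\<in>{1..M}. \<rho> m > 1) \<and>
            (\<forall>\<T>0 \<T> w. initial_mesh D \<T>0 \<longrightarrow> admissible_mesh D \<T>0 \<T> \<longrightarrow>
               semidiscrete_solution D M a f (fe_space D \<T>) w \<longrightarrow>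
               (\<lambda>i. (multi_power M \<rho> i * X_norm D (taylor_coeff M w i))\<^sup>2)
                 summable_on multi_indices M \<and>
               (\<Sum>\<^sub>\<infinity>i\<in>multi_indices M.
                  multi_power M \<rho> (\<lambda>m. 2 * i m) * (X_norm D (taylor_coeff M w i))\<^sup>2) \<le> C))"
proof -
  have D': "open D" "bounded D" "D \<noteq> {}" using D by (auto simp: polytopal_lipschitz_domain_def)
  obtain r where r: "r > 0" "\<And>x. x \<in> D \<Longrightarrow> (\<Sum>m=1..M. \<bar>ac m x\<bar>) \<le> ac 0 x - r"
    using elliptic by blast
  have a0: "r \<le> ac 0 x" if "x \<in> D" for x
  proof -
    have "0 \<le> (\<Sum>m=1..M. \<bar>ac m x\<bar>)" by (intro sum_nonneg) simp
    with r(2) [OF that] show ?thesis by linarith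
  qed
  obtain R0 where R0: "\<And>x. x \<in> D \<Longrightarrow> norm x \<le> R0" using D'(2) by (auto simp: bounded_iff)
  define R where "R = max 1 R0"
  have R: "R > 0" "D \<subseteq> cball 0 R" using R0 by (force simp: R_def)+
  obtain K0 where K0: "AE x in lebesgue_on D. \<bar>ac 0 x\<bar> \<le> K0"
    using Linf [of 0] by (auto simp: Linf_def)
  \<comment> \<open>An upper bound for a_0 almost everywhere; the maximum with 2 r keeps r / K \<le>
    1/2, so that \<theta>' stays positive and can be divided by.\<close>
  define K where "K = max K0 (2 * r)"
  have K: "K \<ge> 2 * r" "K > 0" using r(1) by (auto simp: K_def)
  \<comment> \<open>From a_0 \<le> K follows a_0 - r \<le> (1 - r / K) a_0: the additive gap of the
    ellipticity assumption becomes a factor below 1.\<close>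
  define \<theta>' where "\<theta>' = 1 - r / K"
  define \<theta> where "\<theta> = (1 + \<theta>') / 2"
  have \<theta>': "0 < \<theta>'" "\<theta>' < 1" using K r(1) by (auto simp: \<theta>'_def)
  have \<theta>: "\<theta>' < \<theta>" "\<theta> < 1" using \<theta>' by (auto simp: \<theta>_def)
  \<comment> \<open>The same weight serves in every direction. As \<theta> lies halfway between
    \<theta>' and 1, the quotient exceeds 1 and raises the factor \<theta>' exactly to
    \<theta>.\<close>
  define \<rho> where "\<rho> = (\<lambda>m::nat. \<theta> / \<theta>')"
  have \<rho>: "\<rho> m > 1" for m using \<theta> \<theta>' by (simp add: \<rho>_def)
  have "AE x in lebesgue_on D. x \<in> D" by (intro AE_I2) simp
  with K0 have dom: "AE x in lebesgue_on D. (\<Sum>m=1..M. \<rho> m * \<bar>ac m x\<bar>) \<le> \<theta> * ac 0 x"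
  proof eventually_elim
    case (elim x)
    have "ac 0 x \<le> K" using elim(1) by (simp add: K_def)
    then have "r * ac 0 x \<le> r * K" using r(1) by simp
    then have "r / K * ac 0 x \<le> r" using K(2) by (simp add: field_simps)
    then have "(\<Sum>m=1..M. \<bar>ac m x\<bar>) \<le> \<theta>' * ac 0 x"
      using r(2) [OF elim(2)] by (simp add: \<theta>'_def left_diff_distrib)
    then have "\<theta> / \<theta>' * (\<Sum>m=1..M. \<bar>ac m x\<bar>) \<le> \<theta> / \<theta>' * (\<theta>' * ac 0 x)"
      using \<theta> \<theta>' by (intro mult_left_mono) auto
    then show ?case using \<theta>' by (simp add: \<rho>_def sum_distrib_left)
  qed
  have bound: "(\<lambda>i. (multi_power M \<rho> i * X_norm D (taylor_coeff M w i))\<^sup>2) summable_on multi_indices M \<and>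
      (\<Sum>\<^sub>\<infinity>i\<in>multi_indices M. multi_power M \<rho> (\<lambda>m. 2 * i m) * (X_norm D (taylor_coeff M w i))\<^sup>2) \<le>
        (2 - \<theta>) / (2 - 2 * \<theta>) * (16 * R\<^sup>2 / r * sq_int D f) / r"
    if "admissible_mesh D \<T>0 \<T>" "semidiscrete_solution D M a f (fe_space D \<T>) w" for \<T>0 \<T> w
  proof -
    have mesh: "conforming_mesh D \<T>" using that(1) by (simp add: admissible_mesh_def)
    show ?thesis
      using taylor_coeff_summable [OF D'(1,2) R(2,1) mesh f affine Linf r(1) a0 \<rho> \<theta>(2) dom that(2)] by blast
  qed
  show ?thesis
  proof (intro conjI)
    show "\<exists>a_min a_max :: real. 0 < a_min \<and> 0 < a_max \<and>
            (AE y in Pi\<^sub>M {1..M} P.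
               ereal a_min \<le> essinf (lebesgue_on D) (\<lambda>x. ereal (a x y)) \<and>
               essinf (lebesgue_on D) (\<lambda>x. ereal (a x y))
                 \<le> esssup (lebesgue_on D) (\<lambda>x. ereal (a x y)) \<and>
               esssup (lebesgue_on D) (\<lambda>x. ereal (a x y)) \<le> ereal a_max)"
      using P by (intro coefficient_bounds [where ac = ac and M = M and r = r] D' affine Linf r) auto
  next
    show "\<exists>(\<rho> :: nat \<Rightarrow> real) (C :: real). (\<forall>m\<in>{1..M}. \<rho> m > 1) \<and>
            (\<forall>\<T>0 \<T> w. initial_mesh D \<T>0 \<longrightarrow> admissible_mesh D \<T>0 \<T> \<longrightarrow>
               semidiscrete_solution D M a f (fe_space D \<T>) w \<longrightarrow>
               (\<lambda>i. (multi_power M \<rho> i * X_norm D (taylor_coeff M w i))\<^sup>2)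
                 summable_on multi_indices M \<and>
               (\<Sum>\<^sub>\<infinity>i\<in>multi_indices M.
                  multi_power M \<rho> (\<lambda>m. 2 * i m) * (X_norm D (taylor_coeff M w i))\<^sup>2) \<le> C)"
      using \<rho> bound by blast
  qed
qed

end
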